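(* Let $(\mathcal{G},\mu)$ be a p.m.p. groupoid which is sofic and has infinite classes. Then $\underline{s}(\mathcal{G})\ge 1$.
   Context: A discrete measurable groupoid is a groupoid $\mathcal{G}$ (source map $\mathfrak{s}$, range map $\mathfrak{r}$, unit space $\mathcal{G}^0$; $xy$ is defined when $\mathfrak{s}(x)=\mathfrak{r}(y)$) with the structure of a standard Borel space such that $\mathcal{G}^0$ is Borel, the source, range, multiplication and inversion maps are Borel, and $\mathfrak{s}^{-1}(x)$ is countable for every $x\in\mathcal{G}^0$. A probability-measure-preserving (p.m.p.) groupoid is a discrete measurable groupoid together with a Borel probability measure $\mu$ on $\mathcal{G}^0$ such that $\int_{\mathcal{G}^0}|\mathfrak{s}^{-1}(x)\cap B|\,d\mu(x)=\int_{\mathcal{G}^0}|\mathfrak{r}^{-1}(x)\cap B|\,d\mu(x)$ for every Borel $B\subseteq\mathcal{G}$; this common value defines a $\sigma$-finite Borel measure on $\mathcal{G}$, again denoted $\mu$. $\mathcal{G}$ has infinite classes if $\mathfrak{s}^{-1}(\{x\})$ is infinite (equivalently $\mathfrak{r}^{-1}(\{x\})$ is infinite) for $\mu$-almost every $x\in\mathcal{G}^0$. For a Borel set $B\subseteq\mathcal{G}$ on which $\mathfrak{s}$ and $\mathfrak{r}$ are injective, $s_B$ is the partial isometry on $L^2(\mathcal{G},\mu)$ given by $s_B\xi(x)=\xi(y^{-1})$ if $y$ is the element of $\mathfrak{r}^{-1}(\mathfrak{s}(x))$ with $xy\in B$, and $s_B\xi(x)=0$ if there is no such $y$. $I_{\mathcal{G}}$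 is the set of all such $s_B$; it is an inverse semigroup with inverse $s\mapsto s^*$. $\mathrm{VN}(\mathcal{G})$ is the von Neumann algebra generated by $I_{\mathcal{G}}$, with trace $\tau(a)=\langle a1_{\mathcal{G}^0},1_{\mathcal{G}^0}\rangle$ and $\|a\|_2=\tau(a^*a)^{1/2}$. $I_d$ is the set of partial permutation matrices in $M_d=M_d(\mathbb{C})$ (partial isometries with all entries $0$ or $1$), $\mathrm{tr}$ is the normalized trace on $M_d$, and $\|a\|_2=\mathrm{tr}(a^*a)^{1/2}$ on $M_d$. For $\Omega\subseteq I_{\mathcal{G}}$: $\Omega^*=\{s^*:s\in\Omega\}$; $\Omega^n$ is the set of products $s_1\cdots s_n$ with $s_i\in\Omega$; $\Omega^{\le n}=\bigcup_{k=1}^n\Omega^k$; $[\Omega]$ is the linear span of $\Omega$ in $\mathrm{VN}(\mathcal{G})$. For a finite set $F\subseteq I_{\mathcal{G}}$, $n,d\in\mathbb{N}$ and $\delta>0$, $\mathrm{SA}(F,n,\delta,d)$ is the set of all linear maps $\varphi:[I_{\mathcal{G}}]\to M_d$ such that (1) $\|\varphi(s_1\cdots s_k)-\varphi(s_1)\cdots\varphi(s_k)\|_2<\delta$ for all $k=1,\dots,n$ and $s_1,\dots,s_k\in F\cup F^*$, (2) $\varphi((F\cup F^* )^{\le n})\subseteq I_d$, (3) $|\mathrm{tr}\circ\varphi(s)-\tau(s)|<\delta$ for all $s\in(F\cup F^* )^{\le n}$. For a set $\mathcal{Y}$ of maps, $|\mathcal{Y}|_E$ denotes the cardinality of the set of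 restrictions $\{\varphi|_E:\varphi\in\mathcal{Y}\}$. $\mathcal{G}$ is sofic if for all finite $F\subseteq I_{\mathcal{G}}$, $n\in\mathbb{N}$ and $\delta>0$ the set $\mathrm{SA}(F,n,\delta,d)$ is nonempty for some $d\in\mathbb{N}$. For finite $E,F\subseteq I_{\mathcal{G}}$ set $\underline{s}_E(F,n,\delta)=\liminf_{d\to\infty}\frac{1}{d\log d}\log|\mathrm{SA}(F,n,\delta,d)|_E$ (with $\log 0=-\infty$), $\underline{s}_E(F,n)=\inf_{\delta>0}\underline{s}_E(F,n,\delta)$, $\underline{s}_E(F)=\inf_{n\in\mathbb{N}}\underline{s}_E(F,n)$. The lower sofic dimension is $\underline{s}(\mathcal{G})=\sup_E\inf_F\underline{s}_E(F)$, where $E$ and $F$ range over the finite subsets of $I_{\mathcal{G}}$. *)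

theory Defs
  imports "HOL-Probability.Probability_Measure" "Jordan_Normal_Form.Schur_Decomposition"
begin

section \<open>Groupoids\<close>

text \<open>The Borel structure on the set of arrows is carried by a value of type \<^typ>\<open>'g measure\<close> of
  which only \<^const>\<open>space\<close> and \<^const>\<open>sets\<close> are used.\<close>

record 'g groupoid_data =
  arrows :: "'g measure"
  units :: "'g set"
  src :: "'g \<Rightarrow> 'g"
  rng :: "'g \<Rightarrow> 'g"
  gmult :: "'g \<Rightarrow> 'g \<Rightarrow> 'g"
  ginv :: "'g \<Rightarrow> 'g"

definition composable :: "'g groupoid_data \<Rightarrow> ('g \<times> 'g) set" where
  "composable G =
    {(x, y). x \<in> space (arrows G) \<and> y \<in> space (arrows G) \<and> src G x = rng G y}"

locale groupoid =
  fixes G :: "'g groupoid_data"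
  assumes units_subset: "units G \<subseteq> space (arrows G)"
    and src_closed: "\<And>x. x \<in> space (arrows G) \<Longrightarrow> src G x \<in> units G"
    and rng_closed: "\<And>x. x \<in> space (arrows G) \<Longrightarrow> rng G x \<in> units G"
    and mult_closed: "\<And>x y. (x, y) \<in> composable G \<Longrightarrow> gmult G x y \<in> space (arrows G)"
    and inv_closed: "\<And>x. x \<in> space (arrows G) \<Longrightarrow> ginv G x \<in> space (arrows G)"
    and src_unit: "\<And>x. x \<in> units G \<Longrightarrow> src G x = x"
    and rng_unit: "\<And>x. x \<in> units G \<Longrightarrow> rng G x = x"
    and src_mult: "\<And>x y. (x, y) \<in> composable G \<Longrightarrow> src G (gmult G x y) = src G y"
    and rng_mult: "\<And>x y. (x, y) \<in> composable G \<Longrightarrow> rng G (gmult G x y) = rng G x"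
    and mult_assoc: "\<And>x y z. (x, y) \<in> composable G \<Longrightarrow> (y, z) \<in> composable G \<Longrightarrow>
          gmult G (gmult G x y) z = gmult G x (gmult G y z)"
    and mult_src: "\<And>x. x \<in> space (arrows G) \<Longrightarrow> gmult G x (src G x) = x"
    and rng_mult_left: "\<And>x. x \<in> space (arrows G) \<Longrightarrow> gmult G (rng G x) x = x"
    and src_inv: "\<And>x. x \<in> space (arrows G) \<Longrightarrow> src G (ginv G x) = rng G x"
    and rng_inv: "\<And>x. x \<in> space (arrows G) \<Longrightarrow> rng G (ginv G x) = src G x"
    and inv_mult: "\<And>x. x \<in> space (arrows G) \<Longrightarrow> gmult G (ginv G x) x = src G x"
    and mult_inv: "\<And>x. x \<in> space (arrows G) \<Longrightarrow> gmult G x (ginv G x) = rng G x"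

definition standard_borel :: "'a measure \<Rightarrow> bool" where
  "standard_borel M \<longleftrightarrow> (\<exists>T. completely_metrizable_space T \<and> second_countable T \<and>
     topspace T = space M \<and> sets M = sigma_sets (topspace T) {U. openin T U})"

definition src_fibre :: "'g groupoid_data \<Rightarrow> 'g \<Rightarrow> 'g set" where
  "src_fibre G x = {y \<in> space (arrows G). src G y = x}"

definition rng_fibre :: "'g groupoid_data \<Rightarrow> 'g \<Rightarrow> 'g set" where
  "rng_fibre G x = {y \<in> space (arrows G). rng G y = x}"

locale discrete_measurable_groupoid = groupoid +
  assumes standard_borel: "standard_borel (arrows G)"
    and units_borel: "units G \<in> sets (arrows G)"
    and src_borel: "src G \<in> arrows G \<rightarrow>\<^sub>M arrows G"
    and rng_borel: "rng G \<in> arrows G \<rightarrow>\<^sub>M arrows G"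
    and mult_borel: "(\<lambda>(x, y). gmult G x y)
          \<in> restrict_space (arrows G \<Otimes>\<^sub>M arrows G) (composable G) \<rightarrow>\<^sub>M arrows G"
    and inv_borel: "ginv G \<in> arrows G \<rightarrow>\<^sub>M arrows G"
    and countable_src_fibre: "\<And>x. x \<in> units G \<Longrightarrow> countable (src_fibre G x)"

text \<open>\<^term>\<open>emeasure (count_space UNIV) A\<close> is the cardinality of \<^term>\<open>A\<close>, with value
  \<^term>\<open>\<infinity>\<close> for infinite sets.\<close>

locale pmp_groupoid = discrete_measurable_groupoid G + prob_space \<mu>
  for G :: "'g groupoid_data" and \<mu> :: "'g measure" +
  assumes space_mu: "space \<mu> = units G"
    and sets_mu: "sets \<mu> = sets (restrict_space (arrows G) (units G))"
    and measure_preserving: "\<And>B. B \<in> sets (arrows G) \<Longrightarrow>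
          (\<integral>\<^sup>+ x. emeasure (count_space UNIV) (src_fibre G x \<inter> B) \<partial>\<mu>)
            = (\<integral>\<^sup>+ x. emeasure (count_space UNIV) (rng_fibre G x \<inter> B) \<partial>\<mu>)"

definition arrow_measure :: "'g groupoid_data \<Rightarrow> 'g measure \<Rightarrow> 'g measure" where
  "arrow_measure G \<mu> = measure_of (space (arrows G)) (sets (arrows G))
     (\<lambda>B. \<integral>\<^sup>+ x. emeasure (count_space UNIV) (src_fibre G x \<inter> B) \<partial>\<mu>)"

definition infinite_classes :: "'g groupoid_data \<Rightarrow> 'g measure \<Rightarrow> bool" where
  "infinite_classes G \<mu> \<longleftrightarrow> (AE x in \<mu>. infinite (src_fibre G x))"

section \<open>Operators on the complex Hilbert space of square integrable functions\<close>

text \<open>A vector of the Hilbert space is an almost-everywhere class of square integrable functions,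
  represented by the set of all its members; an operator is a function on such classes which is
  \<^const>\<open>undefined\<close> outside the space, so that equality of operators is equality in HOL.\<close>

type_synonym 'a l2 = "('a \<Rightarrow> complex) set"
type_synonym 'a l2op = "'a l2 \<Rightarrow> 'a l2"

definition square_integrable :: "'a measure \<Rightarrow> ('a \<Rightarrow> complex) set" where
  "square_integrable M =
    {f \<in> borel_measurable M. integrable M (\<lambda>x. (cmod (f x))\<^sup>2)}"

definition l2_class :: "'a measure \<Rightarrow> ('a \<Rightarrow> complex) \<Rightarrow> 'a l2" where
  "l2_class M f = {g \<in> square_integrable M. AE x in M. g x = f x}"

definition L2 :: "'a measure \<Rightarrow> 'a l2 set" where
  "L2 M = l2_class M ` square_integrable M"

definition l2_rep :: "'a l2 \<Rightarrow> 'a \<Rightarrow> complex" where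
  "l2_rep X = (SOME f. f \<in> X)"

definition l2_add :: "'a measure \<Rightarrow> 'a l2 \<Rightarrow> 'a l2 \<Rightarrow> 'a l2" where
  "l2_add M X Y = l2_class M (\<lambda>x. l2_rep X x + l2_rep Y x)"

definition l2_scale :: "'a measure \<Rightarrow> complex \<Rightarrow> 'a l2 \<Rightarrow> 'a l2" where
  "l2_scale M c X = l2_class M (\<lambda>x. c * l2_rep X x)"

definition l2_inner :: "'a measure \<Rightarrow> 'a l2 \<Rightarrow> 'a l2 \<Rightarrow> complex" where
  "l2_inner M X Y = (\<integral>x. l2_rep X x * cnj (l2_rep Y x) \<partial>M)"

definition l2_norm :: "'a measure \<Rightarrow> 'a l2 \<Rightarrow> real" where
  "l2_norm M X = sqrt (Re (l2_inner M X X))"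

definition bounded_ops :: "'a measure \<Rightarrow> 'a l2op set" where
  "bounded_ops M = {a \<in> L2 M \<rightarrow>\<^sub>E L2 M.
     (\<forall>X\<in>L2 M. \<forall>Y\<in>L2 M. a (l2_add M X Y) = l2_add M (a X) (a Y)) \<and>
     (\<forall>c. \<forall>X\<in>L2 M. a (l2_scale M c X) = l2_scale M c (a X)) \<and>
     (\<exists>C. \<forall>X\<in>L2 M. l2_norm M (a X) \<le> C * l2_norm M X)}"

definition op_add :: "'a measure \<Rightarrow> 'a l2op \<Rightarrow> 'a l2op \<Rightarrow> 'a l2op" where
  "op_add M a b = (\<lambda>X\<in>L2 M. l2_add M (a X) (b X))"

definition op_scale :: "'a measure \<Rightarrow> complex \<Rightarrow> 'a l2op \<Rightarrow> 'a l2op" where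
  "op_scale M c a = (\<lambda>X\<in>L2 M. l2_scale M c (a X))"

definition op_mult :: "'a measure \<Rightarrow> 'a l2op \<Rightarrow> 'a l2op \<Rightarrow> 'a l2op" where
  "op_mult M a b = (\<lambda>X\<in>L2 M. a (b X))"

definition op_prod :: "'a measure \<Rightarrow> 'a l2op list \<Rightarrow> 'a l2op" where
  "op_prod M as = foldr (op_mult M) as (\<lambda>X\<in>L2 M. X)"

definition op_adjoint :: "'a measure \<Rightarrow> 'a l2op \<Rightarrow> 'a l2op" where
  "op_adjoint M a = (THE b. b \<in> bounded_ops M \<and>
     (\<forall>X\<in>L2 M. \<forall>Y\<in>L2 M. l2_inner M (a X) Y = l2_inner M X (b Y)))"

definition commutant :: "'a measure \<Rightarrow> 'a l2op set \<Rightarrow> 'a l2op set" where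
  "commutant M S = {b \<in> bounded_ops M. \<forall>a\<in>S. op_mult M a b = op_mult M b a}"

definition von_neumann_algebra :: "'a measure \<Rightarrow> 'a l2op set \<Rightarrow> bool" where
  "von_neumann_algebra M A \<longleftrightarrow> A \<subseteq> bounded_ops M \<and> op_adjoint M ` A \<subseteq> A \<and>
     commutant M (commutant M A) = A"

definition op_subspace :: "'a measure \<Rightarrow> 'a l2op set \<Rightarrow> bool" where
  "op_subspace M V \<longleftrightarrow> V \<noteq> {} \<and> (\<forall>a\<in>V. \<forall>b\<in>V. op_add M a b \<in> V) \<and>
     (\<forall>c. \<forall>a\<in>V. op_scale M c a \<in> V)"

definition op_power :: "'a measure \<Rightarrow> 'a l2op set \<Rightarrow> nat \<Rightarrow> 'a l2op set" where
  "op_power M \<Omega> n = {op_prod M ss | ss. length ss = n \<and> set ss \<subseteq> \<Omega>}"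

definition op_power_le :: "'a measure \<Rightarrow> 'a l2op set \<Rightarrow> nat \<Rightarrow> 'a l2op set" where
  "op_power_le M \<Omega> n = (\<Union>k\<in>{1..n}. op_power M \<Omega> k)"

section \<open>The von Neumann algebra of a groupoid\<close>

text \<open>If \<^term>\<open>rng G\<close> is injective on \<^term>\<open>B\<close>, there is at most one \<open>y\<close> as below.\<close>

definition bisection_action ::
    "'g groupoid_data \<Rightarrow> 'g set \<Rightarrow> ('g \<Rightarrow> complex) \<Rightarrow> 'g \<Rightarrow> complex" where
  "bisection_action G B \<xi> x =
    (if \<exists>y\<in>rng_fibre G (src G x). gmult G x y \<in> B
     then \<xi> (ginv G (THE y. y \<in> rng_fibre G (src G x) \<and> gmult G x y \<in> B))
     else 0)"

definition bisection_op :: "'g groupoid_data \<Rightarrow> 'g measure \<Rightarrow> 'g set \<Rightarrow> 'g l2op" where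
  "bisection_op G \<mu> B = (\<lambda>X\<in>L2 (arrow_measure G \<mu>).
     l2_class (arrow_measure G \<mu>) (bisection_action G B (l2_rep X)))"

definition I_groupoid :: "'g groupoid_data \<Rightarrow> 'g measure \<Rightarrow> 'g l2op set" where
  "I_groupoid G \<mu> = bisection_op G \<mu> `
     {B \<in> sets (arrows G). inj_on (src G) B \<and> inj_on (rng G) B}"

definition VN :: "'g groupoid_data \<Rightarrow> 'g measure \<Rightarrow> 'g l2op set" where
  "VN G \<mu> = \<Inter>{A. von_neumann_algebra (arrow_measure G \<mu>) A \<and> I_groupoid G \<mu> \<subseteq> A}"

definition vn_trace :: "'g groupoid_data \<Rightarrow> 'g measure \<Rightarrow> 'g l2op \<Rightarrow> complex" where
  "vn_trace G \<mu> a =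
    (let M = arrow_measure G \<mu>; e = l2_class M (indicator (units G)) in l2_inner M (a e) e)"

definition vn_span :: "'g groupoid_data \<Rightarrow> 'g measure \<Rightarrow> 'g l2op set \<Rightarrow> 'g l2op set" where
  "vn_span G \<mu> \<Omega> = \<Inter>{V. op_subspace (arrow_measure G \<mu>) V \<and> \<Omega> \<subseteq> V \<and> V \<subseteq> VN G \<mu>}"

section \<open>Matrices\<close>

definition ntrace :: "complex mat \<Rightarrow> complex" where
  "ntrace A = (\<Sum>i<dim_row A. A $$ (i, i)) / of_nat (dim_row A)"

definition mat_norm2 :: "complex mat \<Rightarrow> real" where
  "mat_norm2 A = sqrt (Re (ntrace (mat_adjoint A * A)))"

definition partial_permutation_mats :: "nat \<Rightarrow> complex mat set" where
  "partial_permutation_mats d = {A \<in> carrier_mat d d. A * mat_adjoint A * A = A \<and>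
     (\<forall>i<d. \<forall>j<d. A $$ (i, j) \<in> {0, 1})}"

definition mat_list_prod :: "nat \<Rightarrow> complex mat list \<Rightarrow> complex mat" where
  "mat_list_prod d As = foldr (*) As (1\<^sub>m d)"

section \<open>Sofic approximations and sofic dimension\<close>

definition linear_maps ::
    "'g groupoid_data \<Rightarrow> 'g measure \<Rightarrow> nat \<Rightarrow> ('g l2op \<Rightarrow> complex mat) set" where
  "linear_maps G \<mu> d =
    (let M = arrow_measure G \<mu>; V = vn_span G \<mu> (I_groupoid G \<mu>) in
      {\<phi> \<in> V \<rightarrow>\<^sub>E carrier_mat d d.
        (\<forall>a\<in>V. \<forall>b\<in>V. \<phi> (op_add M a b) = \<phi> a + \<phi> b) \<and>
        (\<forall>c. \<forall>a\<in>V. \<phi> (op_scale M c a) = c \<cdot>\<^sub>m \<phi> a)})"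

definition SA :: "'g groupoid_data \<Rightarrow> 'g measure \<Rightarrow> 'g l2op set \<Rightarrow> nat \<Rightarrow> real \<Rightarrow> nat
    \<Rightarrow> ('g l2op \<Rightarrow> complex mat) set" where
  "SA G \<mu> F n \<delta> d =
    (let M = arrow_measure G \<mu>; \<Omega> = F \<union> op_adjoint M ` F in
      {\<phi> \<in> linear_maps G \<mu> d.
        (\<forall>ss. 1 \<le> length ss \<and> length ss \<le> n \<and> set ss \<subseteq> \<Omega> \<longrightarrow>
          mat_norm2 (\<phi> (op_prod M ss) - mat_list_prod d (map \<phi> ss)) < \<delta>) \<and>
        \<phi> ` op_power_le M \<Omega> n \<subseteq> partial_permutation_mats d \<and>
        (\<forall>s\<in>op_power_le M \<Omega> n. cmod (ntrace (\<phi> s) - vn_trace G \<mu> s) < \<delta>)})"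

definition sofic :: "'g groupoid_data \<Rightarrow> 'g measure \<Rightarrow> bool" where
  "sofic G \<mu> \<longleftrightarrow> (\<forall>F n \<delta>. finite F \<and> F \<subseteq> I_groupoid G \<mu> \<and> n \<ge> 1 \<and> \<delta> > 0 \<longrightarrow>
     (\<exists>d\<ge>1. SA G \<mu> F n \<delta> d \<noteq> {}))"

text \<open>The set of restrictions counted below may be infinite when \<open>E\<close> is not contained in the
  products of \<open>F\<close>, hence the explicit value \<open>\<infinity>\<close>: \<^const>\<open>card\<close> would give \<open>0\<close>.\<close>

definition log_card :: "'a set \<Rightarrow> ereal" where
  "log_card A = (if infinite A then \<infinity> else if A = {} then - \<infinity> else ereal (ln (real (card A))))"

definition restrictions :: "('a \<Rightarrow> 'b) set \<Rightarrow> 'a set \<Rightarrow> ('a \<Rightarrow> 'b) set" where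
  "restrictions Y E = (\<lambda>\<phi>. restrict \<phi> E) ` Y"

definition sofic_dim_EFn\<delta> :: "'g groupoid_data \<Rightarrow> 'g measure \<Rightarrow> 'g l2op set \<Rightarrow> 'g l2op set
    \<Rightarrow> nat \<Rightarrow> real \<Rightarrow> ereal" where
  "sofic_dim_EFn\<delta> G \<mu> E F n \<delta> = liminf (\<lambda>d. ereal (1 / (real d * ln (real d))) *
     log_card (restrictions (SA G \<mu> F n \<delta> d) E))"

definition sofic_dim_EFn :: "'g groupoid_data \<Rightarrow> 'g measure \<Rightarrow> 'g l2op set \<Rightarrow> 'g l2op set
    \<Rightarrow> nat \<Rightarrow> ereal" where
  "sofic_dim_EFn G \<mu> E F n = (INF \<delta>\<in>{0<..}. sofic_dim_EFn\<delta> G \<mu> E F n \<delta>)"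

definition sofic_dim_EF ::
    "'g groupoid_data \<Rightarrow> 'g measure \<Rightarrow> 'g l2op set \<Rightarrow> 'g l2op set \<Rightarrow> ereal" where
  "sofic_dim_EF G \<mu> E F = (INF n\<in>{1..}. sofic_dim_EFn G \<mu> E F n)"

definition lower_sofic_dim :: "'g groupoid_data \<Rightarrow> 'g measure \<Rightarrow> ereal" where
  "lower_sofic_dim G \<mu> =
    (SUP E\<in>{E. finite E \<and> E \<subseteq> I_groupoid G \<mu>}.
      INF F\<in>{F. finite F \<and> F \<subseteq> I_groupoid G \<mu>}. sofic_dim_EF G \<mu> E F)"

end

theory Submission
  imports Defs
begin

text \<open>The quantity to be bounded from below counts, on the scale \<open>d log d\<close>, the restrictions to a
  finite set \<open>E\<close> of the approximations in dimension \<open>d\<close>. Soficity gives one approximation \<open>\<phi>\<close> in one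
  dimension \<open>d\<^sub>0\<close>. Direct sums of copies of \<open>\<phi>\<close> and a zero block are approximations in all large
  dimensions \<open>d\<close>, and so are their conjugates by permutation matrices (\<open>SA_block_map\<close>). Two
  permutations give the same restriction to \<open>E\<close> exactly if they differ by a symmetry of the labelled
  graph on \<open>{..<d}\<close> whose edges are the nonzero entries of the matrices of the elements of \<open>E\<close>.
  These are partial permutation matrices, so that a symmetry is determined by the images of one
  vertex in each connected component (\<open>card_edge_determined_maps\<close>). With \<open>c\<close> components there are
  at least \<open>d! / d\<^sup>c\<close> restrictions, and \<open>log d! = d log d - O(d)\<close>. It suffices to find for each \<open>L\<close>
  a set \<open>E\<close> which forces \<open>c \<le> 3d/L\<close> (\<open>many_restrictions\<close>), that is, a set \<open>E\<close> for which nearly all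
  vertices have at least \<open>L\<close> neighbours.

  Since classes are infinite, there are \<open>L\<close> disjoint Borel sections of the source map which are
  defined almost everywhere. A section has measure 1, and by invariance of the measure it is, up to
  a small remainder, a finite union of sets on which the range map is injective as well
  (\<open>disjoint_bisections_exist\<close>). Let \<open>E\<close> consist of the operators of these bisections. The trace of
  \<open>s\<^sub>T\<^sup>* s\<^sub>T\<^sub>'\<close> is the measure of \<open>T \<inter> T'\<close> (\<open>vn_trace_inverse_mult\<close>); hence in a good approximation
  nearly every vertex has an image under each of the \<open>L\<close> sections, and these images are different
  (\<open>SA_low_degree\<close>).

  For this to make sense, the integral of the cardinalities of fibres must be a measure and Borel
  sections must exist. Both follow from a measurable selection theorem up to null sets
  (\<open>measurable_selection\<close>), which comes from the regularity of outer measures along Suslin schemes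
  (\<open>suslin_select\<close>). Up to null sets every bisection then has Borel images and inverse maps, its
  operator is the composition with a measure preserving left translation, and products and adjoints
  of such operators belong to products and inverses of bisections. In particular all words which
  occur in the definition of an approximation lie in its domain.\<close>

section \<open>Suslin schemes and measurable selection\<close>

text \<open>The result of Suslin's operation (A) on the scheme \<open>C\<close>.\<close>

definition suslin_kernel :: "(nat list \<Rightarrow> 'a set) \<Rightarrow> 'a set" where
  "suslin_kernel C = {p. \<exists>a :: nat \<Rightarrow> nat. \<forall>n. p \<in> C (map a [0..<n])}"

definition suslin_sets :: "'a set set \<Rightarrow> 'a set set" where
  "suslin_sets \<C> = {E. \<exists>C. E = suslin_kernel C \<and> (\<forall>s. C s \<in> \<C>)}"

lemma suslin_sets_choose:
  assumes "\<And>i. E i \<in> suslin_sets \<C>"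
  obtains c where "\<And>i s. c i s \<in> \<C>" "\<And>i. E i = suslin_kernel (c i)"
proof -
  have "\<forall>i. \<exists>C. E i = suslin_kernel C \<and> (\<forall>s. C s \<in> \<C>)"
    using assms unfolding suslin_sets_def by simp
  from choice[OF this] obtain c where "\<forall>i. E i = suslin_kernel (c i) \<and> (\<forall>s. c i s \<in> \<C>)" ..
  then show ?thesis by (intro that[of c]) simp_all
qed

lemma suslin_setsI:
  assumes "\<And>s. C s \<in> \<C>" "E = suslin_kernel C"
  shows "E \<in> suslin_sets \<C>"
  unfolding suslin_sets_def using assms by auto

lemma suslin_sets_base: "A \<in> \<C> \<Longrightarrow> A \<in> suslin_sets \<C>"
  by (rule suslin_setsI[where C = "\<lambda>_. A"]) (auto simp: suslin_kernel_def)

lemma prod_encode_mono_snd: "j < n \<Longrightarrow> prod_encode (i, j) < prod_encode (i, n)"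
proof (induction n)
  case (Suc n)
  have "prod_encode (i, n) < prod_encode (i, Suc n)"
    by (simp add: prod_encode_def)
  with Suc show ?case by (cases "j = n") auto
qed simp

text \<open>One branch codes countably many branches through the pairing function. At the length which is the
  code of \<open>(i, n)\<close> the scheme tests the first \<open>n\<close> entries of the \<open>i\<close>-th branch; they are known by then,
  because the pairing function increases in its second argument.\<close>

lemma suslin_sets_INT:
  assumes "\<And>i :: nat. E i \<in> suslin_sets \<C>"
  shows "(\<Inter>i. E i) \<in> suslin_sets \<C>"
proof -
  obtain c where c: "\<And>i s. c i s \<in> \<C>" and E: "\<And>i. E i = suslin_kernel (c i)"
    using suslin_sets_choose[of E, OF assms(1)] by blast
  define C where "C s = (case prod_decode (length s) of
    (i, n) \<Rightarrow> c i (map (\<lambda>j. s ! prod_encode (i, j)) [0..<n]))" for s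
  have C_eq: "C (map a [0..<prod_encode (i, n)]) = c i (map (\<lambda>j. a (prod_encode (i, j))) [0..<n])"
    for a i n
    by (auto simp: C_def prod_encode_mono_snd intro!: arg_cong[where f = "c i"])
  show ?thesis
  proof (rule suslin_setsI)
    show "C s \<in> \<C>" for s by (simp add: C_def c split: prod.split)
  next
    show "(\<Inter>i. E i) = suslin_kernel C"
    proof (intro equalityI subsetI)
      fix p
      assume "p \<in> (\<Inter>i. E i)"
      then have "\<forall>i. \<exists>a :: nat \<Rightarrow> nat. \<forall>n. p \<in> c i (map a [0..<n])" unfolding E suslin_kernel_def by simp
      from choice[OF this] obtain b where b: "\<And>i n. p \<in> c i (map (b i) [0..<n])" by blast
      define a where "a m = (case prod_decode m of (i, j) \<Rightarrow> b i j)" for m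
      have "p \<in> C (map a [0..<n])" for n
      proof -
        obtain i k where "prod_decode n = (i, k)" by fastforce
        then have n: "n = prod_encode (i, k)" by (metis prod_decode_inverse)
        have "(\<lambda>j. a (prod_encode (i, j))) = b i" by (simp add: a_def)
        then show ?thesis unfolding n C_eq by (simp add: b)
      qed
      then show "p \<in> suslin_kernel C" unfolding suslin_kernel_def by blast
    next
      fix p assume "p \<in> suslin_kernel C"
      then obtain a where a: "\<And>n. p \<in> C (map a [0..<n])" unfolding suslin_kernel_def by blast
      have "p \<in> E i" for i
        unfolding E suslin_kernel_def using a[of "prod_encode (i, _)"] unfolding C_eq by blast
      then show "p \<in> (\<Inter>i. E i)" by blast
    qed
  qed
qed

text \<open>The first entry of a branch chooses the set of the union in which the rest of the branch is read.\<close>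

lemma suslin_sets_UN:
  assumes "\<And>i :: nat. E i \<in> suslin_sets \<C>" "\<Omega> \<in> \<C>" "\<And>i. E i \<subseteq> \<Omega>"
  shows "(\<Union>i. E i) \<in> suslin_sets \<C>"
proof -
  obtain c where c: "\<And>i s. c i s \<in> \<C>" and E: "\<And>i. E i = suslin_kernel (c i)"
    using suslin_sets_choose[of E, OF assms(1)] by blast
  define C where "C s = (case s of [] \<Rightarrow> \<Omega> | i # s \<Rightarrow> c i s)" for s
  have C_Suc: "C (map a [0..<Suc n]) = c (a 0) (map (\<lambda>i. a (Suc i)) [0..<n])" for a n
    unfolding C_def map_upt_Suc by simp
  show ?thesis
  proof (rule suslin_setsI)
    show "C s \<in> \<C>" for s by (simp add: C_def c assms(2) split: list.split)
  next
    show "(\<Union>i. E i) = suslin_kernel C"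
    proof (intro equalityI subsetI)
      fix p
      assume "p \<in> (\<Union>i. E i)"
      then obtain i a where a: "\<And>n. p \<in> c i (map a [0..<n])" and "p \<in> E i"
        unfolding E suslin_kernel_def by blast
      have "p \<in> C (map (case_nat i a) [0..<n])" for n
      proof (cases n)
        case 0
        then show ?thesis using assms(3) \<open>p \<in> E i\<close> by (auto simp: C_def)
      next
        case (Suc k)
        show ?thesis unfolding Suc C_Suc using a[of k] by simp
      qed
      then show "p \<in> suslin_kernel C" unfolding suslin_kernel_def by blast
    next
      fix p assume "p \<in> suslin_kernel C"
      then obtain a where a: "\<And>n. p \<in> C (map a [0..<n])" unfolding suslin_kernel_def by blast
      have "p \<in> E (a 0)"
        unfolding E suslin_kernel_def using a[of "Suc _"] unfolding C_Suc by blast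
      then show "p \<in> (\<Union>i. E i)" by blast
    qed
  qed
qed

lemma suslin_sets_subset:
  assumes "E \<in> suslin_sets \<C>" "\<And>C. C \<in> \<C> \<Longrightarrow> C \<subseteq> \<Omega>"
  shows "E \<subseteq> \<Omega>"
proof
  fix p assume "p \<in> E"
  moreover obtain C where "E = suslin_kernel C" "\<And>s. C s \<in> \<C>"
    using assms(1) unfolding suslin_sets_def by auto
  ultimately obtain a where "p \<in> C (map a [0..<0])" "C (map a [0..<0]) \<in> \<C>"
    unfolding suslin_kernel_def by blast
  then show "p \<in> \<Omega>" using assms(2) by blast
qed

definition closed_rectangles :: "'a topology \<Rightarrow> 'b measure \<Rightarrow> ('a \<times> 'b) set set" where
  "closed_rectangles T N = {F \<times> B | F B. closedin T F \<and> B \<in> sets N}"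

text \<open>Rectangles with a closed side are wanted, since nested closed sets of a complete space meet. The sets
  which are obtained from them by Suslin's operation, and whose complements are as well, form a
  \<open>\<sigma>\<close>-algebra. The complement of a closed rectangle is among them because open sets of a metrizable
  space are countable unions of closed sets.\<close>

lemma product_measurable_suslin:
  assumes T: "metrizable_space T"
    and spM: "space M = topspace T" and seM: "sets M = sigma_sets (topspace T) {U. openin T U}"
    and E: "E \<in> sets (M \<Otimes>\<^sub>M N)"
  shows "E \<in> suslin_sets (closed_rectangles T N)"
proof -
  let ?C = "closed_rectangles T N"
  define \<Omega> where "\<Omega> = topspace T \<times> space N"
  define \<G> where "\<G> = {E. E \<in> suslin_sets ?C \<and> \<Omega> - E \<in> suslin_sets ?C}"
  have \<Omega>_in: "\<Omega> \<in> ?C" unfolding closed_rectangles_def \<Omega>_def by blast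
  have C_sub: "C \<subseteq> \<Omega>" if "C \<in> ?C" for C
    using that closedin_subset sets.sets_into_space
    unfolding closed_rectangles_def \<Omega>_def by fast
  have sub: "E \<subseteq> \<Omega>" if "E \<in> suslin_sets ?C" for E
    using suslin_sets_subset[OF that C_sub] by blast
  have empty_in: "{} \<in> suslin_sets ?C"
  proof (rule suslin_sets_base)
    have "{} = {} \<times> space N" by simp
    then show "{} \<in> ?C" unfolding closed_rectangles_def by blast
  qed
  have G_compl: "\<Omega> - E \<in> \<G>" if "E \<in> \<G>" for E
    using that sub[of E] by (auto simp: \<G>_def double_diff)
  have G_UN: "(\<Union>i :: nat. E i) \<in> \<G>" if "\<And>i. E i \<in> \<G>" for E
  proof -
    have "\<Omega> - (\<Union>i. E i) = (\<Inter>i. \<Omega> - E i)" by auto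
    then show ?thesis
      using that suslin_sets_UN[of E ?C \<Omega>] suslin_sets_INT[of "\<lambda>i. \<Omega> - E i" ?C] \<Omega>_in sub
      unfolding \<G>_def by simp
  qed
  have G_Un: "E \<union> F \<in> \<G>" if "E \<in> \<G>" "F \<in> \<G>" for E F
  proof -
    have "E \<union> F = (\<Union>i :: nat. if i = 0 then E else F)"
      by (auto split: if_splits) 
    then show ?thesis using G_UN[of "\<lambda>i :: nat. if i = 0 then E else F"] that by simp
  qed
  have G_Int: "E \<inter> F \<in> \<G>" if "E \<in> \<G>" "F \<in> \<G>" for E F
  proof -
    have "E \<inter> F = \<Omega> - ((\<Omega> - E) \<union> (\<Omega> - F))"
      using that sub[of E] unfolding \<G>_def by blast
    then show ?thesis using that G_Un G_compl by metis
  qed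
  have suslin_Un: "E \<union> F \<in> suslin_sets ?C" if "E \<in> suslin_sets ?C" "F \<in> suslin_sets ?C" for E F
  proof -
    have "E \<union> F = (\<Union>i :: nat. if i = 0 then E else F)"
      by (auto split: if_splits)
    then show ?thesis
      using suslin_sets_UN[of "\<lambda>i :: nat. if i = 0 then E else F" ?C \<Omega>] that \<Omega>_in sub by simp
  qed
  have open_suslin: "U \<times> space N \<in> suslin_sets ?C" if "openin T U" for U
  proof (cases "U = {}")
    case True then show ?thesis using empty_in by simp
  next
    case False
    have "fsigma_in T U" using open_imp_fsigma_in[OF T that] .
    then obtain \<F> where F: "countable \<F>" "\<And>F. F \<in> \<F> \<Longrightarrow> closedin T F" "\<Union>\<F> = U"
      unfolding fsigma_in_def union_of_def by auto
    with False have ne: "\<F> \<noteq> {}" by auto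
    define f where "f = from_nat_into \<F>"
    have f: "range f = \<F>" unfolding f_def using F(1) ne by (simp add: range_from_nat_into)
    have "U \<times> space N = (\<Union>i. f i \<times> space N)" using F(3) f by auto
    moreover have "f i \<times> space N \<in> ?C" for i
      using F(2) f unfolding closed_rectangles_def by blast
    ultimately show ?thesis
      using suslin_sets_UN[OF suslin_sets_base \<Omega>_in C_sub, of "\<lambda>i. f i \<times> space N"] by simp
  qed
  have rect: "F \<times> B \<in> \<G>" if "closedin T F" "B \<in> sets N" for F B
  proof -
    have "\<Omega> - F \<times> B = (topspace T - F) \<times> space N \<union> topspace T \<times> (space N - B)"
      unfolding \<Omega>_def by auto
    moreover have "topspace T \<times> (space N - B) \<in> ?C"
      unfolding closed_rectangles_def using that by blast
    moreover have "F \<times> B \<in> ?C"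
      unfolding closed_rectangles_def using that by blast
    ultimately show ?thesis
      unfolding \<G>_def
      using suslin_Un[OF open_suslin suslin_sets_base, of "topspace T - F"]
        suslin_sets_base[of "F \<times> B"] that(1)
      by (simp add: closedin_def)
  qed
  have A_in: "A \<times> space N \<in> \<G>" if "A \<in> sigma_sets (topspace T) {U. openin T U}" for A
    using that
  proof induction
    case (Basic U)
    then have "openin T U" by simp
    then have "U \<times> space N = \<Omega> - (topspace T - U) \<times> space N"
      using openin_subset[of T U] unfolding \<Omega>_def by auto
    then show ?case using G_compl rect[of "topspace T - U" "space N"] \<open>openin T U\<close> by auto
  next
    case Empty
    then show ?case using rect[of "{}" "space N"] by auto
  next
    case (Compl A)
    have "(topspace T - A) \<times> space N = \<Omega> - A \<times> space N" unfolding \<Omega>_def by auto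
    then show ?case using G_compl Compl by simp
  next
    case (Union A)
    have "(\<Union>i. A i) \<times> space N = (\<Union>i. A i \<times> space N)" by auto
    then show ?case using G_UN[of "\<lambda>i. A i \<times> space N"] Union by simp
  qed
  have "E \<in> \<G>"
    using E unfolding sets_pair_measure
  proof induction
    case (Basic R)
    then obtain A B where R: "R = A \<times> B" "A \<in> sets M" "B \<in> sets N" by auto
    have "R = (A \<times> space N) \<inter> (topspace T \<times> B)"
      using R sets.sets_into_space[OF R(2)] sets.sets_into_space[OF R(3)] spM by auto
    then show ?case using G_Int A_in rect[of "topspace T" B] R seM by auto
  next
    case Empty
    then show ?case using rect[of "{}" "space N"] by auto
  next
    case (Compl A)
    then show ?case using G_compl[of A] by (simp add: \<Omega>_def spM)
  next
    case (Union A)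
    then show ?case using G_UN[of A] by simp
  qed
  then show ?thesis unfolding \<G>_def by simp
qed


text \<open>Upper bounds \<open>k 0, k 1, \<dots>\<close> for the entries of branches are chosen one after the other. As outer
  measure is continuous along increasing sequences of arbitrary sets, the bound \<open>k m\<close> can be chosen so
  that the loss of outer measure is at most \<open>\<epsilon> / 2\<^sup>m\<^sup>+\<^sup>1\<close>. The words that respect the bounds form a finitely
  branching tree. By Koenig's argument a point that lies in \<open>H s\<close> for a bounded word \<open>s\<close> of every length
  lies in the sets along a whole branch, so that the points which remain form a measurable set; the
  leftmost of their branches depends measurably on the point.\<close>

lemma suslin_select:
  fixes H :: "nat list \<Rightarrow> 'b set"
  assumes "finite_measure N"
    and H: "\<And>s. H s \<in> sets N" and anti: "\<And>s i. H (s @ [i]) \<subseteq> H s"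
    and \<epsilon>: "\<epsilon> > (0 :: real)"
  obtains C a where "C \<in> sets N" "outer_measure_of N (suslin_kernel H) \<le> emeasure N C + \<epsilon>"
    "\<And>y n. y \<in> C \<Longrightarrow> y \<in> H (map (a y) [0..<n])"
    "\<And>s. {y \<in> C. map (a y) [0..<length s] = s} \<in> sets N"
proof -
  interpret finite_measure N by fact
  \<comment> \<open>The points that have a branch whose first entries are bounded by \<open>ks\<close>.\<close>
  define Q where "Q ks = {y. \<exists>a. (\<forall>i<length ks. a i \<le> ks ! i) \<and> (\<forall>n. y \<in> H (map a [0..<n]))}"
    for ks :: "nat list"
  have Q_sub: "Q ks \<subseteq> space N" for ks
  proof
    fix y assume "y \<in> Q ks"
    then obtain a where "y \<in> H (map a [0..<0])" unfolding Q_def by blast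
    then show "y \<in> space N" using sets.sets_into_space[OF H] by blast
  qed
  have step: "\<exists>j. outer_measure_of N (Q ks) \<le> outer_measure_of N (Q (ks @ [j])) + ennreal e"
    if "e > 0" for ks e
  proof -
    have "incseq (\<lambda>j. Q (ks @ [j]))"
    proof (rule incseq_SucI, rule subsetI)
      fix j y assume "y \<in> Q (ks @ [j])"
      then obtain a where a: "\<forall>i<length (ks @ [j]). a i \<le> (ks @ [j]) ! i"
          "\<forall>n. y \<in> H (map a [0..<n])" unfolding Q_def by blast
      have "a i \<le> (ks @ [Suc j]) ! i" if "i < length (ks @ [Suc j])" for i
        using a(1)[rule_format, of i] that by (cases "i < length ks") (auto simp: nth_append less_Suc_eq)
      with a(2) show "y \<in> Q (ks @ [Suc j])" unfolding Q_def by blast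
    qed
    then have "(SUP j. outer_measure_of N (Q (ks @ [j]))) = outer_measure_of N (\<Union>j. Q (ks @ [j]))"
      by (intro SUP_outer_measure_of_incseq Q_sub)
    also have "(\<Union>j. Q (ks @ [j])) = Q ks"
    proof (intro equalityI subsetI)
      fix y assume "y \<in> (\<Union>j. Q (ks @ [j]))"
      then obtain j a where a: "\<forall>i<length (ks @ [j]). a i \<le> (ks @ [j]) ! i"
          "\<forall>n. y \<in> H (map a [0..<n])" unfolding Q_def by blast
      have "\<forall>i<length ks. a i \<le> ks ! i"
        using a(1) by (metis length_append less_SucI length_append_singleton nth_append)
      with a(2) show "y \<in> Q ks" unfolding Q_def by blast
    next
      fix y assume "y \<in> Q ks"
      then obtain a where a: "\<forall>i<length ks. a i \<le> ks ! i"
          "\<forall>n. y \<in> H (map a [0..<n])" unfolding Q_def by blast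
      have "a i \<le> (ks @ [a (length ks)]) ! i" if "i < length (ks @ [a (length ks)])" for i
        using a(1) that by (cases "i < length ks") (auto simp: nth_append less_Suc_eq)
      with a(2) have "y \<in> Q (ks @ [a (length ks)])" unfolding Q_def by blast
      then show "y \<in> (\<Union>j. Q (ks @ [j]))" by blast
    qed
    finally have sup: "(SUP j. outer_measure_of N (Q (ks @ [j]))) = outer_measure_of N (Q ks)" .
    have fin: "outer_measure_of N (Q ks) < \<infinity>"
    proof -
      have "outer_measure_of N (Q ks) \<le> outer_measure_of N (space N)"
        by (intro outer_measure_of_mono Q_sub)
      also have "\<dots> < \<infinity>" by (simp add: emeasure_eq_measure)
      finally show ?thesis .
    qed
    show ?thesis
    proof (cases "outer_measure_of N (Q ks) = 0")
      case False
      then have "outer_measure_of N (Q ks) - ennreal e < outer_measure_of N (Q ks)"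
        using fin \<open>e > 0\<close> by (intro ennreal_between) (auto simp: zero_less_iff_neq_zero)
      then obtain j where "outer_measure_of N (Q ks) - ennreal e < outer_measure_of N (Q (ks @ [j]))"
        unfolding sup[symmetric] less_SUP_iff by blast
      then have "outer_measure_of N (Q ks) \<le> outer_measure_of N (Q (ks @ [j])) + ennreal e"
        by (metis add.commute ennreal_minus_le_iff ennreal_neq_top order_less_imp_le)
      then show ?thesis ..
    qed simp
  qed
  define e where "e m = \<epsilon> * (1 / 2) ^ Suc m" for m :: nat
  have e_pos: "e m > 0" for m using \<epsilon> by (simp add: e_def)
  define j where "j ks = (SOME j. outer_measure_of N (Q ks)
    \<le> outer_measure_of N (Q (ks @ [j])) + ennreal (e (length ks)))" for ks
  have j: "outer_measure_of N (Q ks) \<le> outer_measure_of N (Q (ks @ [j ks])) + ennreal (e (length ks))"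
    for ks unfolding j_def using step[OF e_pos] by (rule someI_ex)
  define K where "K = rec_nat [] (\<lambda>m ks. ks @ [j ks])"
  have K0: "K 0 = []" and K_Suc: "K (Suc m) = K m @ [j (K m)]" for m by (simp_all add: K_def)
  have lenK: "length (K m) = m" for m by (induction m) (simp_all add: K0 K_Suc)
  define k where "k m = j (K m)" for m
  have K_nth: "i < m \<Longrightarrow> K m ! i = k i" for m i
    by (induction m) (auto simp: K_Suc nth_append lenK k_def less_Suc_eq)
  have K_bound: "outer_measure_of N (Q []) \<le> outer_measure_of N (Q (K m)) + ennreal (\<Sum>i<m. e i)" for m
  proof (induction m)
    case (Suc m)
    have "outer_measure_of N (Q []) \<le> outer_measure_of N (Q (K m)) + ennreal (\<Sum>i<m. e i)" by fact
    also have "\<dots> \<le> (outer_measure_of N (Q (K (Suc m))) + ennreal (e m)) + ennreal (\<Sum>i<m. e i)"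
      using j[of "K m"] by (intro add_right_mono) (simp add: K_Suc lenK)
    also have "\<dots> = outer_measure_of N (Q (K (Suc m))) + ennreal (\<Sum>i<Suc m. e i)"
      using e_pos by (simp add: sum_nonneg less_imp_le add.assoc add.commute flip: ennreal_plus)
    finally show ?case .
  qed (simp add: K0)
  have "(\<Sum>i<m. e i) \<le> \<epsilon>" for m
  proof -
    have "(\<Sum>i<m. e i) = \<epsilon> * (1 - (1 / 2) ^ m)"
      unfolding e_def by (induction m) (simp_all add: algebra_simps)
    also have "\<dots> \<le> \<epsilon>" using \<epsilon> by (simp add: mult_le_cancel_left1)
    finally show ?thesis .
  qed
  then have Q_bound: "outer_measure_of N (Q []) \<le> outer_measure_of N (Q (K m)) + ennreal \<epsilon>" for m
    by (intro order.trans[OF K_bound[of m]] add_left_mono ennreal_leI)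
  \<comment> \<open>The bounded words of length \<open>m\<close>.\<close>
  define T where "T m = {t. length t = m \<and> (\<forall>i<m. t ! i \<le> k i)}" for m
  have fin_T: "finite (T m)" for m
  proof (rule finite_subset)
    show "T m \<subseteq> {t. set t \<subseteq> {..Max (k ` {..<m})} \<and> length t = m}"
    proof
      fix t assume t: "t \<in> T m"
      have "x \<le> Max (k ` {..<m})" if x: "x \<in> set t" for x
      proof -
        obtain i where "i < m" "x = t ! i" using x t by (auto simp: T_def in_set_conv_nth)
        then show ?thesis using t by (auto simp: T_def intro: order.trans[OF _ Max_ge])
      qed
      then show "t \<in> {t. set t \<subseteq> {..Max (k ` {..<m})} \<and> length t = m}" using t by (auto simp: T_def)
    qed
    show "finite {t. set t \<subseteq> {..Max (k ` {..<m})} \<and> length t = m}"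
      by (intro finite_lists_length_eq) simp
  qed
  \<comment> \<open>The points at which \<open>s\<close> extends to bounded words of every length.\<close>
  define D where "D s = (\<Inter>m\<in>{length s..}. \<Union>t\<in>{t \<in> T m. take (length s) t = s}. H t)" for s
  have D_sets: "D s \<in> sets N" for s
    unfolding D_def using fin_T H by (intro sets.countable_INT' sets.finite_UN) auto
  have D_H: "D s \<subseteq> H s" for s
  proof
    fix y assume "y \<in> D s"
    then obtain t where "t \<in> T (length s)" "take (length s) t = s" "y \<in> H t"
      unfolding D_def by auto
    then show "y \<in> H s" by (simp add: T_def)
  qed
  have anti_take: "H t \<subseteq> H (take m t)" for t m
  proof (induction t rule: rev_induct)
    case (snoc x t)
    then show ?case using anti[of t x] by (cases "m \<le> length t") (auto simp: take_Cons' )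
  qed simp
  \<comment> \<open>Otherwise each of the finitely many next letters fails at some length, and at the greatest of these
    lengths no extension of \<open>s\<close> is left.\<close>
  have D_step: "\<exists>i. y \<in> D (s @ [i])" if y: "y \<in> D s" for y s
  proof (rule ccontr)
    let ?l = "length s"
    assume "\<nexists>i. y \<in> D (s @ [i])"
    then have "\<forall>i. \<exists>m. Suc ?l \<le> m \<and> (\<forall>t\<in>T m. take (Suc ?l) t = s @ [i] \<longrightarrow> y \<notin> H t)"
      unfolding D_def by (simp, meson atLeast_iff)
    from choice[OF this] obtain f where f: "\<And>i. Suc ?l \<le> f i"
        "\<And>i t. t \<in> T (f i) \<Longrightarrow> take (Suc ?l) t = s @ [i] \<Longrightarrow> y \<notin> H t"
      by blast
    define m where "m = Max (f ` {..k ?l})"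
    have f_le: "f i \<le> m" if "i \<le> k ?l" for i unfolding m_def using that by (intro Max_ge) auto
    have "Suc ?l \<le> m" using f(1)[of 0] f_le[of 0] by simp
    then obtain t where t: "t \<in> T m" "take ?l t = s" "y \<in> H t"
      using y unfolding D_def by (auto dest!: bspec[where x = m])
    define i where "i = t ! ?l"
    have i: "i \<le> k ?l" using t(1) \<open>Suc ?l \<le> m\<close> unfolding T_def i_def by auto
    have "take (f i) t \<in> T (f i)" using t(1) f_le[OF i] unfolding T_def by auto
    moreover have "take (Suc ?l) (take (f i) t) = s @ [i]"
      using t \<open>Suc ?l \<le> m\<close> f(1)[of i] unfolding T_def i_def
      by (auto simp: min_def take_Suc_conv_app_nth)
    moreover have "y \<in> H (take (f i) t)" using anti_take t(3) by blast
    ultimately show False using f(2) by blast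
  qed
  define w where "w y = rec_nat [] (\<lambda>m s. s @ [LEAST i. y \<in> D (s @ [i])])" for y
  have w0: "w y 0 = []" and w_Suc: "w y (Suc m) = w y m @ [LEAST i. y \<in> D (w y m @ [i])]" for y m
    by (simp_all add: w_def)
  define a where "a y m = (LEAST i. y \<in> D (w y m @ [i]))" for y m
  have w_a: "w y m = map (a y) [0..<m]" for y m
    by (induction m) (simp_all add: w0 w_Suc a_def)
  have w_D: "y \<in> D (w y m)" if "y \<in> D []" for y m
  proof (induction m)
    case (Suc m)
    show ?case unfolding w_Suc using D_step[OF Suc] by (rule LeastI_ex)
  qed (simp add: w0 that)
  have meas: "{y \<in> D []. w y (length s) = s} \<in> sets N" for s
  proof (induction s rule: rev_induct)
    case (snoc i s)
    have "{y \<in> D []. w y (length (s @ [i])) = s @ [i]}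
        = {y \<in> D []. w y (length s) = s} \<inter> (D (s @ [i]) - (\<Union>j<i. D (s @ [j])))"
    proof (intro equalityI subsetI)
      fix y assume y: "y \<in> {y \<in> D []. w y (length (s @ [i])) = s @ [i]}"
      then have s: "w y (length s) = s" and i: "i = (LEAST i. y \<in> D (s @ [i]))"
        by (auto simp: w_Suc)
      have "y \<in> D (s @ [i])" using w_D[of y "length (s @ [i])"] y by simp
      moreover have "y \<notin> D (s @ [j])" if "j < i" for j
        using not_less_Least that i by blast
      ultimately show "y \<in> {y \<in> D []. w y (length s) = s} \<inter> (D (s @ [i]) - (\<Union>j<i. D (s @ [j])))"
        using s y by simp
    next
      fix y assume y: "y \<in> {y \<in> D []. w y (length s) = s} \<inter> (D (s @ [i]) - (\<Union>j<i. D (s @ [j])))"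
      then have "(LEAST i. y \<in> D (s @ [i])) = i"
        by (intro Least_equality) (auto simp: not_less[symmetric])
      then show "y \<in> {y \<in> D []. w y (length (s @ [i])) = s @ [i]}"
        using y by (simp add: w_Suc)
    qed
    then show ?case using snoc D_sets by auto
  qed (simp add: w0 D_sets)
  have D_Nil: "D [] = (\<Inter>m. \<Union>t\<in>T m. H t)" by (simp add: D_def)
  have bound: "outer_measure_of N (Q []) \<le> emeasure N (D []) + ennreal \<epsilon>"
  proof -
    have Q_sub_T: "Q (K m) \<subseteq> (\<Union>t\<in>T m. H t)" for m
    proof
      fix y assume "y \<in> Q (K m)"
      then obtain a where a: "\<forall>i<length (K m). a i \<le> K m ! i" "y \<in> H (map a [0..<m])"
        unfolding Q_def by blast
      then have "map a [0..<m] \<in> T m" by (simp add: T_def lenK K_nth)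
      then show "y \<in> (\<Union>t\<in>T m. H t)" using a(2) by blast
    qed
    have "decseq (\<lambda>m. \<Union>t\<in>T m. H t)"
    proof (rule decseq_SucI, rule subsetI)
      fix m y assume "y \<in> (\<Union>t\<in>T (Suc m). H t)"
      then obtain t where t: "t \<in> T (Suc m)" "y \<in> H t" by blast
      then have "take m t \<in> T m" "y \<in> H (take m t)" using anti_take[of t m] by (auto simp: T_def)
      then show "y \<in> (\<Union>t\<in>T m. H t)" by blast
    qed
    moreover have "range (\<lambda>m. \<Union>t\<in>T m. H t) \<subseteq> sets N" using fin_T H by auto
    ultimately have "(INF m. emeasure N (\<Union>t\<in>T m. H t)) = emeasure N (D [])"
      unfolding D_Nil by (intro INF_emeasure_decseq) auto
    moreover have "outer_measure_of N (Q []) - ennreal \<epsilon> \<le> emeasure N (\<Union>t\<in>T m. H t)" for m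
    proof -
      have "outer_measure_of N (Q []) \<le> ennreal \<epsilon> + outer_measure_of N (Q (K m))"
        using Q_bound[of m] by (simp add: add.commute)
      also have "\<dots> \<le> ennreal \<epsilon> + outer_measure_of N (\<Union>t\<in>T m. H t)"
        by (intro add_left_mono outer_measure_of_mono Q_sub_T)
      also have "outer_measure_of N (\<Union>t\<in>T m. H t) = emeasure N (\<Union>t\<in>T m. H t)"
        using fin_T H by (intro outer_measure_of_eq) auto
      finally show ?thesis by (simp add: ennreal_minus_le_iff)
    qed
    ultimately have "outer_measure_of N (Q []) - ennreal \<epsilon> \<le> emeasure N (D [])"
      by (metis (mono_tags, lifting) INF_greatest)
    then show ?thesis by (simp add: ennreal_minus_le_iff add.commute)
  qed
  show thesis
  proof (rule that[of "D []" a])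
    show "D [] \<in> sets N" by (rule D_sets)
    show "outer_measure_of N (suslin_kernel H) \<le> emeasure N (D []) + ennreal \<epsilon>"
      using bound by (simp add: Q_def suslin_kernel_def)
    show "y \<in> H (map (a y) [0..<n])" if "y \<in> D []" for y n
      using w_D[OF that, of n] D_H unfolding w_a by blast
    show "{y \<in> D []. map (a y) [0..<length s] = s} \<in> sets N" for s
      using meas[of s] unfolding w_a .
  qed
qed


text \<open>The set \<open>E\<close> comes from a scheme of rectangles with a closed first side. Intersecting these sides with
  small balls around points of a dense sequence makes every branch determine one point of \<open>M\<close>. A branch
  chosen by \<open>suslin_select\<close> from the second sides alone therefore yields a point of \<open>E\<close>.\<close>

lemma measurable_selection_approx:
  assumes "standard_borel M" "finite_measure N" "E \<in> sets (M \<Otimes>\<^sub>M N)" "\<epsilon> > (0 :: real)"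
  obtains C z where "C \<in> sets N" "outer_measure_of N (snd ` E) \<le> emeasure N C + \<epsilon>"
    "\<And>y. y \<in> C \<Longrightarrow> (z y, y) \<in> E" "\<And>A. A \<in> sets M \<Longrightarrow> {y \<in> C. z y \<in> A} \<in> sets N"
proof (cases "space M = {}")
  case True
  then have "E = {}" using sets.sets_into_space[OF assms(3)] by (auto simp: space_pair_measure)
  then have "outer_measure_of N (snd ` E) = 0" by simp
  then show ?thesis by (intro that[of "{}" undefined]) auto
next
  case False
  obtain T where T: "completely_metrizable_space T" "second_countable T" "topspace T = space M"
      "sets M = sigma_sets (topspace T) {U. openin T U}"
    using assms(1) unfolding standard_borel_def by blast
  obtain X d where "Metric_space X d" and compl: "Metric_space.mcomplete X d"
    and T_eq: "T = Metric_space.mtopology X d"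
    using T(1) unfolding completely_metrizable_space_def by blast
  then interpret Metric_space X d by simp
  have X: "X = space M" using T(3) T_eq by simp
  obtain S where S: "countable S" "S \<subseteq> X" "T closure_of S = X"
    using second_countable_imp_separable_space[OF T(2)]
    unfolding separable_space_def using T_eq by auto
  define q where "q = from_nat_into S"
  have "S \<noteq> {}" using S(3) False X by auto
  then have q: "range q = S" using S(1) unfolding q_def by (rule range_from_nat_into)
  have q_dense: "\<exists>i. x \<in> mcball (q i) (1 / real (Suc k))" if "x \<in> X" for x k
  proof -
    have "x \<in> mtopology closure_of S" using S(3) that T_eq by simp
    then have "\<forall>r>0. \<exists>y\<in>S. y \<in> mball x r" unfolding metric_closure_of by simp
    moreover have "1 / real (Suc k) > 0" by simp
    ultimately obtain y where "y \<in> range q" "y \<in> mball x (1 / real (Suc k))" using q by blast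
    then obtain i where "q i \<in> mball x (1 / real (Suc k))" by blast
    then show ?thesis using commute by (intro exI[of _ i]) (auto simp: order.strict_implies_order)
  qed
  have "E \<in> suslin_sets (closed_rectangles T N)"
    using completely_metrizable_imp_metrizable_space[OF T(1)] T(3,4) assms(3)
    by (intro product_measurable_suslin) auto
  then obtain R where R: "E = suslin_kernel R" "\<And>s. R s \<in> closed_rectangles T N"
    unfolding suslin_sets_def by blast
  have "\<forall>s. \<exists>FB. R s = fst FB \<times> snd FB \<and> closedin T (fst FB) \<and> snd FB \<in> sets N"
    using R(2) unfolding closed_rectangles_def by fastforce
  from choice[OF this] obtain FB where FB: "\<And>s. R s = fst (FB s) \<times> snd (FB s)"
     "\<And>s. closedin T (fst (FB s))" "\<And>s. snd (FB s) \<in> sets N" by blast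
  \<comment> \<open>A letter codes a pair: a letter of the given scheme and the centre of a small ball.\<close>
  define c where "c s = map (fst \<circ> prod_decode) s" for s
  define F where "F s = (\<Inter>k\<in>{..length s}. fst (FB (c (take k s))))
      \<inter> (\<Inter>k\<in>{..<length s}. mcball (q (snd (prod_decode (s ! k)))) (1 / real (Suc k)))" for s
  define B where "B s = (\<Inter>k\<in>{..length s}. snd (FB (c (take k s))))" for s
  \<comment> \<open>Where the closed sides are empty the word is discarded. What is left is a condition on the second
    coordinate only; by completeness the closed sides along an infinite branch still have a common point.\<close>
  define H where "H s = (if F s = {} then {} else B s)" for s
  have F_anti: "F (s @ [i]) \<subseteq> F s" for s i
  proof
    fix x assume x: "x \<in> F (s @ [i])"
    have "x \<in> fst (FB (c (take k s)))" if "k \<le> length s" for k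
      using x that unfolding F_def by (auto dest!: bspec[where x = k])
    moreover have "x \<in> mcball (q (snd (prod_decode (s ! k)))) (1 / real (Suc k))" if "k < length s" for k
      using x that unfolding F_def by (auto dest!: bspec[where x = k] simp: nth_append)
    ultimately show "x \<in> F s" unfolding F_def by blast
  qed
  have B_anti: "B (s @ [i]) \<subseteq> B s" for s i
  proof
    fix y assume y: "y \<in> B (s @ [i])"
    have "y \<in> snd (FB (c (take k s)))" if "k \<le> length s" for k
      using y that unfolding B_def by (auto dest!: bspec[where x = k])
    then show "y \<in> B s" unfolding B_def by blast
  qed
  have F_closed: "closedin T (F s)" for s
  proof -
    have "closedin T (\<Inter>k\<in>{..length s}. fst (FB (c (take k s))))"
      by (intro closedin_INT FB(2)) auto
    then show ?thesis
    proof (cases "length s = 0")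
      case False
      then have "closedin T (\<Inter>k\<in>{..<length s}.
          mcball (q (snd (prod_decode (s ! k)))) (1 / real (Suc k)))"
        by (intro closedin_INT) (auto simp: T_eq closedin_mcball)
      with \<open>closedin T (\<Inter>k\<in>{..length s}. _ k)\<close> show ?thesis
        unfolding F_def by (rule closedin_Int)
    qed (simp add: F_def)
  qed
  have B_sets: "B s \<in> sets N" for s
    unfolding B_def by (intro sets.finite_INT FB(3)) auto
  have single: "\<exists>p. (\<Inter>n. F (map a [0..<n])) = {p}" if ne: "\<And>n. F (map a [0..<n]) \<noteq> {}" for a
  proof -
    have "decseq (\<lambda>n. F (map a [0..<n]))"
      using F_anti by (intro decseq_SucI) simp
    moreover have "\<exists>n b. F (map a [0..<n]) \<subseteq> mcball b e" if "e > 0" for e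
    proof -
      obtain n where n: "1 / real (Suc n) < e" using \<open>e > 0\<close> by (metis nat_approx_posE)
      have "F (map a [0..<Suc n]) \<subseteq> mcball (q (snd (prod_decode (map a [0..<Suc n] ! n)))) (1 / real (Suc n))"
        unfolding F_def by auto
      also have "\<dots> \<subseteq> mcball (q (snd (prod_decode (map a [0..<Suc n] ! n)))) e"
        using n by auto
      finally show ?thesis by blast
    qed
    ultimately show ?thesis
      using compl[unfolded mcomplete_nest_sing, rule_format, of "\<lambda>n. F (map a [0..<n])"]
        ne F_closed[unfolded T_eq] by blast
  qed
  have E_sub: "snd ` E \<subseteq> suslin_kernel H"
  proof
    fix y assume "y \<in> snd ` E"
    then obtain p where "(p, y) \<in> E" by auto
    then obtain b where b: "\<And>n. p \<in> fst (FB (map b [0..<n]))" "\<And>n. y \<in> snd (FB (map b [0..<n]))"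
      unfolding R(1) suslin_kernel_def FB(1) by auto
    have "p \<in> X" using b(1)[of 0] closedin_subset[OF FB(2)] X T(3) by blast
    then have "\<forall>k. \<exists>i. p \<in> mcball (q i) (1 / real (Suc k))" using q_dense by blast
    then obtain i where i: "\<And>k. p \<in> mcball (q (i k)) (1 / real (Suc k))" by metis
    define a where "a k = prod_encode (b k, i k)" for k
    have c_a: "c (map a [0..<k]) = map b [0..<k]" for k by (simp add: c_def a_def)
    have tk: "k \<le> n \<Longrightarrow> take k (map a [0..<n]) = map a [0..<k]" for k n by (simp add: take_map)
    have "p \<in> F (map a [0..<n])" for n
      unfolding F_def using b(1) i by (auto simp: tk c_a a_def)
    moreover have "y \<in> B (map a [0..<n])" for n
      unfolding B_def using b(2) by (auto simp: tk c_a)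
    ultimately show "y \<in> suslin_kernel H" unfolding suslin_kernel_def H_def by auto
  qed
  have H_sets: "H s \<in> sets N" for s by (simp add: H_def B_sets)
  have H_anti: "H (s @ [i]) \<subseteq> H s" for s i
    using F_anti[of s i] B_anti[of s i] unfolding H_def by auto
  obtain C a where C: "C \<in> sets N" "outer_measure_of N (suslin_kernel H) \<le> emeasure N C + \<epsilon>"
      "\<And>y n. y \<in> C \<Longrightarrow> y \<in> H (map (a y) [0..<n])"
      "\<And>s. {y \<in> C. map (a y) [0..<length s] = s} \<in> sets N"
    using suslin_select[of N H \<epsilon>, OF assms(2) H_sets H_anti assms(4)] by blast
  define z where "z y = (THE p. (\<Inter>n. F (map (a y) [0..<n])) = {p})" for y
  have z: "(\<Inter>n. F (map (a y) [0..<n])) = {z y}" if "y \<in> C" for y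
  proof -
    have "\<exists>p. (\<Inter>n. F (map (a y) [0..<n])) = {p}"
    proof (rule single)
      show "F (map (a y) [0..<n]) \<noteq> {}" for n
        using C(3)[OF that, of n] by (auto simp: H_def split: if_splits)
    qed
    then show ?thesis unfolding z_def by (metis (mono_tags, lifting) singleton_inject the_equality)
  qed
  have z_F: "z y \<in> F (map (a y) [0..<n])" if "y \<in> C" for y n using z[OF that] by blast
  have z_E: "(z y, y) \<in> E" if "y \<in> C" for y
  proof -
    define b where "b k = fst (prod_decode (a y k))" for k
    have c_a: "c (map (a y) [0..<k]) = map b [0..<k]" for k by (simp add: c_def b_def)
    have "z y \<in> fst (FB (map b [0..<n]))" for n
      using z_F[OF that, of n] unfolding F_def by (auto dest!: bspec[where x = n] simp: c_a)
    moreover have "y \<in> snd (FB (map b [0..<n]))" for n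
      using C(3)[OF that, of n] unfolding H_def B_def
      by (auto dest!: bspec[where x = n] simp: c_a split: if_splits)
    ultimately show ?thesis unfolding R(1) suslin_kernel_def FB(1) by auto
  qed
  have open_meas: "{y \<in> C. z y \<in> U} \<in> sets N" if U: "openin T U" for U
  proof -
    have "{y \<in> C. z y \<in> U} = (\<Union>s\<in>{s. F s \<subseteq> U}. {y \<in> C. map (a y) [0..<length s] = s})"
    proof (intro equalityI subsetI)
      fix y assume "y \<in> {y \<in> C. z y \<in> U}"
      then have y: "y \<in> C" "z y \<in> U" by auto
      then obtain e where e: "e > 0" "mball (z y) e \<subseteq> U"
        using U unfolding T_eq openin_mtopology by blast
      have zX: "z y \<in> X" using z_F[OF y(1), of 0] closedin_subset[OF F_closed] X T(3) by blast
      obtain n where n: "1 / real (Suc n) < e / 2" using \<open>e > 0\<close> by (metis half_gt_zero nat_approx_posE)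
      let ?s = "map (a y) [0..<Suc n]"
      have sub: "F ?s \<subseteq> mcball (q (snd (prod_decode (?s ! n)))) (1 / real (Suc n))"
        unfolding F_def by auto
      have "F ?s \<subseteq> U"
      proof
        fix x assume x: "x \<in> F ?s"
        let ?p = "q (snd (prod_decode (?s ! n)))"
        have 1: "?p \<in> X" "x \<in> X" "d ?p x \<le> 1 / real (Suc n)" using sub x by auto
        have 2: "d ?p (z y) \<le> 1 / real (Suc n)" using sub z_F[OF y(1), of "Suc n"] by auto
        have "d (z y) x \<le> d (z y) ?p + d ?p x" using triangle 1 zX by blast
        also have "\<dots> < e" using 1 2 n commute[of "z y" ?p] by linarith
        finally show "x \<in> U" using e(2) zX 1 by auto
      qed
      then show "y \<in> (\<Union>s\<in>{s. F s \<subseteq> U}. {y \<in> C. map (a y) [0..<length s] = s})"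
        using y(1) by (intro UN_I[of ?s]) auto
    next
      fix y assume "y \<in> (\<Union>s\<in>{s. F s \<subseteq> U}. {y \<in> C. map (a y) [0..<length s] = s})"
      then obtain s where "F s \<subseteq> U" "y \<in> C" "map (a y) [0..<length s] = s" by blast
      then show "y \<in> {y \<in> C. z y \<in> U}" using z_F[of y "length s"] by auto
    qed
    also have "\<dots> \<in> sets N" by (intro sets.countable_UN'' C(4)) auto
    finally show ?thesis .
  qed
  have "z y \<in> topspace T" if "y \<in> C" for y
    using z_F[OF that, of 0] closedin_subset[OF F_closed] by blast
  then have top: "{y \<in> C. z y \<in> topspace T} = C" by auto
  have meas: "{y \<in> C. z y \<in> A} \<in> sets N" if "A \<in> sets M" for A
    using that unfolding T(4)
  proof induction
    case (Compl A)
    have "{y \<in> C. z y \<in> topspace T - A} = C - {y \<in> C. z y \<in> A}" using top by auto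
    then show ?case using Compl C(1) by auto
  next
    case (Union A)
    have "{y \<in> C. z y \<in> (\<Union>i. A i)} = (\<Union>i. {y \<in> C. z y \<in> A i})" by auto
    then show ?case using Union by auto
  qed (use open_meas in auto)
  show thesis
  proof (rule that[of C z])
    have "outer_measure_of N (snd ` E) \<le> outer_measure_of N (suslin_kernel H)"
      by (rule outer_measure_of_mono[OF E_sub])
    then show "outer_measure_of N (snd ` E) \<le> emeasure N C + \<epsilon>"
      using C(2) by simp
  qed (use C z_E meas in auto)
qed

text \<open>The selection theorem of Jankov and von Neumann for a finite measure: a selector is defined on all of
  the projection up to a null set. The set \<open>D\<close> is a measurable hull of the projection.\<close>

theorem measurable_selection:
  assumes "standard_borel M" "finite_measure N" "E \<in> sets (M \<Otimes>\<^sub>M N)"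
  obtains C D z where "C \<in> sets N" "D \<in> sets N" "snd ` E \<subseteq> D" "emeasure N (D - C) = 0"
    "\<And>y. y \<in> C \<Longrightarrow> (z y, y) \<in> E" "\<And>A. A \<in> sets M \<Longrightarrow> {y \<in> C. z y \<in> A} \<in> sets N"
proof -
  interpret finite_measure N by fact
  have "\<exists>C z. C \<in> sets N \<and> outer_measure_of N (snd ` E) \<le> emeasure N C + ennreal (1 / real (Suc n)) \<and>
      (\<forall>y\<in>C. (z y, y) \<in> E) \<and> (\<forall>A\<in>sets M. {y \<in> C. z y \<in> A} \<in> sets N)" for n
  proof -
    have "1 / real (Suc n) > 0" by simp
    then show ?thesis by (rule measurable_selection_approx[OF assms]) blast
  qed
  then have "\<forall>n. \<exists>Cz. fst Cz \<in> sets N \<and>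
      outer_measure_of N (snd ` E) \<le> emeasure N (fst Cz) + ennreal (1 / real (Suc n)) \<and>
      (\<forall>y\<in>fst Cz. (snd Cz y, y) \<in> E) \<and> (\<forall>A\<in>sets M. {y \<in> fst Cz. snd Cz y \<in> A} \<in> sets N)"
    by simp
  from choice[OF this] obtain Cz where Cz: "\<forall>n. fst (Cz n) \<in> sets N \<and>
      outer_measure_of N (snd ` E) \<le> emeasure N (fst (Cz n)) + ennreal (1 / real (Suc n)) \<and>
      (\<forall>y\<in>fst (Cz n). (snd (Cz n) y, y) \<in> E) \<and>
      (\<forall>A\<in>sets M. {y \<in> fst (Cz n). snd (Cz n) y \<in> A} \<in> sets N)" ..
  define C z where "C n = fst (Cz n)" and "z n = snd (Cz n)" for n
  have C: "\<And>n. C n \<in> sets N"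
    and bound: "\<And>n. outer_measure_of N (snd ` E) \<le> emeasure N (C n) + ennreal (1 / real (Suc n))"
    and zE: "\<And>n y. y \<in> C n \<Longrightarrow> (z n y, y) \<in> E"
    and meas: "\<And>n A. A \<in> sets M \<Longrightarrow> {y \<in> C n. z n y \<in> A} \<in> sets N"
    using Cz by (simp_all add: C_def z_def)
  have "snd ` E \<subseteq> space N"
    using sets.sets_into_space[OF assms(3)] by (auto simp: space_pair_measure)
  from outer_measure_of_attain[OF this]
  obtain D where D: "D \<in> sets N" "snd ` E \<subseteq> D" "outer_measure_of N (snd ` E) = emeasure N D"
    by (elim bexE conjE)
  let ?C = "\<Union>n. C n"
  have C_sub: "?C \<subseteq> D"
  proof
    fix y assume "y \<in> ?C"
    then obtain n where "(z n y, y) \<in> E" using zE by blast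
    then have "y \<in> snd ` E" by (rule image_eqI[rotated]) simp
    then show "y \<in> D" using D(2) by (rule subsetD[rotated])
  qed
  have le: "emeasure N D \<le> emeasure N ?C"
  proof (rule ennreal_le_epsilon)
    fix e :: real assume "e > 0"
    then obtain n where n: "1 / real (Suc n) < e" by (metis nat_approx_posE)
    have "emeasure N D \<le> emeasure N (C n) + ennreal (1 / real (Suc n))" using bound[of n] unfolding D(3) .
    also have "\<dots> \<le> emeasure N ?C + ennreal e"
      using n C by (intro add_mono emeasure_mono ennreal_leI) auto
    finally show "emeasure N D \<le> emeasure N ?C + ennreal e" .
  qed
  have null: "emeasure N (D - ?C) = 0"
  proof -
    have "emeasure N (D - ?C) = emeasure N D - emeasure N ?C"
      by (intro emeasure_Diff C_sub D(1) sets.countable_UN'' C) simp_all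
    then show ?thesis using le
      by (simp add: diff_eq_0_iff_ennreal less_top[symmetric] emeasure_eq_measure)
  qed
  define i where "i y = (LEAST n. y \<in> C n)" for y
  have i: "y \<in> C (i y)" if "y \<in> ?C" for y
  proof -
    obtain n where "y \<in> C n" using \<open>y \<in> ?C\<close> by blast
    then show ?thesis unfolding i_def by (rule LeastI)
  qed
  show thesis
  proof (rule that[of ?C D "\<lambda>y. z (i y) y"])
    fix A assume A: "A \<in> sets M"
    have "{y \<in> ?C. z (i y) y \<in> A} = (\<Union>n. {y \<in> C n. z n y \<in> A} - (\<Union>m<n. C m))"
    proof (intro equalityI subsetI)
      fix y assume y: "y \<in> {y \<in> ?C. z (i y) y \<in> A}"
      have "y \<notin> C m" if "m < i y" for m 
        using that not_less_Least[of m "\<lambda>n. y \<in> C n"] by (simp add: i_def)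
      moreover have "y \<in> C (i y)" using y by (intro i) simp
      ultimately have "y \<in> {y' \<in> C (i y). z (i y) y' \<in> A} - (\<Union>m<i y. C m)"
        using y by simp
      then show "y \<in> (\<Union>n. {y \<in> C n. z n y \<in> A} - (\<Union>m<n. C m))" by (rule UN_I[OF UNIV_I])
    next
      fix y assume "y \<in> (\<Union>n. {y \<in> C n. z n y \<in> A} - (\<Union>m<n. C m))"
      then obtain n where n: "y \<in> {y \<in> C n. z n y \<in> A} - (\<Union>m<n. C m)" by (rule UN_E)
      then have "i y = n"
        unfolding i_def by (intro Least_equality) (auto simp: not_less[symmetric])
      then show "y \<in> {y \<in> ?C. z (i y) y \<in> A}" using n by auto
    qed
    also have "\<dots> \<in> sets N" using meas[OF A] C by (intro sets.countable_UN'' sets.Diff) auto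
    finally show "{y \<in> ?C. z (i y) y \<in> A} \<in> sets N" .
  next
    show "?C \<in> sets N" using C by blast
    show "(z (i y) y, y) \<in> E" if "y \<in> ?C" for y using zE i[OF that] by blast
  qed (use D null in auto)
qed

section \<open>Borel sections of the source and range maps\<close>

lemma standard_borel_countable_separating:
  assumes "standard_borel M"
  obtains \<B> where "countable \<B>" "\<B> \<subseteq> sets M"
    "\<And>x y. x \<in> space M \<Longrightarrow> y \<in> space M \<Longrightarrow> (\<And>V. V \<in> \<B> \<Longrightarrow> x \<in> V \<longleftrightarrow> y \<in> V) \<Longrightarrow> x = y"
proof -
  obtain T where T: "completely_metrizable_space T" "second_countable T" "topspace T = space M"
      "sets M = sigma_sets (topspace T) {U. openin T U}"
    using assms(1) unfolding standard_borel_def by blast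
  obtain \<B> where B: "countable \<B>" "\<And>V. V \<in> \<B> \<Longrightarrow> openin T V"
      "\<And>U x. openin T U \<Longrightarrow> x \<in> U \<Longrightarrow> \<exists>V\<in>\<B>. x \<in> V \<and> V \<subseteq> U"
    using T(2) unfolding second_countable_def by metis
  have "Hausdorff_space T"
    using T(1) completely_metrizable_imp_metrizable_space metrizable_imp_Hausdorff_space by blast
  then have haus: "\<exists>U. openin T U \<and> x \<in> U \<and> y \<notin> U" if "x \<in> space M" "y \<in> space M" "x \<noteq> y" for x y
    using that T(3) unfolding Hausdorff_space_def disjnt_def by (metis disjoint_iff)
  show thesis
  proof (rule that[of \<B>])
    show "\<B> \<subseteq> sets M" unfolding T(4) using B(2) by (auto intro: sigma_sets.Basic)
    fix x y assume xy: "x \<in> space M" "y \<in> space M" and sep: "\<And>V. V \<in> \<B> \<Longrightarrow> x \<in> V \<longleftrightarrow> y \<in> V"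
    show "x = y"
    proof (rule ccontr)
      assume "x \<noteq> y"
      then obtain U where "openin T U" "x \<in> U" "y \<notin> U" using haus xy by blast
      then obtain V where "V \<in> \<B>" "x \<in> V" "V \<subseteq> U" using B(3) by meson
      then show False using sep \<open>y \<notin> U\<close> by blast
    qed
  qed (rule B(1))
qed

text \<open>The diagonal is measurable because countably many Borel sets separate points.\<close>

lemma standard_borel_equality_set:
  assumes "standard_borel M" and f: "f \<in> N \<rightarrow>\<^sub>M M" and g: "g \<in> N \<rightarrow>\<^sub>M M"
  shows "{x \<in> space N. f x = g x} \<in> sets N"
proof -
  obtain \<B> where B: "countable \<B>" "\<B> \<subseteq> sets M"
    "\<And>x y. x \<in> space M \<Longrightarrow> y \<in> space M \<Longrightarrow> (\<And>V. V \<in> \<B> \<Longrightarrow> x \<in> V \<longleftrightarrow> y \<in> V) \<Longrightarrow> x = y"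
    using standard_borel_countable_separating[OF assms(1)] by metis
  have "{x \<in> space N. f x = g x} = {x \<in> space N. \<forall>V\<in>\<B>. f x \<in> V \<longleftrightarrow> g x \<in> V}"
    using B(3) measurable_space[OF f] measurable_space[OF g] by (auto; blast)
  also have "\<dots> \<in> sets N"
  proof (rule sets.sets_Collect_countable_All')
    show "countable \<B>" by (rule B(1))
    fix V assume "V \<in> \<B>"
    then have V: "V \<in> sets M" using B(2) by blast
    have "{x \<in> space N. f x \<in> V} \<in> sets N" "{x \<in> space N. g x \<in> V} \<in> sets N"
      using measurable_sets[OF f V] measurable_sets[OF g V] by (simp_all add: vimage_def Int_def conj_commute)
    moreover have "{x \<in> space N. (f x \<in> V) = (g x \<in> V)} =
        space N - ({x \<in> space N. f x \<in> V} - {x \<in> space N. g x \<in> V}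
          \<union> ({x \<in> space N. g x \<in> V} - {x \<in> space N. f x \<in> V}))" by auto
    ultimately show "{x \<in> space N. (f x \<in> V) = (g x \<in> V)} \<in> sets N" by simp
  qed
  finally show ?thesis .
qed

lemma measurable_restrict_space_partial:
  assumes "C \<in> sets N" "\<And>y. y \<in> C \<Longrightarrow> z y \<in> space M" "\<And>A. A \<in> sets M \<Longrightarrow> {y \<in> C. z y \<in> A} \<in> sets N"
  shows "z \<in> restrict_space N C \<rightarrow>\<^sub>M M"
proof (rule measurableI)
  have C: "C \<subseteq> space N" using assms(1) by (rule sets.sets_into_space)
  then show "z x \<in> space M" if "x \<in> space (restrict_space N C)" for x
    using that assms(2) by (auto simp: space_restrict_space)
  fix A assume "A \<in> sets M"
  moreover have "z -` A \<inter> space (restrict_space N C) = {y \<in> C. z y \<in> A}"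
    using C by (auto simp: space_restrict_space)
  ultimately show "z -` A \<inter> space (restrict_space N C) \<in> sets (restrict_space N C)"
    using assms(1,3) C by (auto simp: sets_restrict_space_iff)
qed

lemma measurable_restrict_space_partialD:
  assumes "C \<in> sets N" "z \<in> restrict_space N C \<rightarrow>\<^sub>M M"
  shows "y \<in> C \<Longrightarrow> z y \<in> space M" "A \<in> sets M \<Longrightarrow> {y \<in> C. z y \<in> A} \<in> sets N"
proof -
  have C: "C \<subseteq> space N" using assms(1) by (rule sets.sets_into_space)
  then show "z y \<in> space M" if "y \<in> C"
    using that measurable_space[OF assms(2), of y] by (auto simp: space_restrict_space)
  assume "A \<in> sets M"
  from measurable_sets[OF assms(2) this]
  have "z -` A \<inter> space (restrict_space N C) \<in> sets N"
    using assms(1) C by (simp add: sets_restrict_space_iff)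
  moreover have "z -` A \<inter> space (restrict_space N C) = {y \<in> C. z y \<in> A}"
    using C by (auto simp: space_restrict_space)
  ultimately show "{y \<in> C. z y \<in> A} \<in> sets N" by simp
qed

text \<open>The image and the inverse are required to be measurable so that a point of \<open>S\<close> can be recovered
  measurably from its value. Up to a null set of values, every Borel set contains such a set with the
  same image (\<open>borel_section_exists\<close>).\<close>

definition borel_section :: "'a measure \<Rightarrow> 'b measure \<Rightarrow> ('a \<Rightarrow> 'b) \<Rightarrow> 'a set \<Rightarrow> bool" where
  "borel_section M N f S \<longleftrightarrow> S \<in> sets M \<and> inj_on f S \<and> f ` S \<in> sets N \<and>
     the_inv_into S f \<in> restrict_space N (f ` S) \<rightarrow>\<^sub>M M"

lemma borel_section_subset:
  assumes "borel_section M N f S" "S' \<in> sets M" "S' \<subseteq> S"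
  shows "borel_section M N f S'"
proof -
  note S = assms(1)[unfolded borel_section_def]
  have inv_eq: "the_inv_into S' f y = the_inv_into S f y" if "y \<in> f ` S'" for y
    using that S assms(3) by (auto simp: the_inv_into_f_f inj_on_subset subset_iff)
  have "f ` S' = {y \<in> f ` S. the_inv_into S f y \<in> S'}"
    using S assms(3) by (auto simp: the_inv_into_f_f subset_iff intro: rev_image_eqI)
  moreover have "\<dots> \<in> sets N"
    using measurable_restrict_space_partialD(2)[of "f ` S" N _ M] S assms(2) by simp
  ultimately have im: "f ` S' \<in> sets N" by simp
  have "the_inv_into S' f \<in> restrict_space N (f ` S') \<rightarrow>\<^sub>M M"
  proof (rule measurable_restrict_space_partial[OF im])
    fix y assume "y \<in> f ` S'"
    then show "the_inv_into S' f y \<in> space M"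
      using S assms(2,3) sets.sets_into_space[OF assms(2)]
      by (auto simp: the_inv_into_f_f inj_on_subset)
  next
    fix A assume A: "A \<in> sets M"
    have "{y \<in> f ` S'. the_inv_into S' f y \<in> A} = {y \<in> f ` S'. the_inv_into S f y \<in> A}"
      by (intro Collect_cong conj_cong refl) (simp add: inv_eq)
    also have "\<dots> = {y \<in> f ` S. the_inv_into S f y \<in> A} \<inter> f ` S'"
      using image_mono[OF assms(3), of f] by blast
    also have "\<dots> \<in> sets N"
      using measurable_restrict_space_partialD(2)[of "f ` S" N _ M] S A im by (intro sets.Int) auto
    finally show "{y \<in> f ` S'. the_inv_into S' f y \<in> A} \<in> sets N" .
  qed
  then show ?thesis
    unfolding borel_section_def using S assms(2,3) im by (auto intro: inj_on_subset)
qed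

text \<open>A selector \<open>z\<close> is taken from the part of the graph of \<open>f\<close> over \<open>B\<close>. Its image is Borel since it is the
  set of all \<open>x\<close> in \<open>B\<close> with \<open>z (f x) = x\<close>.\<close>

lemma borel_section_exists:
  assumes M: "standard_borel M" and "finite_measure N"
    and f: "f \<in> M \<rightarrow>\<^sub>M N" and graph: "{p \<in> space (M \<Otimes>\<^sub>M N). f (fst p) = snd p} \<in> sets (M \<Otimes>\<^sub>M N)"
    and B: "B \<in> sets M"
  obtains S D where "borel_section M N f S" "S \<subseteq> B" "D \<in> null_sets N" "f ` B \<subseteq> f ` S \<union> D"
proof -
  define E where "E = {p \<in> space (M \<Otimes>\<^sub>M N). f (fst p) = snd p} \<inter> (B \<times> space N)"
  have B_sub: "B \<subseteq> space M" using B by (rule sets.sets_into_space)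
  have E: "E \<in> sets (M \<Otimes>\<^sub>M N)" unfolding E_def using graph B by auto
  obtain C D z where C: "C \<in> sets N" "D \<in> sets N" "snd ` E \<subseteq> D" "emeasure N (D - C) = 0"
    "\<And>y. y \<in> C \<Longrightarrow> (z y, y) \<in> E" "\<And>A. A \<in> sets M \<Longrightarrow> {y \<in> C. z y \<in> A} \<in> sets N"
    by (rule measurable_selection[OF M assms(2) E]) blast
  have z: "z y \<in> B" "f (z y) = y" if "y \<in> C" for y
    using C(5)[OF that] by (auto simp: E_def)
  have z_meas: "z \<in> restrict_space N C \<rightarrow>\<^sub>M M"
    using C(1,6) z(1) B_sub by (intro measurable_restrict_space_partial) auto
  define S where "S = z ` C"
  have inj: "inj_on f S" unfolding S_def using z(2) by (auto simp: inj_on_def)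
  have fS: "f ` S = C" unfolding S_def using z(2) by (force simp: image_image)
  have inv: "the_inv_into S f y = z y" if "y \<in> C" for y
    using that inj z(2) unfolding S_def by (intro the_inv_into_f_eq) auto
  define P where "P = f -` C \<inter> space M"
  have P: "P \<in> sets M" unfolding P_def using f C(1) by (rule measurable_sets)
  have "(\<lambda>x. z (f x)) \<in> restrict_space M P \<rightarrow>\<^sub>M M"
  proof (rule measurable_compose[OF _ z_meas])
    show "f \<in> restrict_space M P \<rightarrow>\<^sub>M restrict_space N C"
      using f by (intro measurable_restrict_space3) (auto simp: P_def)
  qed
  moreover have "(\<lambda>x. x) \<in> restrict_space M P \<rightarrow>\<^sub>M M" by (rule measurable_restrict_space1) simp
  ultimately have "{x \<in> space (restrict_space M P). z (f x) = x} \<in> sets (restrict_space M P)"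
    by (rule standard_borel_equality_set[OF M])
  then have "{x \<in> space (restrict_space M P). z (f x) = x} \<in> sets M"
    using P sets.sets_into_space[OF P] by (simp add: sets_restrict_space_iff)
  moreover have "S = {x \<in> space (restrict_space M P). z (f x) = x} \<inter> B"
    unfolding S_def space_restrict_space P_def using z B_sub by (auto intro: rev_image_eqI)
  ultimately have S: "S \<in> sets M" using B by simp
  show thesis
  proof (rule that[of S "D - C"])
    have "the_inv_into S f \<in> restrict_space N C \<rightarrow>\<^sub>M M"
      using z_meas sets.sets_into_space[OF C(1)] inv
      by (subst measurable_cong[where g = z]) (auto simp: space_restrict_space)
    then show "borel_section M N f S" unfolding borel_section_def fS using S inj C(1) by simp
    show "S \<subseteq> B" unfolding S_def using z(1) by auto
    show "D - C \<in> null_sets N" using C(1,2,4) by auto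
    show "f ` B \<subseteq> f ` S \<union> (D - C)"
    proof
      fix y assume "y \<in> f ` B"
      then obtain x where x: "x \<in> B" "y = f x" by blast
      then have "(x, y) \<in> E"
        using B_sub measurable_space[OF f] by (auto simp: E_def space_pair_measure)
      then have "y \<in> D" using C(3) by force
      then show "y \<in> f ` S \<union> (D - C)" unfolding fS by blast
    qed
  qed
qed

text \<open>Each section is taken from what its predecessors have left over, and up to a null set it meets every
  fibre which still has points. A fibre that is missed by a section has thus been used up before. An
  infinite fibre need not be exhausted.\<close>

lemma greedy_borel_sections:
  assumes M: "standard_borel M" and N: "finite_measure N"
    and f: "f \<in> M \<rightarrow>\<^sub>M N" and graph: "{p \<in> space (M \<Otimes>\<^sub>M N). f (fst p) = snd p} \<in> sets (M \<Otimes>\<^sub>M N)"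
    and B: "B \<in> sets M"
  obtains S :: "nat \<Rightarrow> 'a set" where "\<And>i. borel_section M N f (S i)" "\<And>i. S i \<subseteq> B"
    "disjoint_family S"
    "AE y in N. \<forall>n. y \<notin> f ` S n \<longrightarrow> {x \<in> B. f x = y} \<subseteq> (\<Union>i<n. S i)"
proof -
  have "\<forall>R. \<exists>SD. R \<in> sets M \<longrightarrow> borel_section M N f (fst SD) \<and> fst SD \<subseteq> R \<and>
      snd SD \<in> null_sets N \<and> f ` R \<subseteq> f ` fst SD \<union> snd SD"
  proof
    fix R
    show "\<exists>SD. R \<in> sets M \<longrightarrow> borel_section M N f (fst SD) \<and> fst SD \<subseteq> R \<and>
      snd SD \<in> null_sets N \<and> f ` R \<subseteq> f ` fst SD \<union> snd SD"
    proof (cases "R \<in> sets M")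
      case True
      obtain S D where "borel_section M N f S" "S \<subseteq> R" "D \<in> null_sets N" "f ` R \<subseteq> f ` S \<union> D"
        by (rule borel_section_exists[OF M N f graph True])
      then show ?thesis by (intro exI[of _ "(S, D)"]) simp
    qed simp
  qed
  from choice[OF this] obtain SD where SD: "\<forall>R. R \<in> sets M \<longrightarrow> borel_section M N f (fst (SD R)) \<and>
      fst (SD R) \<subseteq> R \<and> snd (SD R) \<in> null_sets N \<and> f ` R \<subseteq> f ` fst (SD R) \<union> snd (SD R)" ..
  define R where "R = rec_nat B (\<lambda>_ R. R - fst (SD R))"
  have R0: "R 0 = B" and R_Suc: "R (Suc n) = R n - fst (SD (R n))" for n by (simp_all add: R_def)
  have R_sets: "R n \<in> sets M" for n
  proof (induction n)
    case (Suc n)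
    then have "fst (SD (R n)) \<in> sets M" using SD unfolding borel_section_def by blast
    then show ?case using Suc by (simp add: R_Suc)
  qed (simp add: R0 B)
  define S where "S n = fst (SD (R n))" for n
  have S: "borel_section M N f (S n)" "S n \<subseteq> R n" "snd (SD (R n)) \<in> null_sets N"
      "f ` R n \<subseteq> f ` S n \<union> snd (SD (R n))" for n
    using SD R_sets unfolding S_def by blast+
  have R_eq: "R n = B - (\<Union>i<n. S i)" for n
    by (induction n) (auto simp: R0 R_Suc S_def less_Suc_eq)
  show thesis
  proof (rule that[of S])
    show "borel_section M N f (S i)" "S i \<subseteq> B" for i using S(1,2)[of i] R_eq[of i] by auto
    have "S i \<inter> S j = {}" if "i < j" for i j
      using S(2)[of j] R_eq[of j] that by blast
    then show "disjoint_family S"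
      unfolding disjoint_family_on_def by (metis Int_commute linorder_neqE_nat)
    have "AE y in N. \<forall>n. y \<notin> snd (SD (R n))"
      unfolding AE_all_countable using S(3) by (auto intro: AE_not_in)
    then show "AE y in N. \<forall>n. y \<notin> f ` S n \<longrightarrow> {x \<in> B. f x = y} \<subseteq> (\<Union>i<n. S i)"
    proof (rule AE_mp, intro AE_I2 impI allI)
      fix y n assume "\<forall>n. y \<notin> snd (SD (R n))" "y \<notin> f ` S n"
      then have "y \<notin> f ` R n" using S(4)[of n] by blast
      then show "{x \<in> B. f x = y} \<subseteq> (\<Union>i<n. S i)" unfolding R_eq by blast
    qed
  qed
qed

abbreviation cardinality :: "'a set \<Rightarrow> ennreal" where
  "cardinality A \<equiv> emeasure (count_space UNIV) A"

lemma cardinality_fibre_section: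
  assumes "inj_on f S"
  shows "cardinality {x \<in> S. f x = y} = indicator (f ` S) y"
proof (cases "y \<in> f ` S")
  case True
  then obtain x where "x \<in> S" "f x = y" by blast
  then have "{x \<in> S. f x = y} = {x}" using assms by (auto simp: inj_on_def)
  then show ?thesis using True by simp
next
  case False
  then have "{x \<in> S. f x = y} = {}" by auto
  then show ?thesis using False by (simp only: emeasure_empty) simp
qed

text \<open>If all sections meet the fibre, both sides are infinite; otherwise the sections exhaust it.\<close>

lemma cardinality_fibre_AE:
  assumes S: "\<And>i. inj_on f (S i)" "\<And>i. S i \<subseteq> B" "disjoint_family S"
    and cover: "\<And>n. y \<notin> f ` S n \<Longrightarrow> {x \<in> B. f x = y} \<subseteq> (\<Union>i<n. S i)"
  shows "cardinality {x \<in> B. f x = y} = (\<Sum>i. indicator (f ` S i) y)"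
proof -
  have "disjoint_family (\<lambda>i. {x \<in> S i. f x = y})"
    using S(3) unfolding disjoint_family_on_def by blast
  then have "(\<Sum>i. cardinality {x \<in> S i. f x = y}) = cardinality (\<Union>i. {x \<in> S i. f x = y})"
    by (intro suminf_emeasure) auto
  then have sum: "(\<Sum>i. indicator (f ` S i) y) = cardinality (\<Union>i. {x \<in> S i. f x = y})"
    by (simp add: cardinality_fibre_section[OF S(1)])
  show ?thesis
  proof (cases "\<exists>n. y \<notin> f ` S n")
    case True
    then obtain n where "{x \<in> B. f x = y} \<subseteq> (\<Union>i<n. S i)" using cover by blast
    then have "{x \<in> B. f x = y} = (\<Union>i. {x \<in> S i. f x = y})" using S(2) by blast
    then show ?thesis using sum by simp
  next
    case False
    then have "(\<Sum>i. indicator (f ` S i) y :: ennreal) = (\<Sum>i. 1)" by simp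
    also have "\<dots> = \<infinity>"
      using summable_iff_suminf_neq_top[of "\<lambda>_. 1"] summable_const_iff[of "1 :: real"] by simp
    finally have *: "(\<Sum>i. indicator (f ` S i) y :: ennreal) = \<infinity>" .
    moreover have "cardinality (\<Union>i. {x \<in> S i. f x = y}) \<le> cardinality {x \<in> B. f x = y}"
      using S(2) by (intro emeasure_mono) auto
    ultimately show ?thesis using sum by (simp add: top_unique)
  qed
qed

section \<open>Groupoid algebra and the measure on arrows\<close>

context groupoid
begin

abbreviation X where "X \<equiv> space (arrows G)"

lemma unit_arrow: "u \<in> units G \<Longrightarrow> u \<in> X"
  using units_subset by blast

lemma composableI: "x \<in> X \<Longrightarrow> y \<in> X \<Longrightarrow> src G x = rng G y \<Longrightarrow> (x, y) \<in> composable G"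
  by (simp add: composable_def)

lemma inv_inv:
  assumes "x \<in> X"
  shows "ginv G (ginv G x) = x"
proof -
  have x': "ginv G x \<in> X" and x'': "ginv G (ginv G x) \<in> X" using assms inv_closed by auto
  have c1: "(ginv G (ginv G x), ginv G x) \<in> composable G"
    by (intro composableI x' x'') (simp add: src_inv[OF x'])
  have c2: "(ginv G x, x) \<in> composable G"
    by (intro composableI x' assms) (simp add: src_inv[OF assms])
  have "ginv G (ginv G x) = gmult G (ginv G (ginv G x)) (gmult G (ginv G x) x)"
    using mult_src[OF x''] assms x' by (simp add: inv_mult src_inv rng_inv)
  also have "\<dots> = gmult G (gmult G (ginv G (ginv G x)) (ginv G x)) x"
    using mult_assoc[OF c1 c2] by simp
  also have "\<dots> = x" using assms x' by (simp add: inv_mult src_inv rng_mult_left)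
  finally show ?thesis .
qed

lemma inv_mult_cancel:
  assumes "x \<in> X" "y \<in> X" "src G x = rng G y"
  shows "gmult G (ginv G x) (gmult G x y) = y"
proof -
  have "gmult G (ginv G x) (gmult G x y) = gmult G (gmult G (ginv G x) x) y"
    using assms by (intro mult_assoc[symmetric] composableI) (auto simp: src_inv inv_closed)
  then show ?thesis using assms by (simp add: inv_mult rng_mult_left)
qed

lemma mult_inv_cancel:
  assumes "x \<in> X" "y \<in> X" "rng G x = rng G y"
  shows "gmult G x (gmult G (ginv G x) y) = y"
  using inv_mult_cancel[of "ginv G x" y] assms by (simp add: inv_closed src_inv inv_inv)

lemma inv_of_mult:
  assumes "x \<in> X" "y \<in> X" "src G x = rng G y"
  shows "ginv G (gmult G x y) = gmult G (ginv G y) (ginv G x)"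
proof -
  let ?p = "gmult G x y" and ?q = "gmult G (ginv G y) (ginv G x)"
  have p: "?p \<in> X" "src G ?p = src G y" "rng G ?p = rng G x"
    using assms by (auto intro!: mult_closed src_mult rng_mult composableI)
  have q: "?q \<in> X" "rng G ?q = src G y"
    using assms by (auto intro!: mult_closed composableI simp: rng_mult src_inv rng_inv inv_closed composableI)
  have "gmult G ?p ?q = gmult G x (gmult G y ?q)"
    using assms q by (intro mult_assoc composableI) auto
  also have "gmult G y ?q = ginv G x"
    using assms by (intro mult_inv_cancel) (auto simp: inv_closed rng_inv)
  finally have "gmult G ?p ?q = rng G x" using assms by (simp add: mult_inv)
  then have "gmult G (ginv G ?p) (rng G x) = ?q"
    using inv_mult_cancel[of ?p ?q] p q by simp
  then show ?thesis using mult_src[OF inv_closed[OF p(1)]] p by (simp add: src_inv)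
qed

lemma src_fibre_Int: "B \<subseteq> X \<Longrightarrow> src_fibre G u \<inter> B = {x \<in> B. src G x = u}"
  by (auto simp: src_fibre_def)

lemma rng_fibre_Int: "B \<subseteq> X \<Longrightarrow> rng_fibre G u \<inter> B = {x \<in> B. rng G x = u}"
  by (auto simp: rng_fibre_def)

end

context pmp_groupoid
begin

abbreviation \<nu> where "\<nu> \<equiv> arrow_measure G \<mu>"

lemma sets_mu_iff: "A \<in> sets \<mu> \<longleftrightarrow> A \<in> sets (arrows G) \<and> A \<subseteq> units G"
  using sets_mu units_borel units_subset by (auto simp: sets_restrict_space_iff Int_absorb2)

lemma src_measurable [measurable]: "src G \<in> arrows G \<rightarrow>\<^sub>M \<mu>"
  using src_borel src_closed
  by (subst measurable_cong_sets[OF refl sets_mu]) (auto intro!: measurable_restrict_space2)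

lemma rng_measurable [measurable]: "rng G \<in> arrows G \<rightarrow>\<^sub>M \<mu>"
  using rng_borel rng_closed
  by (subst measurable_cong_sets[OF refl sets_mu]) (auto intro!: measurable_restrict_space2)

lemma graph_measurable:
  assumes "f \<in> arrows G \<rightarrow>\<^sub>M \<mu>"
  shows "{p \<in> space (arrows G \<Otimes>\<^sub>M \<mu>). f (fst p) = snd p} \<in> sets (arrows G \<Otimes>\<^sub>M \<mu>)"
proof (rule standard_borel_equality_set[OF standard_borel])
  have id: "(\<lambda>x. x) \<in> \<mu> \<rightarrow>\<^sub>M arrows G"
    using sets_mu_iff unit_arrow space_mu
    by (subst measurable_cong_sets[OF sets_mu refl]) (auto intro!: measurable_restrict_space1)
  show "(\<lambda>p. f (fst p)) \<in> arrows G \<Otimes>\<^sub>M \<mu> \<rightarrow>\<^sub>M arrows G"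
    by (rule measurable_compose[OF measurable_compose[OF measurable_fst assms] id])
  show "snd \<in> arrows G \<Otimes>\<^sub>M \<mu> \<rightarrow>\<^sub>M arrows G"
    by (rule measurable_compose[OF measurable_snd id])
qed

lemma fibre_cardinality_AE_borel:
  assumes f: "f \<in> arrows G \<rightarrow>\<^sub>M \<mu>" and B: "B \<in> sets (arrows G)"
  obtains g where "g \<in> borel_measurable \<mu>" "AE u in \<mu>. cardinality {x \<in> B. f x = u} = g u"
proof -
  obtain S :: "nat \<Rightarrow> 'g set" where S: "\<And>i. borel_section (arrows G) \<mu> f (S i)" "\<And>i. S i \<subseteq> B"
    "disjoint_family S"
    "AE y in \<mu>. \<forall>n. y \<notin> f ` S n \<longrightarrow> {x \<in> B. f x = y} \<subseteq> (\<Union>i<n. S i)"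
    by (rule greedy_borel_sections[OF standard_borel finite_measure_axioms f graph_measurable[OF f] B]) blast
  show thesis
  proof (rule that)
    have [measurable]: "f ` S i \<in> sets \<mu>" for i using S(1) unfolding borel_section_def by blast
    show "(\<lambda>u. \<Sum>i. indicator (f ` S i) u :: ennreal) \<in> borel_measurable \<mu>" by measurable
    show "AE u in \<mu>. cardinality {x \<in> B. f x = u} = (\<Sum>i. indicator (f ` S i) u)"
      using S(4)
    proof (rule AE_mp, intro AE_I2 impI)
      fix u assume "\<forall>n. u \<notin> f ` S n \<longrightarrow> {x \<in> B. f x = u} \<subseteq> (\<Union>i<n. S i)"
      then show "cardinality {x \<in> B. f x = u} = (\<Sum>i. indicator (f ` S i) u)"
        using S(1-3) unfolding borel_section_def by (intro cardinality_fibre_AE) blast+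
    qed
  qed
qed

text \<open>The cardinalities of fibres agree almost everywhere with Borel functions, which makes the integral
  additive.\<close>

lemma nn_integral_fibre_cardinality_suminf:
  assumes f: "f \<in> arrows G \<rightarrow>\<^sub>M \<mu>" and A: "range A \<subseteq> sets (arrows G)" "disjoint_family A"
  shows "(\<integral>\<^sup>+ u. cardinality {x \<in> (\<Union>i. A i). f x = u} \<partial>\<mu>)
      = (\<Sum>i. \<integral>\<^sup>+ u. cardinality {x \<in> A i. f x = u} \<partial>\<mu>)"
proof -
  have "\<forall>i. \<exists>g. g \<in> borel_measurable \<mu> \<and> (AE u in \<mu>. cardinality {x \<in> A i. f x = u} = g u)"
  proof
    fix i
    have "A i \<in> sets (arrows G)" using A(1) by blast
    then show "\<exists>g. g \<in> borel_measurable \<mu> \<and> (AE u in \<mu>. cardinality {x \<in> A i. f x = u} = g u)"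
      by (rule fibre_cardinality_AE_borel[OF f]) blast
  qed
  from choice[OF this] obtain g where g: "\<And>i. g i \<in> borel_measurable \<mu>"
    "\<And>i. AE u in \<mu>. cardinality {x \<in> A i. f x = u} = g i u" by auto
  have union: "cardinality {x \<in> (\<Union>i. A i). f x = u} = (\<Sum>i. cardinality {x \<in> A i. f x = u})" for u
  proof -
    have "disjoint_family (\<lambda>i. {x \<in> A i. f x = u})"
      using A(2) unfolding disjoint_family_on_def by blast
    then have "(\<Sum>i. cardinality {x \<in> A i. f x = u}) = cardinality (\<Union>i. {x \<in> A i. f x = u})"
      by (intro suminf_emeasure) auto
    also have "(\<Union>i. {x \<in> A i. f x = u}) = {x \<in> (\<Union>i. A i). f x = u}" by auto
    finally show ?thesis by simp
  qed
  have "(\<integral>\<^sup>+ u. cardinality {x \<in> (\<Union>i. A i). f x = u} \<partial>\<mu>) = (\<integral>\<^sup>+ u. (\<Sum>i. g i u) \<partial>\<mu>)"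
  proof (rule nn_integral_cong_AE)
    have "AE u in \<mu>. \<forall>i. cardinality {x \<in> A i. f x = u} = g i u"
      unfolding AE_all_countable using g(2) by blast
    then show "AE u in \<mu>. cardinality {x \<in> (\<Union>i. A i). f x = u} = (\<Sum>i. g i u)"
    proof (rule AE_mp, intro AE_I2 impI)
      fix u assume "\<forall>i. cardinality {x \<in> A i. f x = u} = g i u"
      then show "cardinality {x \<in> (\<Union>i. A i). f x = u} = (\<Sum>i. g i u)"
        unfolding union by simp
    qed
  qed
  also have "\<dots> = (\<Sum>i. \<integral>\<^sup>+ u. g i u \<partial>\<mu>)" using g(1) by (rule nn_integral_suminf)
  also have "\<dots> = (\<Sum>i. \<integral>\<^sup>+ u. cardinality {x \<in> A i. f x = u} \<partial>\<mu>)"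
    by (intro arg_cong[where f = suminf] ext nn_integral_cong_AE) (use g(2) in \<open>auto simp: eq_commute\<close>)
  finally show ?thesis .
qed

lemma space_nu [simp]: "space \<nu> = X" and sets_nu [simp, measurable_cong]: "sets \<nu> = sets (arrows G)"
  unfolding arrow_measure_def using sets.sets_into_space
  by (auto simp: sets_measure_of_conv space_measure_of_conv sets.sigma_sets_eq sets.space_closed)

lemma emeasure_nu:
  assumes "B \<in> sets (arrows G)"
  shows "emeasure \<nu> B = (\<integral>\<^sup>+ u. cardinality {x \<in> B. src G x = u} \<partial>\<mu>)"
proof -
  have eq: "(\<integral>\<^sup>+ u. cardinality (src_fibre G u \<inter> B) \<partial>\<mu>) = (\<integral>\<^sup>+ u. cardinality {x \<in> B. src G x = u} \<partial>\<mu>)"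
    if "B \<in> sets (arrows G)" for B
    using src_fibre_Int[OF sets.sets_into_space[OF that]] by simp
  have "emeasure \<nu> B = (\<integral>\<^sup>+ u. cardinality (src_fibre G u \<inter> B) \<partial>\<mu>)"
  proof (rule emeasure_measure_of[OF arrow_measure_def])
    show "sets (arrows G) \<subseteq> Pow X" using sets.sets_into_space by auto
    show "positive (sets \<nu>) (\<lambda>B. \<integral>\<^sup>+ u. cardinality (src_fibre G u \<inter> B) \<partial>\<mu>)"
      by (simp add: positive_def)
    show "countably_additive (sets \<nu>) (\<lambda>B. \<integral>\<^sup>+ u. cardinality (src_fibre G u \<inter> B) \<partial>\<mu>)"
    proof (rule countably_additiveI)
      fix A :: "nat \<Rightarrow> 'g set"
      assume A: "range A \<subseteq> sets \<nu>" "disjoint_family A" "(\<Union>i. A i) \<in> sets \<nu>"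
      then have "A i \<in> sets (arrows G)" for i by auto
      then show "(\<Sum>i. \<integral>\<^sup>+ u. cardinality (src_fibre G u \<inter> A i) \<partial>\<mu>) =
          (\<integral>\<^sup>+ u. cardinality (src_fibre G u \<inter> (\<Union>i. A i)) \<partial>\<mu>)"
        using nn_integral_fibre_cardinality_suminf[OF src_measurable, of A] A eq by simp
    qed
    show "B \<in> sets \<nu>" using assms by simp
  qed
  then show ?thesis using eq[OF assms] by simp
qed

lemma emeasure_nu_rng:
  assumes "B \<in> sets (arrows G)"
  shows "emeasure \<nu> B = (\<integral>\<^sup>+ u. cardinality {x \<in> B. rng G x = u} \<partial>\<mu>)"
  using measure_preserving[OF assms] emeasure_nu[OF assms]
    src_fibre_Int[OF sets.sets_into_space[OF assms]] rng_fibre_Int[OF sets.sets_into_space[OF assms]]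
  by simp

lemma fibre_integral_eq_0_iff:
  assumes f: "f \<in> arrows G \<rightarrow>\<^sub>M \<mu>" and B: "B \<in> sets (arrows G)"
  shows "(\<integral>\<^sup>+ u. cardinality {x \<in> B. f x = u} \<partial>\<mu>) = 0 \<longleftrightarrow> (AE u in \<mu>. \<forall>x\<in>B. f x \<noteq> u)"
proof -
  obtain g where g: "g \<in> borel_measurable \<mu>" "AE u in \<mu>. cardinality {x \<in> B. f x = u} = g u"
    by (rule fibre_cardinality_AE_borel[OF f B])
  have "(\<integral>\<^sup>+ u. cardinality {x \<in> B. f x = u} \<partial>\<mu>) = (\<integral>\<^sup>+ u. g u \<partial>\<mu>)"
    by (rule nn_integral_cong_AE[OF g(2)])
  also have "\<dots> = 0 \<longleftrightarrow> (AE u in \<mu>. g u = 0)" by (rule nn_integral_0_iff_AE[OF g(1)])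
  also have "\<dots> \<longleftrightarrow> (AE u in \<mu>. cardinality {x \<in> B. f x = u} = 0)"
    using g(2) by (intro iffI) (auto elim: eventually_elim2)
  also have "\<dots> \<longleftrightarrow> (AE u in \<mu>. \<forall>x\<in>B. f x \<noteq> u)"
    by (intro arg_cong[where f = "\<lambda>P. AE u in \<mu>. P u"] ext) (auto simp: emeasure_count_space_eq_0)
  finally show ?thesis .
qed

lemma nu_null_iff_src:
  "B \<in> sets (arrows G) \<Longrightarrow> emeasure \<nu> B = 0 \<longleftrightarrow> (AE u in \<mu>. \<forall>x\<in>B. src G x \<noteq> u)"
  by (simp add: emeasure_nu fibre_integral_eq_0_iff)

lemma nu_null_iff_rng:
  "B \<in> sets (arrows G) \<Longrightarrow> emeasure \<nu> B = 0 \<longleftrightarrow> (AE u in \<mu>. \<forall>x\<in>B. rng G x \<noteq> u)"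
  by (simp add: emeasure_nu_rng fibre_integral_eq_0_iff)

text \<open>Here the invariance of \<open>\<mu>\<close> enters: counted along the range map, the arrows over a null set of units
  have measure zero.\<close>

lemma AE_rng:
  assumes "AE u in \<mu>. P u"
  shows "AE x in \<nu>. P (rng G x)"
proof -
  obtain N where N: "N \<in> null_sets \<mu>" "{u \<in> space \<mu>. \<not> P u} \<subseteq> N"
    using assms by (rule AE_E3) auto
  have sets: "rng G -` N \<inter> X \<in> sets (arrows G)"
    by (rule measurable_sets[OF rng_measurable]) (use N(1) in blast)
  have "emeasure \<nu> (rng G -` N \<inter> X) = 0"
    unfolding nu_null_iff_rng[OF sets] using AE_not_in[OF N(1)] by (rule AE_mp) (auto intro!: AE_I2)
  then show ?thesis
    using sets N(2) rng_closed space_mu by (intro AE_I'[of "rng G -` N \<inter> X"]) auto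
qed

end

section \<open>Bisections acting on functions\<close>

context pmp_groupoid
begin

definition bisections :: "'g set set" where
  "bisections = {B \<in> sets (arrows G). inj_on (src G) B \<and> inj_on (rng G) B}"

text \<open>By \<open>regular_bisection_conull\<close> every bisection is regular up to a null set of arrows, and such a null
  set has no influence on the operator (\<open>bisection_op_conull\<close>).\<close>

definition regular_bisections :: "'g set set" where
  "regular_bisections =
    {B. borel_section (arrows G) \<mu> (src G) B \<and> borel_section (arrows G) \<mu> (rng G) B}"

lemma regular_bisectionsD:
  assumes "B \<in> regular_bisections"
  shows "B \<in> bisections" "B \<in> sets (arrows G)" "B \<subseteq> X" "inj_on (src G) B" "inj_on (rng G) B"
    "src G ` B \<in> sets \<mu>" "rng G ` B \<in> sets \<mu>"
  using assms sets.sets_into_space[of B "arrows G"]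
  unfolding regular_bisections_def bisections_def borel_section_def by auto

lemma regular_bisection_subset:
  assumes "B \<in> regular_bisections" "B' \<in> sets (arrows G)" "B' \<subseteq> B"
  shows "B' \<in> regular_bisections"
  using assms borel_section_subset unfolding regular_bisections_def by blast

lemma borel_section_conull:
  assumes f: "f = src G \<or> f = rng G" and B: "B \<in> sets (arrows G)" "inj_on f B"
  obtains S where "borel_section (arrows G) \<mu> f S" "S \<subseteq> B" "emeasure \<nu> (B - S) = 0"
proof -
  have fm: "f \<in> arrows G \<rightarrow>\<^sub>M \<mu>" using f by auto
  obtain S D where S: "borel_section (arrows G) \<mu> f S" "S \<subseteq> B" "D \<in> null_sets \<mu>"
      "f ` B \<subseteq> f ` S \<union> D"
    by (rule borel_section_exists[OF standard_borel finite_measure_axioms fm graph_measurable[OF fm] B(1)])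
  have meas: "B - S \<in> sets (arrows G)" using B S(1) unfolding borel_section_def by blast
  have "f x \<in> D" if "x \<in> B - S" for x
  proof (rule ccontr)
    assume "f x \<notin> D"
    then obtain y where "y \<in> S" "f x = f y" using S(4) \<open>x \<in> B - S\<close> by blast
    then show False using B(2) S(2) \<open>x \<in> B - S\<close> by (auto dest: inj_onD)
  qed
  note D = this
  have "AE u in \<mu>. \<forall>x\<in>B - S. f x \<noteq> u"
    using AE_not_in[OF S(3)]
  proof (rule AE_mp, intro AE_I2 impI ballI notI)
    fix u x assume "u \<notin> D" "x \<in> B - S" "f x = u"
    then show False using D by blast
  qed
  then have "emeasure \<nu> (B - S) = 0"
    using f nu_null_iff_src[OF meas] nu_null_iff_rng[OF meas] by (elim disjE) simp_all
  with S show thesis using that by blast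
qed

lemma regular_bisection_conull:
  assumes "B \<in> bisections"
  obtains B' where "B' \<in> regular_bisections" "B' \<subseteq> B" "emeasure \<nu> (B - B') = 0"
proof -
  have B: "B \<in> sets (arrows G)" "inj_on (src G) B" "inj_on (rng G) B"
    using assms by (auto simp: bisections_def)
  obtain S where S: "borel_section (arrows G) \<mu> (src G) S" "S \<subseteq> B" "emeasure \<nu> (B - S) = 0"
    using borel_section_conull[of "src G" B] B by auto
  obtain R where R: "borel_section (arrows G) \<mu> (rng G) R" "R \<subseteq> B" "emeasure \<nu> (B - R) = 0"
    using borel_section_conull[of "rng G" B] B by auto
  have sets: "S \<in> sets (arrows G)" "R \<in> sets (arrows G)"
    using S(1) R(1) unfolding borel_section_def by auto
  have "emeasure \<nu> ((B - S) \<union> (B - R)) \<le> emeasure \<nu> (B - S) + emeasure \<nu> (B - R)"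
    using sets B(1) by (intro emeasure_subadditive) auto
  moreover have "B - (S \<inter> R) = (B - S) \<union> (B - R)" by auto
  ultimately have "emeasure \<nu> (B - (S \<inter> R)) = 0" using S(3) R(3) by simp
  moreover have "S \<inter> R \<in> regular_bisections"
    unfolding regular_bisections_def
    using borel_section_subset[OF S(1), of "S \<inter> R"] borel_section_subset[OF R(1), of "S \<inter> R"] sets by auto
  ultimately show thesis using that[of "S \<inter> R"] S(2) by blast
qed

lemma bisection_action_in:
  assumes "inj_on (rng G) B" "B \<subseteq> X" "b \<in> B" "x \<in> X" "rng G b = rng G x"
  shows "bisection_action G B \<xi> x = \<xi> (gmult G (ginv G b) x)"
proof -
  have b: "b \<in> X" using assms by blast
  define y0 where "y0 = gmult G (ginv G x) b"
  have c: "(ginv G x, b) \<in> composable G"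
    using assms b by (intro composableI) (auto simp: inv_closed src_inv)
  have y0: "y0 \<in> rng_fibre G (src G x)" "gmult G x y0 = b"
    unfolding y0_def rng_fibre_def using assms b c mult_inv_cancel[of x b]
    by (auto simp: mult_closed rng_mult rng_inv)
  have uniq: "y = y0" if y: "y \<in> rng_fibre G (src G x)" "gmult G x y \<in> B" for y
  proof -
    have yX: "y \<in> X" "rng G y = src G x" using y(1) by (auto simp: rng_fibre_def)
    have "rng G (gmult G x y) = rng G x" using yX assms by (intro rng_mult composableI) auto
    then have "rng G (gmult G x y) = rng G b" using assms(5) by simp
    then have "gmult G x y = b" using inj_onD[OF assms(1) _ y(2) assms(3)] by simp
    then show ?thesis using inv_mult_cancel[of x y] yX assms unfolding y0_def by simp
  qed
  have "(THE y. y \<in> rng_fibre G (src G x) \<and> gmult G x y \<in> B) = y0"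
  proof (rule the_equality)
    show "y0 \<in> rng_fibre G (src G x) \<and> gmult G x y0 \<in> B" using y0 assms(3) by simp
  qed (elim conjE, rule uniq)
  moreover have "\<exists>y\<in>rng_fibre G (src G x). gmult G x y \<in> B" using y0 assms(3) by auto
  moreover have "ginv G y0 = gmult G (ginv G b) x"
    unfolding y0_def using assms b by (subst inv_of_mult) (auto simp: inv_closed src_inv inv_inv)
  ultimately show ?thesis unfolding bisection_action_def by simp
qed

lemma bisection_action_notin:
  assumes "x \<in> X" "\<And>b. b \<in> B \<Longrightarrow> rng G b \<noteq> rng G x"
  shows "bisection_action G B \<xi> x = 0"
proof -
  have "gmult G x y \<notin> B" if "y \<in> rng_fibre G (src G x)" for y
  proof -
    have "rng G (gmult G x y) = rng G x"
      using that assms(1) by (intro rng_mult composableI) (auto simp: rng_fibre_def)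
    then show ?thesis using assms(2)[of "gmult G x y"] by auto
  qed
  then show ?thesis unfolding bisection_action_def by auto
qed

lemma bisection_action_conull:
  assumes "B \<in> bisections" "B' \<in> sets (arrows G)" "B' \<subseteq> B" "emeasure \<nu> (B - B') = 0"
  shows "AE x in \<nu>. \<forall>\<xi>. bisection_action G B \<xi> x = bisection_action G B' \<xi> x"
proof -
  have B: "B \<in> sets (arrows G)" "inj_on (rng G) B" "B \<subseteq> X"
    using assms(1) sets.sets_into_space by (auto simp: bisections_def)
  have B': "inj_on (rng G) B'" "B' \<subseteq> X" using B assms(3) by (auto intro: inj_on_subset)
  have "B - B' \<in> sets (arrows G)" using B assms(2) by blast
  from nu_null_iff_rng[OF this] have "AE u in \<mu>. \<forall>b\<in>B - B'. rng G b \<noteq> u" using assms(4) by simp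
  then have "AE x in \<nu>. \<forall>b\<in>B - B'. rng G b \<noteq> rng G x" by (rule AE_rng)
  then show ?thesis
  proof (rule AE_mp, intro AE_I2 impI allI)
    fix x \<xi> assume "x \<in> space \<nu>" and x: "\<forall>b\<in>B - B'. rng G b \<noteq> rng G x"
    then have xX: "x \<in> X" by simp
    show "bisection_action G B \<xi> x = bisection_action G B' \<xi> x"
    proof (cases "\<exists>b\<in>B. rng G b = rng G x")
      case True
      then obtain b where b: "b \<in> B" "b \<in> B'" "rng G b = rng G x" using x by blast
      show ?thesis
        using bisection_action_in[OF B(2,3) b(1) xX b(3)] bisection_action_in[OF B' b(2) xX b(3)] by simp
    next
      case False
      then have "\<And>b. b \<in> B \<Longrightarrow> rng G b \<noteq> rng G x" "\<And>b. b \<in> B' \<Longrightarrow> rng G b \<noteq> rng G x"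
        using assms(3) by blast+
      then show ?thesis by (simp add: bisection_action_notin[OF xX])
    qed
  qed
qed

definition bisection_dom :: "'g set \<Rightarrow> 'g set" where
  "bisection_dom B = {x \<in> X. rng G x \<in> rng G ` B}"

text \<open>Left translation by the inverse of the bisection \<open>B\<close>. It is a bijection from \<open>bisection_dom B\<close> to
  \<open>bisection_dom (ginv G ` B)\<close>, and \<open>bisection_action G B\<close> is the composition with it
  (\<open>bisection_action_eq\<close>).\<close>

definition bisection_map :: "'g set \<Rightarrow> 'g \<Rightarrow> 'g" where
  "bisection_map B x = gmult G (ginv G (the_inv_into B (rng G) (rng G x))) x"

lemma bisection_mapE:
  assumes "B \<in> bisections" "x \<in> bisection_dom B"
  obtains b where "b \<in> B" "b \<in> X" "x \<in> X" "rng G b = rng G x" "bisection_map B x = gmult G (ginv G b) x"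
    "bisection_map B x \<in> X" "rng G (bisection_map B x) = src G b"
    "src G (bisection_map B x) = src G x" "gmult G b (bisection_map B x) = x"
proof -
  have B: "inj_on (rng G) B" "B \<subseteq> X"
    using assms(1) sets.sets_into_space by (auto simp: bisections_def)
  obtain b where b: "b \<in> B" "rng G b = rng G x" and x: "x \<in> X"
    using assms(2) by (auto simp: bisection_dom_def)
  then have bX: "b \<in> X" using B by blast
  have "the_inv_into B (rng G) (rng G x) = b" using B(1) b by (intro the_inv_into_f_eq) auto
  then have eq: "bisection_map B x = gmult G (ginv G b) x" by (simp add: bisection_map_def)
  have c: "(ginv G b, x) \<in> composable G"
    using b x bX by (intro composableI) (auto simp: inv_closed src_inv)
  show thesis
    by (rule that[OF b(1) bX x b(2) eq])
      (use c b x bX in \<open>auto simp: eq mult_closed rng_mult src_mult rng_inv mult_inv_cancel\<close>)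
qed

lemma bisection_map_closed:
  assumes "B \<in> bisections" "x \<in> bisection_dom B"
  shows "bisection_map B x \<in> X" "src G (bisection_map B x) = src G x"
  by (rule bisection_mapE[OF assms], assumption)+

lemma bisection_action_eq:
  assumes "B \<in> bisections" "x \<in> X"
  shows "bisection_action G B \<xi> x = (if x \<in> bisection_dom B then \<xi> (bisection_map B x) else 0)"
proof (cases "x \<in> bisection_dom B")
  case True
  have B: "inj_on (rng G) B" "B \<subseteq> X"
    using assms(1) sets.sets_into_space by (auto simp: bisections_def)
  from assms(1) True show ?thesis
  proof (rule bisection_mapE)
    fix b assume b: "b \<in> B" "rng G b = rng G x" "bisection_map B x = gmult G (ginv G b) x"
    then show ?thesis using bisection_action_in[OF B b(1) assms(2) b(2)] True by simp
  qed
next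
  case False
  then have "rng G x \<notin> rng G ` B" using assms(2) by (simp add: bisection_dom_def)
  then have "\<And>b. b \<in> B \<Longrightarrow> rng G b \<noteq> rng G x" by (metis imageI)
  then show ?thesis using bisection_action_notin[OF assms(2)] False by simp
qed

lemma inverse_bisection_eq:
  assumes "B \<subseteq> X" shows "ginv G ` B = ginv G -` B \<inter> X"
  using assms inv_inv inv_closed by (auto simp: subset_iff intro: rev_image_eqI)

lemma src_inverse_bisection: "B \<subseteq> X \<Longrightarrow> src G ` ginv G ` B = rng G ` B"
  and rng_inverse_bisection: "B \<subseteq> X \<Longrightarrow> rng G ` ginv G ` B = src G ` B"
  using src_inv rng_inv by (force simp: image_image subset_iff)+

lemma inverse_bisection:
  assumes "B \<in> bisections" shows "ginv G ` B \<in> bisections"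
proof -
  have B: "B \<in> sets (arrows G)" "inj_on (src G) B" "inj_on (rng G) B" "B \<subseteq> X"
    using assms sets.sets_into_space by (auto simp: bisections_def)
  have "ginv G ` B \<in> sets (arrows G)"
    unfolding inverse_bisection_eq[OF B(4)] by (rule measurable_sets[OF inv_borel B(1)])
  moreover have "inj_on (src G) (ginv G ` B)" "inj_on (rng G) (ginv G ` B)"
    using B by (auto simp: inj_on_def src_inv rng_inv subset_iff)
  ultimately show ?thesis by (simp add: bisections_def)
qed

lemma inverse_regular_bisection:
  assumes "B \<in> regular_bisections" shows "ginv G ` B \<in> regular_bisections"
proof -
  note B = regular_bisectionsD[OF assms]
  have B': "ginv G ` B \<in> sets (arrows G)" "inj_on (src G) (ginv G ` B)" "inj_on (rng G) (ginv G ` B)"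
    using inverse_bisection[OF B(1)] by (auto simp: bisections_def)
  have sp: "space (restrict_space \<mu> A) = A" if "A \<in> sets \<mu>" for A
    using sets.sets_into_space[OF that] by (auto simp: space_restrict_space)
  have *: "the_inv_into (ginv G ` B) f \<in> restrict_space \<mu> (g ` B) \<rightarrow>\<^sub>M arrows G"
    if g: "borel_section (arrows G) \<mu> g B" and inj: "inj_on f (ginv G ` B)"
      and fg: "\<And>x. x \<in> X \<Longrightarrow> f (ginv G x) = g x" for f g
  proof -
    note g' = g[unfolded borel_section_def]
    have "(\<lambda>u. ginv G (the_inv_into B g u)) \<in> restrict_space \<mu> (g ` B) \<rightarrow>\<^sub>M arrows G"
      using g' by (intro measurable_compose[OF _ inv_borel]) auto
    moreover have "the_inv_into (ginv G ` B) f u = ginv G (the_inv_into B g u)" if u: "u \<in> g ` B" for u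
    proof -
      obtain b where b: "b \<in> B" "u = g b" using u by blast
      have "the_inv_into B g u = b" using g' b by (auto intro: the_inv_into_f_eq)
      moreover have "the_inv_into (ginv G ` B) f u = ginv G b"
        using b B(3) fg by (intro the_inv_into_f_eq inj) auto
      ultimately show ?thesis by simp
    qed
    ultimately show ?thesis using sp g' by (subst measurable_cong) auto
  qed
  have "borel_section (arrows G) \<mu> (src G) (ginv G ` B)"
    unfolding borel_section_def src_inverse_bisection[OF B(3)]
    using B' B(7) *[of "rng G" "src G"] assms src_inv by (auto simp: regular_bisections_def)
  moreover have "borel_section (arrows G) \<mu> (rng G) (ginv G ` B)"
    unfolding borel_section_def rng_inverse_bisection[OF B(3)]
    using B' B(6) *[of "src G" "rng G"] assms rng_inv by (auto simp: regular_bisections_def)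
  ultimately show ?thesis by (simp add: regular_bisections_def)
qed

lemma inverse_inverse_bisection: "B \<subseteq> X \<Longrightarrow> ginv G ` ginv G ` B = B"
  using inv_inv by (force simp: image_image subset_iff)

lemma bisection_map_inverse:
  assumes "B \<in> bisections" "x \<in> bisection_dom B"
  shows "bisection_map B x \<in> bisection_dom (ginv G ` B)"
    "bisection_map (ginv G ` B) (bisection_map B x) = x"
proof -
  have BX: "B \<subseteq> X" using assms(1) sets.sets_into_space by (auto simp: bisections_def)
  obtain b where b: "b \<in> B" "b \<in> X" "x \<in> X" "rng G b = rng G x"
      "bisection_map B x \<in> X" "rng G (bisection_map B x) = src G b" "gmult G b (bisection_map B x) = x"
    by (rule bisection_mapE[OF assms])
  show 1: "bisection_map B x \<in> bisection_dom (ginv G ` B)"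
    unfolding bisection_dom_def rng_inverse_bisection[OF BX] using b by auto
  obtain c where c: "c \<in> ginv G ` B" "rng G c = rng G (bisection_map B x)"
      "bisection_map (ginv G ` B) (bisection_map B x) = gmult G (ginv G c) (bisection_map B x)"
    by (rule bisection_mapE[OF inverse_bisection[OF assms(1)] 1])
  have "ginv G b \<in> ginv G ` B" "rng G (ginv G b) = rng G c" using b c by (auto simp: rng_inv)
  then have "c = ginv G b"
    using c(1) inverse_bisection[OF assms(1)] by (auto simp: bisections_def dest: inj_onD)
  then show "bisection_map (ginv G ` B) (bisection_map B x) = x" using c(3) b inv_inv by simp
qed

lemma bisection_dom_sets:
  assumes "B \<in> regular_bisections" shows "bisection_dom B \<in> sets (arrows G)"
proof -
  have "bisection_dom B = rng G -` (rng G ` B) \<inter> X" by (auto simp: bisection_dom_def)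
  then show ?thesis
    using measurable_sets[OF rng_measurable regular_bisectionsD(7)[OF assms]] by simp
qed

lemma bisection_map_measurable:
  assumes "B \<in> regular_bisections"
  shows "bisection_map B \<in> restrict_space (arrows G) (bisection_dom B) \<rightarrow>\<^sub>M arrows G"
proof -
  note B = regular_bisectionsD[OF assms]
  let ?R = "restrict_space (arrows G) (bisection_dom B)"
  have rng: "rng G \<in> ?R \<rightarrow>\<^sub>M restrict_space \<mu> (rng G ` B)"
    by (rule measurable_restrict_space3[OF rng_measurable]) (auto simp: bisection_dom_def)
  have inv: "the_inv_into B (rng G) \<in> restrict_space \<mu> (rng G ` B) \<rightarrow>\<^sub>M arrows G"
    using assms by (simp add: regular_bisections_def borel_section_def)
  have 1: "(\<lambda>x. ginv G (the_inv_into B (rng G) (rng G x))) \<in> ?R \<rightarrow>\<^sub>M arrows G"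
    by (rule measurable_compose[OF measurable_compose[OF rng inv] inv_borel])
  have "(\<lambda>x. (ginv G (the_inv_into B (rng G) (rng G x)), x)) \<in> ?R \<rightarrow>\<^sub>M arrows G \<Otimes>\<^sub>M arrows G"
    by (intro measurable_Pair 1 measurable_restrict_space1) simp
  moreover have "(ginv G (the_inv_into B (rng G) (rng G x)), x) \<in> composable G"
    if x: "x \<in> space ?R" for x
  proof -
    have "x \<in> X" "rng G x \<in> rng G ` B" using x by (auto simp: space_restrict_space bisection_dom_def)
    then show ?thesis
      using B(3,5) f_the_inv_into_f[of "rng G" B "rng G x"] the_inv_into_into[of "rng G" B "rng G x" B]
      by (intro composableI) (auto simp: inv_closed src_inv subset_iff)
  qed
  ultimately have "(\<lambda>x. (ginv G (the_inv_into B (rng G) (rng G x)), x))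
      \<in> ?R \<rightarrow>\<^sub>M restrict_space (arrows G \<Otimes>\<^sub>M arrows G) (composable G)"
    by (intro measurable_restrict_space2) auto
  from measurable_compose[OF this mult_borel] show ?thesis
    by (simp add: bisection_map_def[abs_def])
qed

lemma cardinality_bij_betw:
  assumes "bij_betw f A B" shows "cardinality A = cardinality B"
  using assms bij_betw_same_card[OF assms] bij_betw_finite[OF assms]
  by (cases "finite A") (auto simp: emeasure_count_space)

lemma bisection_dom_inverse_X: "bisection_dom B \<subseteq> X"
  by (auto simp: bisection_dom_def)

text \<open>Left translation preserves sources, hence permutes the arrows of each source fibre, and the measure
  counts the arrows in source fibres.\<close>

lemma emeasure_bisection_map:
  assumes "B \<in> regular_bisections" "A \<in> sets (arrows G)"
  shows "emeasure \<nu> {x \<in> bisection_dom B. bisection_map B x \<in> A}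
    = emeasure \<nu> (A \<inter> bisection_dom (ginv G ` B))"
proof -
  let ?B' = "ginv G ` B"
  note B = regular_bisectionsD[OF assms(1)]
  have dom: "bisection_dom B \<in> sets (arrows G)" using bisection_dom_sets[OF assms(1)] .
  have dom': "bisection_dom ?B' \<in> sets (arrows G)"
    using bisection_dom_sets[OF inverse_regular_bisection[OF assms(1)]] .
  have T: "bisection_map B x \<in> bisection_dom ?B'" "bisection_map ?B' (bisection_map B x) = x"
    "src G (bisection_map B x) = src G x" if "x \<in> bisection_dom B" for x
    using bisection_map_inverse[OF B(1) that] bisection_map_closed[OF B(1) that] by auto
  have T': "bisection_map ?B' y \<in> bisection_dom B" "bisection_map B (bisection_map ?B' y) = y"
    "src G (bisection_map ?B' y) = src G y" if "y \<in> bisection_dom ?B'" for y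
    using bisection_map_inverse[OF inverse_bisection[OF B(1)] that]
      bisection_map_closed[OF inverse_bisection[OF B(1)] that] inverse_inverse_bisection[OF B(3)] by auto
  have meas: "{x \<in> bisection_dom B. bisection_map B x \<in> A} \<in> sets (arrows G)"
    by (rule measurable_restrict_space_partialD(2)[OF dom bisection_map_measurable[OF assms(1)] assms(2)])
  have "cardinality {x \<in> {x \<in> bisection_dom B. bisection_map B x \<in> A}. src G x = u}
      = cardinality {x \<in> A \<inter> bisection_dom ?B'. src G x = u}" for u
    by (rule cardinality_bij_betw,
        rule bij_betw_byWitness[where f = "bisection_map B" and f' = "bisection_map ?B'"])
      (use T T' in auto)
  then show ?thesis
    using emeasure_nu[OF meas] emeasure_nu[of "A \<inter> bisection_dom ?B'"] dom' assms(2) by simp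
qed

lemma distr_bisection_map:
  assumes "B \<in> regular_bisections"
  shows "distr (restrict_space \<nu> (bisection_dom B)) \<nu> (bisection_map B)
    = density \<nu> (\<lambda>x. ennreal (indicator (bisection_dom (ginv G ` B)) x))"
    (is "?l = ?r")
proof (rule measure_eqI)
  show "sets ?l = sets ?r" by simp
  fix A assume "A \<in> sets ?l"
  then have A: "A \<in> sets (arrows G)" by simp
  have dom: "bisection_dom B \<in> sets (arrows G)" using bisection_dom_sets[OF assms] .
  have dom': "bisection_dom (ginv G ` B) \<in> sets (arrows G)"
    using bisection_dom_sets[OF inverse_regular_bisection[OF assms]] .
  have meas: "bisection_map B \<in> restrict_space \<nu> (bisection_dom B) \<rightarrow>\<^sub>M \<nu>"
    using bisection_map_measurable[OF assms]
    by (subst measurable_cong_sets[OF sets_restrict_space_cong sets_nu]) (auto simp: )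
  have "emeasure ?l A = emeasure (restrict_space \<nu> (bisection_dom B))
      (bisection_map B -` A \<inter> space (restrict_space \<nu> (bisection_dom B)))"
    using meas A by (intro emeasure_distr) auto
  also have "bisection_map B -` A \<inter> space (restrict_space \<nu> (bisection_dom B))
      = {x \<in> bisection_dom B. bisection_map B x \<in> A}"
    using bisection_dom_inverse_X by (auto simp: space_restrict_space)
  also have "emeasure (restrict_space \<nu> (bisection_dom B)) \<dots> = emeasure \<nu> \<dots>"
    using dom bisection_dom_inverse_X by (intro emeasure_restrict_space) (auto simp: Int_absorb2)
  also have "\<dots> = emeasure \<nu> (A \<inter> bisection_dom (ginv G ` B))"
    by (rule emeasure_bisection_map[OF assms A])
  also have "\<dots> = emeasure ?r A"
    using A dom' by (subst emeasure_density)
      (auto simp: indicator_inter_arith[symmetric] ennreal_indicator Int_commute)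
  finally show "emeasure ?l A = emeasure ?r A" .
qed

lemma integral_bisection_map:
  fixes h :: "'g \<Rightarrow> 'b :: {banach, second_countable_topology}"
  assumes "B \<in> regular_bisections" and h: "h \<in> borel_measurable \<nu>"
  shows "integrable \<nu> (\<lambda>x. indicator (bisection_dom B) x *\<^sub>R h (bisection_map B x))
      \<longleftrightarrow> integrable \<nu> (\<lambda>x. indicator (bisection_dom (ginv G ` B)) x *\<^sub>R h x)"
    and "(\<integral>x. indicator (bisection_dom B) x *\<^sub>R h (bisection_map B x) \<partial>\<nu>)
      = (\<integral>x. indicator (bisection_dom (ginv G ` B)) x *\<^sub>R h x \<partial>\<nu>)"
proof -
  have dom: "bisection_dom B \<inter> space \<nu> \<in> sets \<nu>"
    using bisection_dom_sets[OF assms(1)] by auto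
  have dom': "bisection_dom (ginv G ` B) \<in> sets \<nu>"
    using bisection_dom_sets[OF inverse_regular_bisection[OF assms(1)]] by simp
  have meas: "bisection_map B \<in> restrict_space \<nu> (bisection_dom B) \<rightarrow>\<^sub>M \<nu>"
    using bisection_map_measurable[OF assms(1)]
    by (subst measurable_cong_sets[OF sets_restrict_space_cong sets_nu]) (auto simp: )
  have ind: "(\<lambda>x. indicator (bisection_dom (ginv G ` B)) x :: real) \<in> borel_measurable \<nu>"
    using dom' by simp
  show "integrable \<nu> (\<lambda>x. indicator (bisection_dom B) x *\<^sub>R h (bisection_map B x))
      \<longleftrightarrow> integrable \<nu> (\<lambda>x. indicator (bisection_dom (ginv G ` B)) x *\<^sub>R h x)"
    unfolding integrable_restrict_space[OF dom, symmetric]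
      integrable_density[OF h ind AE_I2[OF indicator_pos_le], symmetric]
      distr_bisection_map[OF assms(1), symmetric]
    by (rule integrable_distr_eq[symmetric, OF meas h])
  show "(\<integral>x. indicator (bisection_dom B) x *\<^sub>R h (bisection_map B x) \<partial>\<nu>)
      = (\<integral>x. indicator (bisection_dom (ginv G ` B)) x *\<^sub>R h x \<partial>\<nu>)"
    unfolding integral_restrict_space[OF dom, symmetric]
      integral_density[OF h ind AE_I2[OF indicator_pos_le], symmetric]
      distr_bisection_map[OF assms(1), symmetric]
    by (rule integral_distr[symmetric, OF meas h])
qed

lemma bisection_action_measurable:
  assumes "B \<in> regular_bisections" and \<xi>: "\<xi> \<in> borel_measurable \<nu>"
  shows "bisection_action G B \<xi> \<in> borel_measurable \<nu>"
proof -
  have dom: "bisection_dom B \<in> sets \<nu>" using bisection_dom_sets[OF assms(1)] by simp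
  have meas: "bisection_map B \<in> restrict_space \<nu> (bisection_dom B) \<rightarrow>\<^sub>M \<nu>"
    using bisection_map_measurable[OF assms(1)]
    by (subst measurable_cong_sets[OF sets_restrict_space_cong sets_nu]) (auto simp: )
  have "(\<lambda>x. if x \<in> bisection_dom B then \<xi> (bisection_map B x) else 0) \<in> borel_measurable \<nu>"
    using measurable_compose[OF meas \<xi>] dom
    by (subst (asm) measurable_restrict_space_iff[where c = 0]) auto
  then show ?thesis
    by (subst measurable_cong[where g = "\<lambda>x. if x \<in> bisection_dom B then \<xi> (bisection_map B x) else 0"])
      (auto simp: bisection_action_eq[OF regular_bisectionsD(1)[OF assms(1)]])
qed

lemma bisection_action_AE_cong:
  assumes "B \<in> regular_bisections" "AE x in \<nu>. \<xi> x = \<eta> x"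
  shows "AE x in \<nu>. bisection_action G B \<xi> x = bisection_action G B \<eta> x"
proof -
  obtain N where N: "N \<in> null_sets \<nu>" "{x \<in> space \<nu>. \<not> \<xi> x = \<eta> x} \<subseteq> N"
    using assms(2) by (rule AE_E3) auto
  then have NX: "N \<in> sets (arrows G)" by auto
  note B = regular_bisectionsD[OF assms(1)]
  let ?N' = "{x \<in> bisection_dom B. bisection_map B x \<in> N}"
  have "emeasure \<nu> ?N' = emeasure \<nu> (N \<inter> bisection_dom (ginv G ` B))"
    by (rule emeasure_bisection_map[OF assms(1) NX])
  also have "\<dots> = 0"
    using N bisection_dom_sets[OF inverse_regular_bisection[OF assms(1)]]
    by (intro null_setsD1 null_set_Int2) auto
  finally have "emeasure \<nu> ?N' = 0" .
  moreover have "?N' \<in> sets \<nu>"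
    using measurable_restrict_space_partialD(2)[OF bisection_dom_sets[OF assms(1)]
      bisection_map_measurable[OF assms(1)] NX] by simp
  ultimately have "AE x in \<nu>. x \<notin> ?N'" by (intro AE_not_in) auto
  then show ?thesis
  proof (rule AE_mp, intro AE_I2 impI)
    fix x assume x: "x \<in> space \<nu>" "x \<notin> ?N'"
    then show "bisection_action G B \<xi> x = bisection_action G B \<eta> x"
      using N(2) bisection_map_closed(1)[OF B(1), of x] by (auto simp: bisection_action_eq[OF B(1)])
  qed
qed

end

section \<open>Square integrable functions modulo null sets\<close>

lemma square_integrable_add:
  assumes "f \<in> square_integrable M" "g \<in> square_integrable M"
  shows "(\<lambda>x. f x + g x) \<in> square_integrable M"
proof -
  have fg: "f \<in> borel_measurable M" "g \<in> borel_measurable M"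
    "integrable M (\<lambda>x. (cmod (f x))\<^sup>2)" "integrable M (\<lambda>x. (cmod (g x))\<^sup>2)"
    using assms by (auto simp: square_integrable_def)
  have "integrable M (\<lambda>x. (cmod (f x + g x))\<^sup>2)"
  proof (rule Bochner_Integration.integrable_bound)
    show "integrable M (\<lambda>x. 2 * (cmod (f x))\<^sup>2 + 2 * (cmod (g x))\<^sup>2)" using fg by auto
    show "(\<lambda>x. (cmod (f x + g x))\<^sup>2) \<in> borel_measurable M" using fg(1,2) by measurable
    have "(cmod (f x + g x))\<^sup>2 \<le> 2 * (cmod (f x))\<^sup>2 + 2 * (cmod (g x))\<^sup>2" for x
    proof -
      have "(cmod (f x + g x))\<^sup>2 \<le> (cmod (f x) + cmod (g x))\<^sup>2"
        by (intro power_mono norm_triangle_ineq) auto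
      also have "\<dots> \<le> 2 * (cmod (f x))\<^sup>2 + 2 * (cmod (g x))\<^sup>2"
        using zero_le_power2[of "cmod (f x) - cmod (g x)"] by (simp add: power2_sum power2_diff)
      finally show ?thesis .
    qed
    then show "AE x in M. norm ((cmod (f x + g x))\<^sup>2) \<le> norm (2 * (cmod (f x))\<^sup>2 + 2 * (cmod (g x))\<^sup>2)"
      by (intro AE_I2) simp
  qed
  then show ?thesis using fg by (simp add: square_integrable_def)
qed

lemma square_integrable_scale:
  assumes "f \<in> square_integrable M"
  shows "(\<lambda>x. c * f x) \<in> square_integrable M"
  using assms by (auto simp: square_integrable_def norm_mult power_mult_distrib)

lemma square_integrable_inner:
  assumes "f \<in> square_integrable M" "g \<in> square_integrable M"
  shows "integrable M (\<lambda>x. f x * cnj (g x))"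
proof (rule Bochner_Integration.integrable_bound)
  have fg: "f \<in> borel_measurable M" "g \<in> borel_measurable M"
    "integrable M (\<lambda>x. (cmod (f x))\<^sup>2)" "integrable M (\<lambda>x. (cmod (g x))\<^sup>2)"
    using assms by (auto simp: square_integrable_def)
  show "integrable M (\<lambda>x. (cmod (f x))\<^sup>2 + (cmod (g x))\<^sup>2)" using fg by auto
  have "(\<lambda>x. cnj (g x)) \<in> borel_measurable M"
    by (rule measurable_compose[OF fg(2) borel_measurable_continuous_onI[OF continuous_on_cnj]]) simp
  then show "(\<lambda>x. f x * cnj (g x)) \<in> borel_measurable M" using fg(1) by measurable
  have "cmod (f x) * cmod (g x) \<le> (cmod (f x))\<^sup>2 + (cmod (g x))\<^sup>2" for x
    using zero_le_power2[of "cmod (f x) - cmod (g x)"] zero_le_power2[of "cmod (f x)"]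
      zero_le_power2[of "cmod (g x)"] unfolding power2_diff by linarith
  then show "AE x in M. norm (f x * cnj (g x)) \<le> norm ((cmod (f x))\<^sup>2 + (cmod (g x))\<^sup>2)"
    by (intro AE_I2) (simp add: norm_mult)
qed

lemma l2_class_cong:
  assumes "AE x in M. f x = g x" shows "l2_class M f = l2_class M g"
proof -
  have "(AE x in M. h x = f x) \<longleftrightarrow> (AE x in M. h x = g x)" for h
    using assms by (intro iffI) (auto elim: eventually_elim2)
  then show ?thesis unfolding l2_class_def by simp
qed

lemma l2_rep_class:
  assumes "f \<in> square_integrable M"
  shows "l2_rep (l2_class M f) \<in> square_integrable M" "AE x in M. l2_rep (l2_class M f) x = f x"
proof -
  have "f \<in> l2_class M f" using assms by (simp add: l2_class_def)
  then have "l2_class M f \<noteq> {}" by auto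
  then have "l2_rep (l2_class M f) \<in> l2_class M f" unfolding l2_rep_def some_in_eq .
  then show "l2_rep (l2_class M f) \<in> square_integrable M" "AE x in M. l2_rep (l2_class M f) x = f x"
    by (auto simp: l2_class_def)
qed

lemma L2I: "f \<in> square_integrable M \<Longrightarrow> l2_class M f \<in> L2 M"
  by (simp add: L2_def)

lemma L2E:
  assumes "Y \<in> L2 M"
  obtains f where "f \<in> square_integrable M" "Y = l2_class M f"
  using assms by (auto simp: L2_def)

lemma l2_add_class:
  assumes "f \<in> square_integrable M" "g \<in> square_integrable M"
  shows "l2_add M (l2_class M f) (l2_class M g) = l2_class M (\<lambda>x. f x + g x)"
  unfolding l2_add_def
  using l2_rep_class(2)[OF assms(1)] l2_rep_class(2)[OF assms(2)]
  by (intro l2_class_cong) (auto elim: eventually_elim2)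

lemma l2_scale_class:
  assumes "f \<in> square_integrable M"
  shows "l2_scale M c (l2_class M f) = l2_class M (\<lambda>x. c * f x)"
  unfolding l2_scale_def
  using l2_rep_class(2)[OF assms] by (intro l2_class_cong) auto

lemma l2_inner_class:
  assumes "f \<in> square_integrable M" "g \<in> square_integrable M"
  shows "l2_inner M (l2_class M f) (l2_class M g) = (\<integral>x. f x * cnj (g x) \<partial>M)"
  unfolding l2_inner_def
proof (rule integral_cong_AE)
  show "AE x in M. l2_rep (l2_class M f) x * cnj (l2_rep (l2_class M g) x) = f x * cnj (g x)"
    using l2_rep_class(2)[OF assms(1)] l2_rep_class(2)[OF assms(2)] by (auto elim: eventually_elim2)
  show "(\<lambda>x. f x * cnj (g x)) \<in> borel_measurable M"
    using square_integrable_inner[OF assms] by (rule borel_measurable_integrable)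
  show "(\<lambda>x. l2_rep (l2_class M f) x * cnj (l2_rep (l2_class M g) x)) \<in> borel_measurable M"
    using square_integrable_inner[OF l2_rep_class(1)[OF assms(1)] l2_rep_class(1)[OF assms(2)]]
    by (rule borel_measurable_integrable)
qed

lemma l2_norm_class:
  assumes "f \<in> square_integrable M"
  shows "l2_norm M (l2_class M f) = sqrt (\<integral>x. (cmod (f x))\<^sup>2 \<partial>M)"
proof -
  have "(\<integral>x. f x * cnj (f x) \<partial>M) = complex_of_real (\<integral>x. (cmod (f x))\<^sup>2 \<partial>M)"
    by (simp only: complex_norm_square[symmetric] integral_complex_of_real)
  then show ?thesis unfolding l2_norm_def l2_inner_class[OF assms assms] by (simp only: Re_complex_of_real)
qed

lemma l2_inner_nondegenerate:
  assumes f: "f \<in> square_integrable M" and g: "g \<in> square_integrable M"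
    and eq: "\<And>Y. Y \<in> L2 M \<Longrightarrow> l2_inner M Y (l2_class M f) = l2_inner M Y (l2_class M g)"
  shows "l2_class M f = l2_class M g"
proof -
  define h where "h x = f x + (- 1) * g x" for x
  have h: "h \<in> square_integrable M"
    unfolding h_def[abs_def] by (intro square_integrable_add square_integrable_scale f g)
  have "(\<integral>x. h x * cnj (h x) \<partial>M) = (\<integral>x. h x * cnj (f x) - h x * cnj (g x) \<partial>M)"
    by (simp add: h_def algebra_simps)
  also have "\<dots> = (\<integral>x. h x * cnj (f x) \<partial>M) - (\<integral>x. h x * cnj (g x) \<partial>M)"
    by (intro Bochner_Integration.integral_diff square_integrable_inner h f g)
  also have "\<dots> = 0"
    using eq[OF L2I[OF h]] by (simp add: l2_inner_class h f g)
  finally have "complex_of_real (\<integral>x. (cmod (h x))\<^sup>2 \<partial>M) = 0"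
    by (simp only: complex_norm_square[symmetric] integral_complex_of_real)
  then have "(\<integral>x. (cmod (h x))\<^sup>2 \<partial>M) = 0" by simp
  moreover have "integrable M (\<lambda>x. (cmod (h x))\<^sup>2)" using h by (simp add: square_integrable_def)
  ultimately have "AE x in M. (cmod (h x))\<^sup>2 = 0"
    by (subst (asm) integral_nonneg_eq_0_iff_AE) auto
  then have "AE x in M. f x = g x" by (rule AE_mp) (auto intro!: AE_I2 simp: h_def)
  then show ?thesis by (rule l2_class_cong)
qed

text \<open>The adjoint is given by a definite description; uniqueness is the nondegeneracy of the inner product.\<close>

lemma op_adjoint_eqI:
  assumes b: "b \<in> bounded_ops M"
    and adj: "\<And>X Y. X \<in> L2 M \<Longrightarrow> Y \<in> L2 M \<Longrightarrow> l2_inner M (a X) Y = l2_inner M X (b Y)"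
  shows "op_adjoint M a = b"
  unfolding op_adjoint_def
proof (rule the_equality)
  show "b \<in> bounded_ops M \<and> (\<forall>X\<in>L2 M. \<forall>Y\<in>L2 M. l2_inner M (a X) Y = l2_inner M X (b Y))"
    using b adj by blast
next
  fix c assume c: "c \<in> bounded_ops M \<and> (\<forall>X\<in>L2 M. \<forall>Y\<in>L2 M. l2_inner M (a X) Y = l2_inner M X (c Y))"
  have maps: "b \<in> L2 M \<rightarrow>\<^sub>E L2 M" "c \<in> L2 M \<rightarrow>\<^sub>E L2 M" using b c by (auto simp: bounded_ops_def)
  show "c = b"
  proof (rule PiE_ext[OF maps(2,1)])
    fix Y assume Y: "Y \<in> L2 M"
    then have bY: "b Y \<in> L2 M" and cY: "c Y \<in> L2 M" using maps by auto
    obtain f where f: "f \<in> square_integrable M" "b Y = l2_class M f" using bY by (rule L2E)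
    obtain g where g: "g \<in> square_integrable M" "c Y = l2_class M g" using cY by (rule L2E)
    note fg = f(1) g(1) f(2) g(2)
    have "l2_class M g = l2_class M f"
    proof (rule l2_inner_nondegenerate[OF fg(2,1)])
      fix X assume "X \<in> L2 M"
      then show "l2_inner M X (l2_class M g) = l2_inner M X (l2_class M f)"
        using adj[of X Y] c Y fg by simp
    qed
    then show "c Y = b Y" using fg by simp
  qed
qed

section \<open>The inverse semigroup of bisection operators\<close>

context pmp_groupoid
begin

lemma bisection_op_conull:
  assumes "B \<in> bisections" "B' \<in> sets (arrows G)" "B' \<subseteq> B" "emeasure \<nu> (B - B') = 0"
  shows "bisection_op G \<mu> B = bisection_op G \<mu> B'"
  unfolding bisection_op_def
  using bisection_action_conull[OF assms]
  by (intro restrict_ext l2_class_cong) (auto elim: eventually_mono)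

lemma I_groupoidE:
  assumes "s \<in> I_groupoid G \<mu>"
  obtains B where "B \<in> regular_bisections" "s = bisection_op G \<mu> B"
proof -
  obtain B where B: "B \<in> bisections" "s = bisection_op G \<mu> B"
    using assms by (auto simp: I_groupoid_def bisections_def)
  obtain B' where B': "B' \<in> regular_bisections" "B' \<subseteq> B" "emeasure \<nu> (B - B') = 0"
    by (rule regular_bisection_conull[OF B(1)])
  show thesis
    using that[OF B'(1)] bisection_op_conull[OF B(1) regular_bisectionsD(2)[OF B'(1)] B'(2,3)] B(2)
    by simp
qed

lemma bisection_op_I: "B \<in> bisections \<Longrightarrow> bisection_op G \<mu> B \<in> I_groupoid G \<mu>"
  by (auto simp: I_groupoid_def bisections_def)

lemma cmod_bisection_action:
  assumes "B \<in> bisections" "x \<in> X"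
  shows "(cmod (bisection_action G B \<xi> x))\<^sup>2
    = indicator (bisection_dom B) x *\<^sub>R (cmod (\<xi> (bisection_map B x)))\<^sup>2"
  using assms by (simp add: bisection_action_eq)

lemma bisection_action_contraction:
  assumes "B \<in> regular_bisections" "\<xi> \<in> square_integrable \<nu>"
  shows "bisection_action G B \<xi> \<in> square_integrable \<nu>"
    and "(\<integral>x. (cmod (bisection_action G B \<xi> x))\<^sup>2 \<partial>\<nu>) \<le> (\<integral>x. (cmod (\<xi> x))\<^sup>2 \<partial>\<nu>)"
proof -
  have \<xi>: "\<xi> \<in> borel_measurable \<nu>" "integrable \<nu> (\<lambda>x. (cmod (\<xi> x))\<^sup>2)"
    using assms(2) by (auto simp: square_integrable_def)
  have meas: "(\<lambda>x. (cmod (\<xi> x))\<^sup>2) \<in> borel_measurable \<nu>" using \<xi>(1) by measurable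
  note B = regular_bisectionsD[OF assms(1)]
  have dom': "bisection_dom (ginv G ` B) \<in> sets \<nu>"
    using bisection_dom_sets[OF inverse_regular_bisection[OF assms(1)]] by simp
  note int = integral_bisection_map[OF assms(1) meas]
  have eq: "(cmod (bisection_action G B \<xi> x))\<^sup>2
      = indicator (bisection_dom B) x *\<^sub>R (cmod (\<xi> (bisection_map B x)))\<^sup>2" if "x \<in> space \<nu>" for x
    using cmod_bisection_action[OF B(1)] that by simp
  have int': "integrable \<nu> (\<lambda>x. indicator (bisection_dom (ginv G ` B)) x *\<^sub>R (cmod (\<xi> x))\<^sup>2)"
    by (rule integrable_mult_indicator[OF dom' \<xi>(2)])
  then have "integrable \<nu> (\<lambda>x. indicator (bisection_dom B) x *\<^sub>R (cmod (\<xi> (bisection_map B x)))\<^sup>2)"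
    unfolding int(1) .
  then have "integrable \<nu> (\<lambda>x. (cmod (bisection_action G B \<xi> x))\<^sup>2)"
    by (subst Bochner_Integration.integrable_cong[OF refl eq]) auto
  then show "bisection_action G B \<xi> \<in> square_integrable \<nu>"
    using bisection_action_measurable[OF assms(1) \<xi>(1)] by (simp add: square_integrable_def)
  have "(\<integral>x. (cmod (bisection_action G B \<xi> x))\<^sup>2 \<partial>\<nu>)
      = (\<integral>x. indicator (bisection_dom B) x *\<^sub>R (cmod (\<xi> (bisection_map B x)))\<^sup>2 \<partial>\<nu>)"
    by (rule Bochner_Integration.integral_cong[OF refl eq])
  also have "\<dots> = (\<integral>x. indicator (bisection_dom (ginv G ` B)) x *\<^sub>R (cmod (\<xi> x))\<^sup>2 \<partial>\<nu>)"
    by (rule int(2))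
  also have "\<dots> \<le> (\<integral>x. (cmod (\<xi> x))\<^sup>2 \<partial>\<nu>)"
    by (intro integral_mono int' \<xi>(2)) (auto simp: indicator_def)
  finally show "(\<integral>x. (cmod (bisection_action G B \<xi> x))\<^sup>2 \<partial>\<nu>) \<le> (\<integral>x. (cmod (\<xi> x))\<^sup>2 \<partial>\<nu>)" .
qed

lemma bisection_op_class:
  assumes "B \<in> regular_bisections" "f \<in> square_integrable \<nu>"
  shows "bisection_op G \<mu> B (l2_class \<nu> f) = l2_class \<nu> (bisection_action G B f)"
  unfolding bisection_op_def
  using L2I[OF assms(2)] bisection_action_AE_cong[OF assms(1) l2_rep_class(2)[OF assms(2)]]
  by (simp add: l2_class_cong)

lemma bisection_op_bounded:
  assumes "B \<in> regular_bisections"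
  shows "bisection_op G \<mu> B \<in> bounded_ops \<nu>"
  unfolding bounded_ops_def
proof (intro CollectI conjI ballI allI exI[of _ 1])
  note B = regular_bisectionsD(1)[OF assms]
  show "bisection_op G \<mu> B \<in> L2 \<nu> \<rightarrow>\<^sub>E L2 \<nu>"
  proof (rule PiE_I)
    fix Y assume "Y \<in> L2 \<nu>"
    then show "bisection_op G \<mu> B Y \<in> L2 \<nu>"
      by (elim L2E) (simp add: bisection_op_class[OF assms] bisection_action_contraction(1)[OF assms] L2I)
  qed (simp add: bisection_op_def)
  fix Y assume "Y \<in> L2 \<nu>"
  then obtain f where f: "f \<in> square_integrable \<nu>" "Y = l2_class \<nu> f" by (rule L2E)
  note Uf = bisection_action_contraction[OF assms f(1)]
  show "bisection_op G \<mu> B (l2_scale \<nu> c Y) = l2_scale \<nu> c (bisection_op G \<mu> B Y)" for c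
    unfolding f(2) using square_integrable_scale[OF f(1)]
    by (simp add: l2_scale_class f(1) bisection_op_class[OF assms] Uf(1))
      (intro l2_class_cong AE_I2, simp add: bisection_action_eq[OF B])
  show "l2_norm \<nu> (bisection_op G \<mu> B Y) \<le> 1 * l2_norm \<nu> Y"
    unfolding f(2) using Uf by (simp add: bisection_op_class[OF assms] f(1) l2_norm_class)
  fix Z assume "Z \<in> L2 \<nu>"
  then obtain g where g: "g \<in> square_integrable \<nu>" "Z = l2_class \<nu> g" by (rule L2E)
  note Ug = bisection_action_contraction[OF assms g(1)]
  show "bisection_op G \<mu> B (l2_add \<nu> Y Z) = l2_add \<nu> (bisection_op G \<mu> B Y) (bisection_op G \<mu> B Z)"
    unfolding f(2) g(2) using square_integrable_add[OF f(1) g(1)]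
    by (simp add: l2_add_class f(1) g(1) bisection_op_class[OF assms] Uf(1) Ug(1))
      (intro l2_class_cong AE_I2, simp add: bisection_action_eq[OF B])
qed

text \<open>Translation by \<open>B\<close> inverts translation by the inverse of \<open>B\<close>, so that this is the invariance of the
  integral under translation.\<close>

lemma bisection_op_adjoint:
  assumes "B \<in> regular_bisections"
  shows "op_adjoint \<nu> (bisection_op G \<mu> B) = bisection_op G \<mu> (ginv G ` B)"
proof (rule op_adjoint_eqI)
  let ?B' = "ginv G ` B"
  have reg': "?B' \<in> regular_bisections" by (rule inverse_regular_bisection[OF assms])
  note B = regular_bisectionsD[OF assms] and B' = regular_bisectionsD[OF reg']
  show "bisection_op G \<mu> ?B' \<in> bounded_ops \<nu>" by (rule bisection_op_bounded[OF reg'])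
  fix Y Z assume Y: "Y \<in> L2 \<nu>" and Z: "Z \<in> L2 \<nu>"
  obtain f where f: "f \<in> square_integrable \<nu>" "Y = l2_class \<nu> f" using Y by (rule L2E)
  obtain g where g: "g \<in> square_integrable \<nu>" "Z = l2_class \<nu> g" using Z by (rule L2E)
  note Uf = bisection_action_contraction(1)[OF assms f(1)]
  note Ug = bisection_action_contraction(1)[OF reg' g(1)]
  define h where "h y = f y * cnj (bisection_action G ?B' g y)" for y
  have h: "h \<in> borel_measurable \<nu>"
    unfolding h_def[abs_def] using square_integrable_inner[OF f(1) Ug] by (rule borel_measurable_integrable)
  have 1: "bisection_action G B f x * cnj (g x) = indicator (bisection_dom B) x *\<^sub>R h (bisection_map B x)"
    if "x \<in> space \<nu>" for x
    using that bisection_map_inverse[OF B(1), of x] bisection_map_closed(1)[OF B(1), of x]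
    by (auto simp: bisection_action_eq[OF B(1)] bisection_action_eq[OF B'(1)] h_def)
  have 2: "indicator (bisection_dom ?B') x *\<^sub>R h x = f x * cnj (bisection_action G ?B' g x)"
    if "x \<in> space \<nu>" for x
    using that by (auto simp: bisection_action_eq[OF B'(1)] h_def)
  have "(\<integral>x. bisection_action G B f x * cnj (g x) \<partial>\<nu>)
      = (\<integral>x. indicator (bisection_dom B) x *\<^sub>R h (bisection_map B x) \<partial>\<nu>)"
    by (rule Bochner_Integration.integral_cong[OF refl 1])
  also have "\<dots> = (\<integral>x. indicator (bisection_dom ?B') x *\<^sub>R h x \<partial>\<nu>)"
    by (rule integral_bisection_map(2)[OF assms h])
  also have "\<dots> = (\<integral>x. f x * cnj (bisection_action G ?B' g x) \<partial>\<nu>)"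
    by (rule Bochner_Integration.integral_cong[OF refl 2])
  finally show "l2_inner \<nu> (bisection_op G \<mu> B Y) Z = l2_inner \<nu> Y (bisection_op G \<mu> ?B' Z)"
    unfolding f(2) g(2)
    by (simp add: bisection_op_class[OF assms f(1)] bisection_op_class[OF reg' g(1)]
        l2_inner_class f(1) g(1) Uf Ug)
qed

text \<open>The arrows \<open>b c\<close> with \<open>b \<in> B\<close> and \<open>c \<in> C\<close>.\<close>

definition bisection_prod :: "'g set \<Rightarrow> 'g set \<Rightarrow> 'g set" where
  "bisection_prod B C = {x \<in> bisection_dom B. bisection_map B x \<in> C}"

lemma bisection_prod_bisection:
  assumes "B \<in> regular_bisections" "C \<in> bisections"
  shows "bisection_prod B C \<in> bisections"
proof -
  note B = regular_bisectionsD[OF assms(1)]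
  have C: "C \<in> sets (arrows G)" "inj_on (src G) C" "inj_on (rng G) C"
    using assms(2) by (auto simp: bisections_def)
  have sets: "bisection_prod B C \<in> sets (arrows G)"
    unfolding bisection_prod_def
    by (rule measurable_restrict_space_partialD(2)[OF bisection_dom_sets[OF assms(1)]
      bisection_map_measurable[OF assms(1)] C(1)])
  have rng: "inj_on (rng G) (bisection_prod B C)"
  proof (rule inj_onI)
    fix x y assume xy: "x \<in> bisection_prod B C" "y \<in> bisection_prod B C" "rng G x = rng G y"
    then have dom: "x \<in> bisection_dom B" "y \<in> bisection_dom B"
      and m: "bisection_map B x \<in> C" "bisection_map B y \<in> C" by (auto simp: bisection_prod_def)
    obtain b where b: "b \<in> B" "rng G b = rng G x" "rng G (bisection_map B x) = src G b"
        "gmult G b (bisection_map B x) = x" by (rule bisection_mapE[OF B(1) dom(1)])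
    obtain b' where b': "b' \<in> B" "rng G b' = rng G y" "rng G (bisection_map B y) = src G b'"
        "gmult G b' (bisection_map B y) = y" by (rule bisection_mapE[OF B(1) dom(2)])
    have "b = b'" by (rule inj_onD[OF B(5) _ b(1) b'(1)]) (simp only: b(2) b'(2) xy(3))
    moreover have "bisection_map B x = bisection_map B y"
      by (rule inj_onD[OF C(3) _ m]) (simp only: b(3) b'(3) \<open>b = b'\<close>)
    ultimately have "gmult G b (bisection_map B x) = gmult G b' (bisection_map B y)" by (simp only:)
    then show "x = y" by (simp only: b(4) b'(4))
  qed
  have src: "inj_on (src G) (bisection_prod B C)"
  proof (rule inj_onI)
    fix x y assume xy: "x \<in> bisection_prod B C" "y \<in> bisection_prod B C" "src G x = src G y"
    then have dom: "x \<in> bisection_dom B" "y \<in> bisection_dom B"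
      and m: "bisection_map B x \<in> C" "bisection_map B y \<in> C" by (auto simp: bisection_prod_def)
    have eq: "bisection_map B x = bisection_map B y"
      by (rule inj_onD[OF C(2) _ m]) (simp only: bisection_map_closed(2)[OF B(1) dom(1)]
        bisection_map_closed(2)[OF B(1) dom(2)] xy(3))
    obtain b where b: "b \<in> B" "rng G (bisection_map B x) = src G b"
        "gmult G b (bisection_map B x) = x" by (rule bisection_mapE[OF B(1) dom(1)])
    obtain b' where b': "b' \<in> B" "rng G (bisection_map B y) = src G b'"
        "gmult G b' (bisection_map B y) = y" by (rule bisection_mapE[OF B(1) dom(2)])
    have "src G b = src G b'" using b(2) b'(2) eq by simp
    then have "b = b'" by (rule inj_onD[OF B(4) _ b(1) b'(1)])
    then have "gmult G b (bisection_map B x) = gmult G b' (bisection_map B y)" using eq by (simp only:)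
    then show "x = y" by (simp only: b(3) b'(3))
  qed
  show ?thesis using sets rng src by (simp add: bisections_def)
qed

lemma bisection_action_prod:
  assumes "B \<in> regular_bisections" "C \<in> bisections" "x \<in> X"
  shows "bisection_action G B (bisection_action G C \<xi>) x = bisection_action G (bisection_prod B C) \<xi> x"
proof -
  note B = regular_bisectionsD[OF assms(1)]
  have C: "inj_on (rng G) C" "C \<subseteq> X"
    using assms(2) sets.sets_into_space by (auto simp: bisections_def)
  have P: "bisection_prod B C \<in> bisections" by (rule bisection_prod_bisection[OF assms(1,2)])
  then have P': "inj_on (rng G) (bisection_prod B C)" "bisection_prod B C \<subseteq> X"
    using sets.sets_into_space by (auto simp: bisections_def)
  show ?thesis
  proof (cases "x \<in> bisection_dom B")
    case False
    then have "\<And>d. d \<in> bisection_prod B C \<Longrightarrow> rng G d \<noteq> rng G x"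
      using assms(3) by (auto simp: bisection_prod_def bisection_dom_def)
    then show ?thesis
      using False by (simp add: bisection_action_eq[OF B(1) assms(3)] bisection_action_notin[OF assms(3)])
  next
    case True
    obtain b where b: "b \<in> B" "b \<in> X" "rng G b = rng G x" "bisection_map B x = gmult G (ginv G b) x"
      "bisection_map B x \<in> X" "rng G (bisection_map B x) = src G b" "gmult G b (bisection_map B x) = x"
      by (rule bisection_mapE[OF B(1) True])
    define y where "y = bisection_map B x"
    have yX: "y \<in> X" using b(5) by (simp add: y_def)
    have lhs: "bisection_action G B (bisection_action G C \<xi>) x = bisection_action G C \<xi> y"
      using True by (simp add: bisection_action_eq[OF B(1) assms(3)] y_def)
    show ?thesis
    proof (cases "\<exists>c\<in>C. rng G c = rng G y")
      case True
      then obtain c where c: "c \<in> C" "rng G c = rng G y" by blast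
      have cX: "c \<in> X" using c C by blast
      have bc: "src G b = rng G c" using b c by (simp add: y_def)
      define d where "d = gmult G b c"
      have d: "d \<in> X" "rng G d = rng G b"
        unfolding d_def using b(2) cX bc by (auto intro!: mult_closed rng_mult composableI)
      have d_dom: "d \<in> bisection_dom B" using d b(1) by (auto simp: bisection_dom_def)
      obtain b' where b': "b' \<in> B" "rng G b' = rng G d" "bisection_map B d = gmult G (ginv G b') d"
        by (rule bisection_mapE[OF B(1) d_dom])
      have "b' = b" by (rule inj_onD[OF B(5) _ b'(1) b(1)]) (simp only: b'(2) d(2))
      then have "bisection_map B d = c"
        using b' inv_mult_cancel[OF b(2) cX bc] by (simp add: d_def)
      then have dP: "d \<in> bisection_prod B C" using d_dom c(1) by (simp add: bisection_prod_def)
      have "gmult G (ginv G d) x = gmult G (gmult G (ginv G c) (ginv G b)) x"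
        unfolding d_def using inv_of_mult[OF b(2) cX bc] by simp
      also have "\<dots> = gmult G (ginv G c) (gmult G (ginv G b) x)"
        using b(2,3) cX bc assms(3)
        by (intro mult_assoc composableI) (auto simp: inv_closed src_inv rng_inv)
      also have "\<dots> = gmult G (ginv G c) y" using b(4) by (simp add: y_def)
      finally have eq: "gmult G (ginv G d) x = gmult G (ginv G c) y" .
      show ?thesis
        unfolding lhs bisection_action_in[OF C c(1) yX c(2)]
          bisection_action_in[OF P' dP assms(3) trans[OF d(2) b(3)]] eq ..
    next
      case False
      have "rng G d \<noteq> rng G x" if d: "d \<in> bisection_prod B C" for d
      proof
        assume eq: "rng G d = rng G x"
        have dd: "d \<in> bisection_dom B" "bisection_map B d \<in> C" using d by (auto simp: bisection_prod_def)
        obtain b' where b': "b' \<in> B" "rng G b' = rng G d" "rng G (bisection_map B d) = src G b'"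
          by (rule bisection_mapE[OF B(1) dd(1)])
        have "b' = b" by (rule inj_onD[OF B(5) _ b'(1) b(1)]) (simp only: b'(2) b(3) eq)
        then show False using False dd(2) b'(3) b(6) by (auto simp: y_def)
      qed
      moreover have "\<And>c. c \<in> C \<Longrightarrow> rng G c \<noteq> rng G y" using False by blast
      ultimately show ?thesis
        unfolding lhs using bisection_action_notin[OF yX, of C] bisection_action_notin[OF assms(3)] by simp
    qed
  qed
qed

lemma bisection_op_mult:
  assumes "B \<in> regular_bisections" "C \<in> regular_bisections"
  shows "op_mult \<nu> (bisection_op G \<mu> B) (bisection_op G \<mu> C) = bisection_op G \<mu> (bisection_prod B C)"
proof -
  have "bisection_op G \<mu> B (bisection_op G \<mu> C Y)
      = l2_class \<nu> (bisection_action G (bisection_prod B C) (l2_rep Y))" if "Y \<in> L2 \<nu>" for Y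
  proof -
    have Y: "l2_rep Y \<in> square_integrable \<nu>"
      using that by (elim L2E) (simp add: l2_rep_class)
    have "bisection_op G \<mu> C Y = l2_class \<nu> (bisection_action G C (l2_rep Y))"
      using that by (simp add: bisection_op_def)
    then have "bisection_op G \<mu> B (bisection_op G \<mu> C Y)
        = l2_class \<nu> (bisection_action G B (bisection_action G C (l2_rep Y)))"
      using bisection_op_class[OF assms(1) bisection_action_contraction(1)[OF assms(2) Y]] by simp
    also have "\<dots> = l2_class \<nu> (bisection_action G (bisection_prod B C) (l2_rep Y))"
      using regular_bisectionsD(1)[OF assms(2)]
      by (intro l2_class_cong AE_I2) (simp add: bisection_action_prod[OF assms(1)])
    finally show ?thesis .
  qed
  then show ?thesis
    unfolding op_mult_def bisection_op_def[of G \<mu> "bisection_prod B C"] by (intro restrict_ext)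
qed

lemma I_groupoid_mult:
  assumes "s \<in> I_groupoid G \<mu>" "t \<in> I_groupoid G \<mu>"
  shows "op_mult \<nu> s t \<in> I_groupoid G \<mu>"
proof -
  obtain B where B: "B \<in> regular_bisections" "s = bisection_op G \<mu> B" by (rule I_groupoidE[OF assms(1)])
  obtain C where C: "C \<in> regular_bisections" "t = bisection_op G \<mu> C" by (rule I_groupoidE[OF assms(2)])
  show ?thesis
    unfolding B(2) C(2) bisection_op_mult[OF B(1) C(1)]
    by (intro bisection_op_I bisection_prod_bisection B(1) regular_bisectionsD(1)[OF C(1)])
qed

lemma I_groupoid_adjoint:
  assumes "s \<in> I_groupoid G \<mu>"
  shows "op_adjoint \<nu> s \<in> I_groupoid G \<mu>"
proof -
  obtain B where B: "B \<in> regular_bisections" "s = bisection_op G \<mu> B" by (rule I_groupoidE[OF assms(1)])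
  show ?thesis
    unfolding B(2) bisection_op_adjoint[OF B(1)]
    by (intro bisection_op_I inverse_bisection regular_bisectionsD(1)[OF B(1)])
qed

lemma op_prod_single:
  assumes "s \<in> I_groupoid G \<mu>" shows "op_prod \<nu> [s] = s"
proof -
  obtain B where B: "B \<in> regular_bisections" "s = bisection_op G \<mu> B" by (rule I_groupoidE[OF assms(1)])
  have "op_prod \<nu> [s] = restrict s (L2 \<nu>)"
    unfolding op_prod_def op_mult_def by (auto intro!: restrict_ext)
  also have "\<dots> = s" unfolding B(2) bisection_op_def by simp
  finally show ?thesis .
qed

text \<open>With \<open>I_groupoid_adjoint\<close> this places the words in \<open>F \<union> F\<^sup>*\<close> in the span on which approximations are
  defined.\<close>

lemma I_groupoid_prod:
  assumes "ss \<noteq> []" "set ss \<subseteq> I_groupoid G \<mu>"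
  shows "op_prod \<nu> ss \<in> I_groupoid G \<mu>"
  using assms
proof (induction ss rule: list_nonempty_induct)
  case (single s)
  then show ?case using op_prod_single by simp
next
  case (cons s ss)
  have "op_prod \<nu> (s # ss) = op_mult \<nu> s (op_prod \<nu> ss)" by (simp add: op_prod_def)
  then show ?case using cons I_groupoid_mult by simp
qed

end

section \<open>Traces of bisections and disjoint bisections with large sources\<close>

context pmp_groupoid
begin

lemma emeasure_nu_section:
  assumes "f = src G \<or> f = rng G" "S \<in> sets (arrows G)" "inj_on f S" "f ` S \<in> sets \<mu>"
  shows "emeasure \<nu> S = emeasure \<mu> (f ` S)"
proof -
  have "emeasure \<nu> S = (\<integral>\<^sup>+ u. cardinality {x \<in> S. f x = u} \<partial>\<mu>)"
    using assms(1) emeasure_nu[OF assms(2)] emeasure_nu_rng[OF assms(2)] by (elim disjE) simp_all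
  also have "\<dots> = (\<integral>\<^sup>+ u. indicator (f ` S) u \<partial>\<mu>)"
    by (simp only: cardinality_fibre_section[OF assms(3)])
  finally show ?thesis using assms(4) by simp
qed

lemma src_image_units: "A \<subseteq> units G \<Longrightarrow> src G ` A = A"
  using src_unit by (auto simp: subset_iff image_iff)

lemma emeasure_nu_units:
  assumes "A \<in> sets \<mu>" shows "emeasure \<nu> A = emeasure \<mu> A"
proof -
  have A: "A \<in> sets (arrows G)" "A \<subseteq> units G" using assms sets_mu_iff by auto
  have "inj_on (src G) A" using A(2) src_unit by (auto simp: inj_on_def subset_iff)
  then show ?thesis using emeasure_nu_section[of "src G" A] A src_image_units[OF A(2)] assms by simp
qed

lemma indicator_units_square_integrable:
  "(indicator (units G) :: 'g \<Rightarrow> complex) \<in> square_integrable \<nu>"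
proof -
  have "units G \<in> sets \<mu>" using space_mu by (metis sets.top)
  then have "emeasure \<nu> (units G) = 1" using emeasure_nu_units space_mu emeasure_space_1 by metis
  then have "integrable \<nu> (indicator (units G) :: 'g \<Rightarrow> real)"
    using units_borel by (subst integrable_indicator_iff) auto
  moreover have "(cmod (indicator (units G) x))\<^sup>2 = indicator (units G) x" for x
    by (simp add: indicator_def)
  ultimately show ?thesis using units_borel by (simp add: square_integrable_def)
qed

text \<open>On units, the image of the unit vector under the operator of \<open>W\<close> is the indicator function of \<open>W\<close>: an
  arrow \<open>b\<inverse> x\<close> with \<open>b \<in> W\<close> is a unit only if \<open>x = b\<close>.\<close>

lemma vn_trace_bisection:
  assumes W: "W \<in> bisections"
  shows "vn_trace G \<mu> (bisection_op G \<mu> W) = complex_of_real (measure \<nu> (W \<inter> units G))"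
proof -
  obtain W' where W': "W' \<in> regular_bisections" "W' \<subseteq> W" "emeasure \<nu> (W - W') = 0"
    by (rule regular_bisection_conull[OF W])
  note R = regular_bisectionsD[OF W'(1)]
  have Ws: "W \<in> sets (arrows G)" using W by (simp add: bisections_def)
  let ?e = "indicator (units G) :: 'g \<Rightarrow> complex"
  note e = indicator_units_square_integrable
  note Ue = bisection_action_contraction(1)[OF W'(1) e]
  have pt: "bisection_action G W' ?e x * cnj (?e x) = complex_of_real (indicator (W' \<inter> units G) x)"
    if x: "x \<in> space \<nu>" for x
  proof (cases "x \<in> units G \<and> x \<in> bisection_dom W'")
    case True
    obtain b where b: "b \<in> W'" "b \<in> X" "rng G b = rng G x" "bisection_map W' x = gmult G (ginv G b) x"
      "rng G (bisection_map W' x) = src G b" "gmult G b (bisection_map W' x) = x"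
      by (rule bisection_mapE[OF R(1) conjunct2[OF True]])
    have "bisection_map W' x \<in> units G \<longleftrightarrow> x \<in> W'"
    proof
      assume u: "bisection_map W' x \<in> units G"
      then have "bisection_map W' x = src G b" using rng_unit b(5) by metis
      then have "x = b" using b(6) mult_src[OF b(2)] by simp
      then show "x \<in> W'" using b(1) by simp
    next
      assume "x \<in> W'"
      then have "b = x" using b(1,3) R(5) by (auto dest: inj_onD)
      then have "bisection_map W' x = src G x" using b(2,4) inv_mult by simp
      then show "bisection_map W' x \<in> units G" using src_closed b(2) \<open>b = x\<close> by simp
    qed
    then show ?thesis
      using True x by (auto simp: bisection_action_eq[OF R(1)] indicator_def)
  next
    case False
    have "x \<in> W' \<Longrightarrow> x \<in> bisection_dom W'" using x by (auto simp: bisection_dom_def)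
    then show ?thesis using False x by (auto simp: bisection_action_eq[OF R(1)] indicator_def)
  qed
  have "vn_trace G \<mu> (bisection_op G \<mu> W) = vn_trace G \<mu> (bisection_op G \<mu> W')"
    using bisection_op_conull[OF W R(2) W'(2,3)] by simp
  also have "\<dots> = (\<integral>x. bisection_action G W' ?e x * cnj (?e x) \<partial>\<nu>)"
    unfolding vn_trace_def Let_def bisection_op_class[OF W'(1) e] by (rule l2_inner_class[OF Ue e])
  also have "\<dots> = (\<integral>x. complex_of_real (indicator (W' \<inter> units G) x) \<partial>\<nu>)"
    by (rule Bochner_Integration.integral_cong[OF refl pt])
  also have "\<dots> = complex_of_real (\<integral>x. indicator (W' \<inter> units G) x \<partial>\<nu>)"
    by (rule integral_complex_of_real)
  also have "(\<integral>x. indicator (W' \<inter> units G) x \<partial>\<nu>) = measure \<nu> (W' \<inter> units G)"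
    using R(2) units_borel sets.sets_into_space[of "W' \<inter> units G" \<nu>] by (simp add: Int_absorb2)
  also have "measure \<nu> (W' \<inter> units G) = measure \<nu> (W \<inter> units G)"
  proof (rule measure_eq_AE)
    have "AE x in \<nu>. x \<notin> W - W'" using W'(3) Ws R(2) by (intro AE_not_in) auto
    then show "AE x in \<nu>. x \<in> W' \<inter> units G \<longleftrightarrow> x \<in> W \<inter> units G"
      by (rule AE_mp) (use W'(2) in \<open>auto intro!: AE_I2\<close>)
  qed (use R(2) Ws units_borel in auto)
  finally show ?thesis .
qed

text \<open>A product of \<open>t\<inverse>\<close> and \<open>t'\<close> is a unit only if \<open>t = t'\<close>.\<close>

lemma bisection_prod_inverse_units:
  assumes T: "T \<in> regular_bisections" and "T' \<subseteq> X"
  shows "bisection_prod (ginv G ` T) T' \<inter> units G = src G ` (T \<inter> T')"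
proof -
  note R = regular_bisectionsD[OF T] and R' = regular_bisectionsD[OF inverse_regular_bisection[OF T]]
  have map_src: "src G t \<in> bisection_dom (ginv G ` T) \<and> bisection_map (ginv G ` T) (src G t) = t"
    if t: "t \<in> T" for t
  proof
    have tX: "t \<in> X" using t R(3) by blast
    have u: "src G t \<in> units G" using src_closed tX by blast
    show dom: "src G t \<in> bisection_dom (ginv G ` T)"
      unfolding bisection_dom_def rng_inverse_bisection[OF R(3)]
      using t u rng_unit unit_arrow by auto
    obtain b where b: "b \<in> ginv G ` T" "rng G b = rng G (src G t)"
        "bisection_map (ginv G ` T) (src G t) = gmult G (ginv G b) (src G t)"
      by (rule bisection_mapE[OF R'(1) dom])
    have "rng G b = rng G (ginv G t)" using b(2) rng_unit[OF u] rng_inv[OF tX] by simp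
    then have "b = ginv G t" by (rule inj_onD[OF R'(5) _ b(1) imageI[OF t]])
    then show "bisection_map (ginv G ` T) (src G t) = t"
      using b(3) inv_inv[OF tX] mult_src[OF tX] by simp
  qed
  show ?thesis
  proof (intro equalityI subsetI)
    fix x assume x: "x \<in> bisection_prod (ginv G ` T) T' \<inter> units G"
    then have dom: "x \<in> bisection_dom (ginv G ` T)" by (simp add: bisection_prod_def)
    then obtain t where t: "t \<in> T" "rng G x = src G t"
      unfolding bisection_dom_def rng_inverse_bisection[OF R(3)] by blast
    then have "x = src G t" using x rng_unit by simp
    then show "x \<in> src G ` (T \<inter> T')" using x map_src[OF t(1)] t(1) by (auto simp: bisection_prod_def)
  next
    fix x assume "x \<in> src G ` (T \<inter> T')"
    then obtain t where t: "t \<in> T" "t \<in> T'" "x = src G t" by blast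
    moreover have "x \<in> units G" using t R(3) src_closed by auto
    ultimately show "x \<in> bisection_prod (ginv G ` T) T' \<inter> units G"
      using map_src[OF t(1)] by (auto simp: bisection_prod_def)
  qed
qed

lemma vn_trace_inverse_mult:
  assumes T: "T \<in> regular_bisections" and T': "T' \<in> regular_bisections"
  shows "vn_trace G \<mu> (op_mult \<nu> (bisection_op G \<mu> (ginv G ` T)) (bisection_op G \<mu> T'))
    = complex_of_real (measure \<nu> (T \<inter> T'))"
proof -
  note R = regular_bisectionsD[OF T] and R' = regular_bisectionsD[OF T']
  have inv: "ginv G ` T \<in> regular_bisections" by (rule inverse_regular_bisection[OF T])
  have S: "T \<inter> T' \<in> regular_bisections"
    using regular_bisection_subset[OF T, of "T \<inter> T'"] R(2) R'(2) by auto
  note RS = regular_bisectionsD[OF S]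
  have "emeasure \<nu> (src G ` (T \<inter> T')) = emeasure \<nu> (T \<inter> T')"
    using emeasure_nu_units[OF RS(6)] emeasure_nu_section[of "src G", OF _ RS(2,4,6)] by simp
  then have "measure \<nu> (src G ` (T \<inter> T')) = measure \<nu> (T \<inter> T')" by (simp add: measure_def)
  then show ?thesis
    unfolding bisection_op_mult[OF inv T'] vn_trace_bisection[OF bisection_prod_bisection[OF inv R'(1)]]
      bisection_prod_inverse_units[OF T R'(3)] by simp
qed

lemma bisection_op_mult_disjoint:
  assumes T: "T \<in> regular_bisections" and T': "T' \<in> regular_bisections"
    and disj: "src G ` T \<inter> src G ` T' = {}"
  shows "op_mult \<nu> (bisection_op G \<mu> T) (bisection_op G \<mu> (ginv G ` T')) = bisection_op G \<mu> {}"
proof -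
  note R = regular_bisectionsD[OF T] and R' = regular_bisectionsD[OF T']
  have inv: "ginv G ` T' \<in> regular_bisections" by (rule inverse_regular_bisection[OF T'])
  have "bisection_prod T (ginv G ` T') = {}"
  proof (rule equals0I)
    fix x assume "x \<in> bisection_prod T (ginv G ` T')"
    then have x: "x \<in> bisection_dom T" "bisection_map T x \<in> ginv G ` T'" by (auto simp: bisection_prod_def)
    obtain b where b: "b \<in> T" "rng G (bisection_map T x) = src G b"
      by (rule bisection_mapE[OF R(1) x(1)])
    have "rng G (bisection_map T x) \<in> src G ` T'"
      using x(2) rng_inverse_bisection[OF R'(3)] by (metis imageI)
    then show False using b disj by auto
  qed
  then show ?thesis using bisection_op_mult[OF T inv] by simp
qed

lemma op_scale_empty_bisection: "op_scale \<nu> 0 (bisection_op G \<mu> {}) = bisection_op G \<mu> {}"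
proof -
  have "bisection_op G \<mu> {} = (\<lambda>Y\<in>L2 \<nu>. l2_class \<nu> (\<lambda>_. 0))"
    unfolding bisection_op_def by (intro restrict_ext arg_cong2[where f = l2_class] refl)
      (auto simp: bisection_action_def)
  then show ?thesis unfolding op_scale_def by (auto intro!: restrict_ext simp: l2_scale_def)
qed

text \<open>Greedy sections \<open>S l\<close> of the source map are defined almost everywhere, since a fibre missed by one of
  them would be finite. Greedy sections \<open>T l k\<close> of the range map inside \<open>S l\<close> are bisections. Counting
  along the range map, which is allowed by invariance, their measures add up to the measure 1 of \<open>S l\<close>.\<close>

lemma disjoint_bisections_exist:
  assumes inf: "infinite_classes G \<mu>" and "\<eta> > (0 :: real)"
  obtains K :: nat and T :: "nat \<Rightarrow> nat \<Rightarrow> 'g set" where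
    "\<And>l k. T l k \<in> regular_bisections"
    "\<And>l k l' k'. (l, k) \<noteq> (l', k') \<Longrightarrow> T l k \<inter> T l' k' = {}"
    "\<And>l k k'. k \<noteq> k' \<Longrightarrow> src G ` T l k \<inter> src G ` T l k' = {}"
    "\<And>l. l < L \<Longrightarrow> (\<Sum>k<K. measure \<nu> (T l k)) \<ge> 1 - \<eta>"
proof -
  obtain S :: "nat \<Rightarrow> 'g set" where S: "\<And>i. borel_section (arrows G) \<mu> (src G) (S i)"
    "\<And>i. S i \<subseteq> X" "disjoint_family S"
    "AE u in \<mu>. \<forall>n. u \<notin> src G ` S n \<longrightarrow> {x \<in> X. src G x = u} \<subseteq> (\<Union>i<n. S i)"
    by (rule greedy_borel_sections[OF standard_borel finite_measure_axioms src_measurable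
      graph_measurable[OF src_measurable] sets.top]) blast
  have inj_src: "inj_on (src G) (S l)" and S_sets: "S l \<in> sets (arrows G)"
    and src_S: "src G ` S l \<in> sets \<mu>" for l
    using S(1) by (auto simp: borel_section_def)
  have full: "AE u in \<mu>. u \<in> src G ` S l" for l
    using S(4) inf[unfolded infinite_classes_def]
  proof eventually_elim
    fix u assume cover: "\<forall>n. u \<notin> src G ` S n \<longrightarrow> {x \<in> X. src G x = u} \<subseteq> (\<Union>i<n. S i)"
      and inf: "infinite (src_fibre G u)"
    show "u \<in> src G ` S l"
    proof (rule ccontr)
      assume "u \<notin> src G ` S l"
      then have "src_fibre G u \<subseteq> (\<Union>i<l. src G -` {u} \<inter> S i)"
        using cover by (auto simp: src_fibre_def)
      moreover have "finite (src G -` {u} \<inter> S i)" for i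
        by (rule finite_vimage_IntI) (auto intro: inj_src)
      ultimately show False using inf by (meson finite_UN_I finite_lessThan finite_subset)
    qed
  qed
  have nu_S: "emeasure \<nu> (S l) = 1" for l
  proof -
    have "emeasure \<nu> (S l) = emeasure \<mu> (src G ` S l)"
      by (rule emeasure_nu_section[OF _ S_sets inj_src src_S]) simp
    also have "\<dots> = 1" using full[of l] src_S by (intro emeasure_eq_1_AE)
    finally show ?thesis .
  qed
  have "\<forall>l. \<exists>T. (\<forall>k :: nat. borel_section (arrows G) \<mu> (rng G) (T k)) \<and> (\<forall>k. T k \<subseteq> S l) \<and>
      disjoint_family T \<and> (AE u in \<mu>. \<forall>n. u \<notin> rng G ` T n \<longrightarrow> {x \<in> S l. rng G x = u} \<subseteq> (\<Union>i<n. T i))"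
  proof
    fix l
    show "\<exists>T. (\<forall>k :: nat. borel_section (arrows G) \<mu> (rng G) (T k)) \<and> (\<forall>k. T k \<subseteq> S l) \<and>
      disjoint_family T \<and> (AE u in \<mu>. \<forall>n. u \<notin> rng G ` T n \<longrightarrow> {x \<in> S l. rng G x = u} \<subseteq> (\<Union>i<n. T i))"
      by (rule greedy_borel_sections[OF standard_borel finite_measure_axioms rng_measurable
        graph_measurable[OF rng_measurable] S_sets[of l]]) blast
  qed
  from choice[OF this] obtain T :: "nat \<Rightarrow> nat \<Rightarrow> 'g set"
    where T_all: "\<forall>l. (\<forall>k. borel_section (arrows G) \<mu> (rng G) (T l k)) \<and> (\<forall>k. T l k \<subseteq> S l) \<and>
      disjoint_family (T l) \<and>
      (AE u in \<mu>. \<forall>n. u \<notin> rng G ` T l n \<longrightarrow> {x \<in> S l. rng G x = u} \<subseteq> (\<Union>i<n. T l i))" ..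
  have T: "\<And>l k. borel_section (arrows G) \<mu> (rng G) (T l k)" "\<And>l k. T l k \<subseteq> S l"
    "\<And>l. disjoint_family (T l)"
    "\<And>l. AE u in \<mu>. \<forall>n. u \<notin> rng G ` T l n \<longrightarrow> {x \<in> S l. rng G x = u} \<subseteq> (\<Union>i<n. T l i)"
    using T_all by blast+
  have T_sets: "T l k \<in> sets (arrows G)" and T_inj: "inj_on (rng G) (T l k)"
    and T_rng: "rng G ` T l k \<in> sets \<mu>" for l k using T(1) by (auto simp: borel_section_def)
  have reg: "T l k \<in> regular_bisections" for l k
    unfolding regular_bisections_def
    using borel_section_subset[OF S(1) T_sets T(2)] T(1) by simp
  have nu_T: "emeasure \<nu> (T l k) = emeasure \<mu> (rng G ` T l k)" for l k
    by (rule emeasure_nu_section[OF _ T_sets T_inj T_rng]) simp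
  have sum_T: "(\<Sum>k. emeasure \<nu> (T l k)) = 1" for l
  proof -
    have "1 = (\<integral>\<^sup>+ u. cardinality {x \<in> S l. rng G x = u} \<partial>\<mu>)"
      using nu_S emeasure_nu_rng[OF S_sets] by metis
    also have "\<dots> = (\<integral>\<^sup>+ u. (\<Sum>k. indicator (rng G ` T l k) u) \<partial>\<mu>)"
    proof (rule nn_integral_cong_AE)
      show "AE u in \<mu>. cardinality {x \<in> S l. rng G x = u} = (\<Sum>k. indicator (rng G ` T l k) u)"
        using T(4)[of l]
      proof eventually_elim
        fix u assume "\<forall>n. u \<notin> rng G ` T l n \<longrightarrow> {x \<in> S l. rng G x = u} \<subseteq> (\<Union>i<n. T l i)"
        then show "cardinality {x \<in> S l. rng G x = u} = (\<Sum>k. indicator (rng G ` T l k) u)"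
          by (intro cardinality_fibre_AE T_inj T(2,3)) blast
      qed
    qed
    also have "\<dots> = (\<Sum>k. \<integral>\<^sup>+ u. indicator (rng G ` T l k) u \<partial>\<mu>)"
      using T_rng by (intro nn_integral_suminf borel_measurable_indicator)
    also have "\<dots> = (\<Sum>k. emeasure \<nu> (T l k))" using T_rng nu_T by simp
    finally show ?thesis by simp
  qed
  have fin: "emeasure \<nu> (T l k) = ennreal (measure \<nu> (T l k))" for l k
  proof -
    have "emeasure \<nu> (T l k) < \<infinity>" unfolding nu_T by (simp add: emeasure_eq_measure)
    then show ?thesis by (intro emeasure_eq_ennreal_measure) auto
  qed
  have "\<forall>\<^sub>F n in sequentially. (\<Sum>k<n. measure \<nu> (T l k)) \<ge> 1 - \<eta>" for l
  proof -
    have "(\<lambda>n. \<Sum>k<n. emeasure \<nu> (T l k)) \<longlonglongrightarrow> (\<Sum>k. emeasure \<nu> (T l k))"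
      by (rule summable_LIMSEQ) simp
    then have "(\<lambda>n. \<Sum>k<n. emeasure \<nu> (T l k)) \<longlonglongrightarrow> 1" by (simp only: sum_T)
    moreover have "ennreal (1 - \<eta>) < 1" using \<open>\<eta> > 0\<close> by (simp add: ennreal_less_one_iff)
    ultimately have "\<forall>\<^sub>F n in sequentially. ennreal (1 - \<eta>) < (\<Sum>k<n. emeasure \<nu> (T l k))"
      by (rule order_tendstoD(1))
    then show ?thesis
    proof eventually_elim
      fix n assume "ennreal (1 - \<eta>) < (\<Sum>k<n. emeasure \<nu> (T l k))"
      then have "ennreal (1 - \<eta>) \<le> ennreal (\<Sum>k<n. measure \<nu> (T l k))"
        by (simp add: fin sum_ennreal)
      then show "(\<Sum>k<n. measure \<nu> (T l k)) \<ge> 1 - \<eta>" by (subst (asm) ennreal_le_iff) (auto intro: sum_nonneg)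
    qed
  qed
  then have "\<forall>\<^sub>F n in sequentially. \<forall>l\<in>{..<L}. (\<Sum>k<n. measure \<nu> (T l k)) \<ge> 1 - \<eta>"
    by (intro eventually_ball_finite) auto
  then obtain K where K: "\<And>l. l < L \<Longrightarrow> (\<Sum>k<K. measure \<nu> (T l k)) \<ge> 1 - \<eta>"
    unfolding eventually_sequentially by auto
  have disj: "T l k \<inter> T l k' = {}" if "k \<noteq> k'" for l k k'
    using T(3)[of l] that by (auto simp: disjoint_family_on_def)
  show thesis
  proof (rule that[OF reg])
    show "T l k \<inter> T l' k' = {}" if "(l, k) \<noteq> (l', k')" for l k l' k'
    proof (cases "l = l'")
      case True
      then show ?thesis using that disj by simp
    next
      case False
      then have "S l \<inter> S l' = {}" using S(3) by (auto simp: disjoint_family_on_def)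
      then show ?thesis using T(2) by blast
    qed
    show "src G ` T l k \<inter> src G ` T l k' = {}" if "k \<noteq> k'" for l k k'
      using disj[OF that, of l] inj_on_image_Int[OF inj_src T(2) T(2), of l k k'] by simp
  qed (rule K)
qed

end

section \<open>Matrices\<close>

lemma mat_mult_entry:
  fixes A B :: "complex mat"
  assumes "A \<in> carrier_mat d d" "B \<in> carrier_mat d d" "i < d" "j < d"
  shows "(A * B) $$ (i, j) = (\<Sum>k<d. A $$ (i, k) * B $$ (k, j))"
  using assms by (auto simp: scalar_prod_def lessThan_atLeast0 intro!: sum.cong)

lemma mat_adjoint_entry:
  fixes A :: "complex mat"
  assumes "A \<in> carrier_mat d d" "i < d" "j < d"
  shows "mat_adjoint A $$ (i, j) = cnj (A $$ (j, i))"
  using assms unfolding mat_adjoint_def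
  by (auto simp: mat_of_rows_index conjugate_complex_def)

lemma mat_adjoint_carrier: "A \<in> carrier_mat d d \<Longrightarrow> mat_adjoint A \<in> carrier_mat d d"
  unfolding mat_adjoint_def by (auto intro!: carrier_matI)

lemma ntrace_carrier: "A \<in> carrier_mat d d \<Longrightarrow> ntrace A = (\<Sum>i<d. A $$ (i, i)) / of_nat d"
  by (simp add: ntrace_def)

lemma mat_norm2_eq:
  assumes A: "A \<in> carrier_mat d d"
  shows "mat_norm2 A = sqrt ((\<Sum>i<d. \<Sum>j<d. (cmod (A $$ (i, j)))\<^sup>2) / real d)"
proof -
  have A': "mat_adjoint A \<in> carrier_mat d d" by (rule mat_adjoint_carrier[OF A])
  have "(\<Sum>j<d. (mat_adjoint A * A) $$ (j, j)) = (\<Sum>j<d. \<Sum>i<d. complex_of_real ((cmod (A $$ (i, j)))\<^sup>2))"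
    by (intro sum.cong refl)
      (simp add: mat_mult_entry[OF A' A] mat_adjoint_entry[OF A] complex_norm_square mult.commute
        del: of_real_power)
  also have "\<dots> = complex_of_real (\<Sum>j<d. \<Sum>i<d. (cmod (A $$ (i, j)))\<^sup>2)"
    by (simp only: of_real_sum)
  also have "(\<Sum>j<d. \<Sum>i<d. (cmod (A $$ (i, j)))\<^sup>2) = (\<Sum>i<d. \<Sum>j<d. (cmod (A $$ (i, j)))\<^sup>2)"
    by (rule sum.swap)
  finally have "ntrace (mat_adjoint A * A)
      = complex_of_real ((\<Sum>i<d. \<Sum>j<d. (cmod (A $$ (i, j)))\<^sup>2) / real d)"
    using ntrace_carrier[of "mat_adjoint A * A" d] A A' by simp
  then show ?thesis unfolding mat_norm2_def by (simp only: Re_complex_of_real)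
qed

subsection \<open>Partial permutation matrices\<close>

lemma partial_permutation_matsD:
  assumes "A \<in> partial_permutation_mats d"
  shows "A \<in> carrier_mat d d" "i < d \<Longrightarrow> j < d \<Longrightarrow> A $$ (i, j) = 0 \<or> A $$ (i, j) = 1"
  using assms by (auto simp: partial_permutation_mats_def)

lemma partial_permutation_entry_01:
  assumes "A \<in> partial_permutation_mats d"
  obtains a :: "nat \<Rightarrow> nat \<Rightarrow> nat" where "\<And>i j. i < d \<Longrightarrow> j < d \<Longrightarrow> A $$ (i, j) = of_nat (a i j)"
    "\<And>i j. a i j \<le> 1"
proof (rule that[of "\<lambda>i j. if A $$ (i, j) = 1 then 1 else 0"])
  show "A $$ (i, j) = of_nat (if A $$ (i, j) = 1 then 1 else 0)" if "i < d" "j < d" for i j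
    using partial_permutation_matsD(2)[OF assms that] by auto
qed auto

text \<open>Two nonzero entries in a row or column of \<open>A\<close> would make an entry of \<open>A A\<^sup>* A\<close> at least 2.\<close>

lemma partial_permutation_unique:
  assumes A: "A \<in> partial_permutation_mats d" and "i < d" "j < d" "k < d"
  shows "A $$ (i, j) \<noteq> 0 \<Longrightarrow> A $$ (i, k) \<noteq> 0 \<Longrightarrow> j = k"
    and "A $$ (j, i) \<noteq> 0 \<Longrightarrow> A $$ (k, i) \<noteq> 0 \<Longrightarrow> j = k"
proof -
  note C = partial_permutation_matsD(1)[OF A] and C' = mat_adjoint_carrier[OF partial_permutation_matsD(1)[OF A]]
  obtain a :: "nat \<Rightarrow> nat \<Rightarrow> nat" where a: "\<And>i j. i < d \<Longrightarrow> j < d \<Longrightarrow> A $$ (i, j) = of_nat (a i j)"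
    "\<And>i j. a i j \<le> 1" by (rule partial_permutation_entry_01[OF A]) blast
  have entry: "a p q = (\<Sum>l<d. \<Sum>m<d. a p m * a l m * a l q)" if "p < d" "q < d" for p q
  proof -
    have "A $$ (p, q) = (A * mat_adjoint A * A) $$ (p, q)"
      using A by (simp add: partial_permutation_mats_def)
    also have "\<dots> = (\<Sum>l<d. (A * mat_adjoint A) $$ (p, l) * A $$ (l, q))"
      using C C' that by (intro mat_mult_entry) auto
    also have "\<dots> = (\<Sum>l<d. (\<Sum>m<d. A $$ (p, m) * mat_adjoint A $$ (m, l)) * A $$ (l, q))"
      using that(1) by (intro sum.cong refl arg_cong2[where f = "(*)"] mat_mult_entry C C') auto
    also have "\<dots> = (\<Sum>l<d. \<Sum>m<d. of_nat (a p m * a l m * a l q))"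
      using that by (intro sum.cong refl)
        (auto simp: sum_distrib_right mat_adjoint_entry[OF C] a(1) intro!: sum.cong)
    finally have "(of_nat (a p q) :: complex) = of_nat (\<Sum>l<d. \<Sum>m<d. a p m * a l m * a l q)"
      using a(1)[OF that] by simp
    then show ?thesis by (simp only: of_nat_eq_iff)
  qed
  have two: "x \<noteq> y \<Longrightarrow> x \<in> S \<Longrightarrow> y \<in> S \<Longrightarrow> f x + f y \<le> sum f S" if "finite S" for f :: "nat \<Rightarrow> nat" and S x y
    using sum_mono2[of S "{x, y}" f] that by simp
  have one: "x \<in> S \<Longrightarrow> f x \<le> sum f S" if "finite S" for f :: "nat \<Rightarrow> nat" and S x
    using member_le_sum[of x S f] that by simp
  show "j = k" if "A $$ (i, j) \<noteq> 0" "A $$ (i, k) \<noteq> 0"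
  proof (rule ccontr)
    assume "j \<noteq> k"
    have 1: "a i j = 1" "a i k = 1"
      using that a(1)[of i j] a(1)[of i k] a(2)[of i j] a(2)[of i k] assms by (auto simp: le_Suc_eq)
    have "a i j * a i j * a i j + a i k * a i k * a i j \<le> (\<Sum>m<d. a i m * a i m * a i j)"
      by (rule two[of _ _ _ "\<lambda>m. a i m * a i m * a i j"]) (use \<open>j \<noteq> k\<close> assms in auto)
    also have "\<dots> \<le> (\<Sum>l<d. \<Sum>m<d. a i m * a l m * a l j)"
      by (rule one[of _ _ "\<lambda>l. \<Sum>m<d. a i m * a l m * a l j"]) (use assms in auto)
    also have "\<dots> = a i j" using entry[of i j] assms by simp
    finally show False using 1 by simp
  qed
  show "j = k" if "A $$ (j, i) \<noteq> 0" "A $$ (k, i) \<noteq> 0"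
  proof (rule ccontr)
    assume "j \<noteq> k"
    have 1: "a j i = 1" "a k i = 1"
      using that a(1)[of j i] a(1)[of k i] a(2)[of j i] a(2)[of k i] assms by (auto simp: le_Suc_eq)
    have "a j i * a j i * a j i + a j i * a k i * a k i
        \<le> (\<Sum>m<d. a j m * a j m * a j i) + (\<Sum>m<d. a j m * a k m * a k i)"
      using one[of "{..<d}" i "\<lambda>m. a j m * a j m * a j i"] one[of "{..<d}" i "\<lambda>m. a j m * a k m * a k i"] assms
      by (intro add_mono) auto
    also have "\<dots> \<le> (\<Sum>l<d. \<Sum>m<d. a j m * a l m * a l i)"
      by (rule two[of _ _ _ "\<lambda>l. \<Sum>m<d. a j m * a l m * a l i"]) (use \<open>j \<noteq> k\<close> assms in auto)
    also have "\<dots> = a j i" using entry[of j i] assms by simp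
    finally show False using 1 by simp
  qed
qed

lemma partial_permutation_ntrace:
  assumes "P \<in> partial_permutation_mats d"
  shows "ntrace P = complex_of_real (real (card {v. v < d \<and> P $$ (v, v) \<noteq> 0}) / real d)"
proof -
  have "(\<Sum>v<d. P $$ (v, v)) = (\<Sum>v<d. if P $$ (v, v) \<noteq> 0 then 1 else 0)"
    using partial_permutation_matsD(2)[OF assms] by (intro sum.cong) auto
  also have "\<dots> = of_nat (card ({..<d} \<inter> {v. P $$ (v, v) \<noteq> 0}))"
    by (subst sum.If_cases) auto
  also have "{..<d} \<inter> {v. P $$ (v, v) \<noteq> 0} = {v. v < d \<and> P $$ (v, v) \<noteq> 0}" by auto
  finally show ?thesis using ntrace_carrier[OF partial_permutation_matsD(1)[OF assms]] by simp
qed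

lemma cmod_ntrace_partial_permutation_le_1:
  assumes "P \<in> partial_permutation_mats d"
  shows "cmod (ntrace P) \<le> 1"
proof -
  have "card {v. v < d \<and> P $$ (v, v) \<noteq> 0} \<le> card {..<d}" by (intro card_mono) auto
  then show ?thesis
    unfolding partial_permutation_ntrace[OF assms] norm_of_real by (simp add: divide_le_eq)
qed

lemma partial_permutation_mult_entry:
  assumes "A \<in> partial_permutation_mats d" "B \<in> partial_permutation_mats d" "u < d" "v < d"
  shows "\<exists>n :: nat. (B * A) $$ (u, v) = of_nat n"
    and "(B * A) $$ (u, v) \<noteq> 0 \<longleftrightarrow> (\<exists>w<d. B $$ (u, w) \<noteq> 0 \<and> A $$ (w, v) \<noteq> 0)"
proof -
  obtain a :: "nat \<Rightarrow> nat \<Rightarrow> nat" where a: "\<And>i j. i < d \<Longrightarrow> j < d \<Longrightarrow> A $$ (i, j) = of_nat (a i j)"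
    by (rule partial_permutation_entry_01[OF assms(1)]) blast
  obtain b :: "nat \<Rightarrow> nat \<Rightarrow> nat" where b: "\<And>i j. i < d \<Longrightarrow> j < d \<Longrightarrow> B $$ (i, j) = of_nat (b i j)"
    by (rule partial_permutation_entry_01[OF assms(2)]) blast
  have eq: "(B * A) $$ (u, v) = of_nat (\<Sum>w<d. b u w * a w v)"
    using assms partial_permutation_matsD(1) by (subst mat_mult_entry) (auto simp: a b)
  then show "\<exists>n :: nat. (B * A) $$ (u, v) = of_nat n" ..
  show "(B * A) $$ (u, v) \<noteq> 0 \<longleftrightarrow> (\<exists>w<d. B $$ (u, w) \<noteq> 0 \<and> A $$ (w, v) \<noteq> 0)"
    unfolding eq of_nat_eq_0_iff using assms(3,4) a b by (auto simp: sum_eq_0_iff)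
qed

text \<open>Entries of products of partial permutation matrices are natural numbers, so that two such
  matrices which are close in the 2-norm have few different entries.\<close>

lemma card_differing_entries:
  assumes "P \<in> partial_permutation_mats d" "A \<in> partial_permutation_mats d" "B \<in> partial_permutation_mats d"
    and "mat_norm2 (P - B * A) < \<delta>"
  shows "real (card {(u, v). u < d \<and> v < d \<and> P $$ (u, v) \<noteq> (B * A) $$ (u, v)}) \<le> real d * \<delta>\<^sup>2"
    (is "real (card ?S) \<le> _")
proof (cases "d = 0")
  case False
  note C = partial_permutation_matsD(1)[OF assms(1)] partial_permutation_matsD(1)[OF assms(2)]
    partial_permutation_matsD(1)[OF assms(3)]
  let ?D = "P - B * A"
  have D: "?D \<in> carrier_mat d d" by (rule minus_carrier_mat[OF mult_carrier_mat[OF C(3,2)]])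
  have fin: "finite ?S" by (rule finite_subset[of _ "{..<d} \<times> {..<d}"]) auto
  have ge1: "1 \<le> (cmod (?D $$ (u, v)))\<^sup>2" if "(u, v) \<in> ?S" for u v
  proof -
    have uv: "u < d" "v < d" "P $$ (u, v) \<noteq> (B * A) $$ (u, v)" using that by auto
    obtain p :: nat where p: "P $$ (u, v) = of_nat p"
      using partial_permutation_matsD(2)[OF assms(1) uv(1,2)] by (metis of_nat_0 of_nat_1)
    obtain q :: nat where q: "(B * A) $$ (u, v) = of_nat q"
      using partial_permutation_mult_entry(1)[OF assms(2,3) uv(1,2)] by blast
    have "?D $$ (u, v) = of_int (int p - int q)" using uv C p q by simp
    then have "cmod (?D $$ (u, v)) = \<bar>of_int (int p - int q)\<bar>" by (simp only: norm_of_int)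
    moreover have "p \<noteq> q" using p q uv(3) by auto
    then have "(1 :: real) \<le> \<bar>of_int (int p - int q)\<bar>" by linarith
    ultimately show ?thesis by (simp only: one_le_power)
  qed
  have "real (card ?S) = (\<Sum>(u, v)\<in>?S. 1)" by (simp add: split_def)
  also have "\<dots> \<le> (\<Sum>(u, v)\<in>?S. (cmod (?D $$ (u, v)))\<^sup>2)"
    by (rule sum_mono) (use ge1 in auto)
  also have "\<dots> \<le> (\<Sum>(u, v)\<in>{..<d} \<times> {..<d}. (cmod (?D $$ (u, v)))\<^sup>2)"
    by (rule sum_mono2) auto
  also have "\<dots> = (\<Sum>u<d. \<Sum>v<d. (cmod (?D $$ (u, v)))\<^sup>2)" by (rule sum.cartesian_product[symmetric])
  also have "\<dots> = real d * (mat_norm2 ?D)\<^sup>2"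
    unfolding mat_norm2_eq[OF D] using False by (subst real_sqrt_pow2) (auto intro!: divide_nonneg_nonneg sum_nonneg)
  also have "\<dots> \<le> real d * \<delta>\<^sup>2"
    using assms(4) mat_norm2_eq[OF D] by (intro mult_left_mono power_mono) (auto intro!: divide_nonneg_nonneg sum_nonneg)
  finally show ?thesis .
qed simp

subsection \<open>Amplification and conjugation\<close>

text \<open>The direct sum of \<open>q\<close> copies of a \<open>d\<^sub>0 \<times> d\<^sub>0\<close> matrix and a zero block,
  conjugated by the permutation matrix of \<open>\<sigma>\<close>.\<close>

definition block_map :: "nat \<Rightarrow> nat \<Rightarrow> nat \<Rightarrow> (nat \<Rightarrow> nat) \<Rightarrow> complex mat \<Rightarrow> complex mat" where
  "block_map d0 q d \<sigma> A = mat d d (\<lambda>(i, j).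
     if \<sigma> i < q * d0 \<and> \<sigma> j < q * d0 \<and> \<sigma> i div d0 = \<sigma> j div d0
     then A $$ (\<sigma> i mod d0, \<sigma> j mod d0) else 0)"

lemma block_map_carrier [simp]: "block_map d0 q d \<sigma> A \<in> carrier_mat d d"
  by (simp add: block_map_def)

lemma block_map_entry:
  "i < d \<Longrightarrow> j < d \<Longrightarrow> block_map d0 q d \<sigma> A $$ (i, j) =
    (if \<sigma> i < q * d0 \<and> \<sigma> j < q * d0 \<and> \<sigma> i div d0 = \<sigma> j div d0
     then A $$ (\<sigma> i mod d0, \<sigma> j mod d0) else 0)"
  by (simp add: block_map_def)

lemma block_map_conjugate:
  assumes "\<sigma> permutes {..<d}" "i < d" "j < d"
  shows "block_map d0 q d \<sigma> A $$ (i, j) = block_map d0 q d id A $$ (\<sigma> i, \<sigma> j)"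
  using assms permutes_in_image[OF assms(1), of i] permutes_in_image[OF assms(1), of j]
  by (simp add: block_map_entry)

context
  fixes d0 q d :: nat and \<sigma> :: "nat \<Rightarrow> nat"
  assumes d0: "d0 > 0" and qd: "q * d0 \<le> d" and \<sigma>: "\<sigma> permutes {..<d}"
begin

abbreviation \<Theta> where "\<Theta> \<equiv> block_map d0 q d \<sigma>"

lemma block_map_add:
  assumes "A \<in> carrier_mat d0 d0" "B \<in> carrier_mat d0 d0"
  shows "\<Theta> (A + B) = \<Theta> A + \<Theta> B"
  by (rule eq_matI) (use assms d0 in \<open>auto simp: block_map_def\<close>)

lemma block_map_minus:
  assumes "A \<in> carrier_mat d0 d0" "B \<in> carrier_mat d0 d0"
  shows "\<Theta> (A - B) = \<Theta> A - \<Theta> B"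
  by (rule eq_matI) (use assms d0 in \<open>auto simp: block_map_def\<close>)

lemma block_map_smult:
  assumes "A \<in> carrier_mat d0 d0"
  shows "\<Theta> (c \<cdot>\<^sub>m A) = c \<cdot>\<^sub>m \<Theta> A"
  by (rule eq_matI) (use assms d0 in \<open>auto simp: block_map_def\<close>)

lemma block_map_adjoint:
  assumes A: "A \<in> carrier_mat d0 d0"
  shows "\<Theta> (mat_adjoint A) = mat_adjoint (\<Theta> A)"
proof (rule eq_matI)
  note C = mat_adjoint_carrier[OF block_map_carrier, of d0 q d \<sigma> A]
  fix i j assume "i < dim_row (mat_adjoint (\<Theta> A))" "j < dim_col (mat_adjoint (\<Theta> A))"
  then have ij: "i < d" "j < d" using C by auto
  then show "\<Theta> (mat_adjoint A) $$ (i, j) = mat_adjoint (\<Theta> A) $$ (i, j)"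
    using d0 by (auto simp: block_map_entry mat_adjoint_entry[OF block_map_carrier] mat_adjoint_entry[OF A])
qed (use mat_adjoint_carrier[OF block_map_carrier, of d0 q d \<sigma> A] in \<open>auto simp: block_map_def\<close>)

lemma sum_block:
  fixes f :: "nat \<Rightarrow> complex"
  assumes "a < q" "\<And>k. k < d \<Longrightarrow> \<not> (k < q * d0 \<and> k div d0 = a) \<Longrightarrow> f k = 0"
  shows "(\<Sum>k<d. f k) = (\<Sum>c<d0. f (a * d0 + c))"
proof -
  have le: "a * d0 + d0 \<le> q * d0"
    using mult_le_mono1[of "Suc a" q d0] assms(1) by simp
  have "(\<Sum>k<d. f k) = (\<Sum>k\<in>(\<lambda>c. a * d0 + c) ` {..<d0}. f k)"
  proof (rule sum.mono_neutral_right)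
    show "(\<lambda>c. a * d0 + c) ` {..<d0} \<subseteq> {..<d}" using le qd by auto
    show "\<forall>k\<in>{..<d} - (\<lambda>c. a * d0 + c) ` {..<d0}. f k = 0"
    proof
      fix k assume k: "k \<in> {..<d} - (\<lambda>c. a * d0 + c) ` {..<d0}"
      have "k div d0 \<noteq> a"
      proof
        assume "k div d0 = a"
        then have "k = a * d0 + k mod d0" "k mod d0 < d0" using d0 by (auto simp: mult.commute)
        then show False using k by blast
      qed
      then show "f k = 0" using assms(2) k by auto
    qed
  qed simp
  also have "\<dots> = (\<Sum>c<d0. f (a * d0 + c))" by (subst sum.reindex) (auto simp: inj_on_def)
  finally show ?thesis .
qed

lemma block_map_mult:
  assumes A: "A \<in> carrier_mat d0 d0" and B: "B \<in> carrier_mat d0 d0"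
  shows "\<Theta> (A * B) = \<Theta> A * \<Theta> B"
proof (rule eq_matI)
  fix i j assume "i < dim_row (\<Theta> A * \<Theta> B)" "j < dim_col (\<Theta> A * \<Theta> B)"
  then have ij: "i < d" "j < d" by (auto simp: block_map_def)
  define f where "f k = (if \<sigma> i < q * d0 \<and> k < q * d0 \<and> \<sigma> i div d0 = k div d0
        then A $$ (\<sigma> i mod d0, k mod d0) else 0) *
      (if k < q * d0 \<and> \<sigma> j < q * d0 \<and> k div d0 = \<sigma> j div d0
        then B $$ (k mod d0, \<sigma> j mod d0) else 0)" for k
  have "(\<Theta> A * \<Theta> B) $$ (i, j) = (\<Sum>k<d. f (\<sigma> k))"
    using ij by (subst mat_mult_entry[of _ d]) (auto simp: block_map_entry f_def intro!: sum.cong)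
  also have "\<dots> = (\<Sum>k<d. f k)"
    using sum.permute[OF \<sigma>, of f] by (simp add: comp_def)
  also have "\<dots> = \<Theta> (A * B) $$ (i, j)"
  proof (cases "\<sigma> i < q * d0")
    case True
    define a where "a = \<sigma> i div d0"
    have a: "a < q" unfolding a_def using True d0 by (simp add: div_less_iff_less_mult)
    have lt: "a * d0 + c < q * d0" if "c < d0" for c
      using mult_le_mono1[of "Suc a" q d0] a that by simp
    have "(\<Sum>k<d. f k) = (\<Sum>c<d0. f (a * d0 + c))"
      by (rule sum_block[OF a]) (auto simp: f_def a_def)
    also have "\<dots> = (\<Sum>c<d0. if \<sigma> j < q * d0 \<and> a = \<sigma> j div d0
        then A $$ (\<sigma> i mod d0, c) * B $$ (c, \<sigma> j mod d0) else 0)"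
      using True lt d0 by (intro sum.cong) (auto simp: f_def a_def)
    also have "\<dots> = \<Theta> (A * B) $$ (i, j)"
      using True ij d0 by (auto simp: block_map_entry a_def mat_mult_entry[OF A B])
    finally show ?thesis .
  next
    case False
    then show ?thesis using ij by (simp add: f_def block_map_entry)
  qed
  finally show "\<Theta> (A * B) $$ (i, j) = (\<Theta> A * \<Theta> B) $$ (i, j)" by simp
qed (auto simp: block_map_def)

lemma block_map_ntrace:
  assumes A: "A \<in> carrier_mat d0 d0"
  shows "ntrace (\<Theta> A) = of_real (real (q * d0) / real d) * ntrace A"
proof -
  define f where "f k = (if k < q * d0 then A $$ (k mod d0, k mod d0) else 0)" for k
  have "(\<Sum>i<d. \<Theta> A $$ (i, i)) = (\<Sum>i<d. f (\<sigma> i))"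
    by (intro sum.cong) (auto simp: block_map_entry f_def)
  also have "\<dots> = (\<Sum>k<d. f k)"
    using sum.permute[OF \<sigma>, of f] by (simp add: comp_def)
  also have "\<dots> = (\<Sum>k<q * d0. A $$ (k mod d0, k mod d0))"
    using qd by (intro sum.mono_neutral_cong_right) (auto simp: f_def)
  also have "\<dots> = (\<Sum>m<q. \<Sum>k\<in>{m * d0..<m * d0 + d0}. A $$ (k mod d0, k mod d0))"
    by (rule sum.nat_group[symmetric])
  also have "\<dots> = (\<Sum>m<q. \<Sum>c<d0. A $$ (c, c))"
  proof (rule sum.cong[OF refl])
    fix m
    have "(\<Sum>k\<in>{m * d0..<m * d0 + d0}. A $$ (k mod d0, k mod d0))
        = (\<Sum>c\<in>{0..<d0}. A $$ ((c + m * d0) mod d0, (c + m * d0) mod d0))"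
      using sum.shift_bounds_nat_ivl[of "\<lambda>k. A $$ (k mod d0, k mod d0)" 0 "m * d0" d0]
      by (simp add: add.commute)
    also have "\<dots> = (\<Sum>c<d0. A $$ (c, c))" by (simp add: lessThan_atLeast0)
    finally show "(\<Sum>k\<in>{m * d0..<m * d0 + d0}. A $$ (k mod d0, k mod d0)) = (\<Sum>c<d0. A $$ (c, c))" .
  qed
  also have "\<dots> = of_nat q * (\<Sum>c<d0. A $$ (c, c))" by simp
  finally show ?thesis
    using ntrace_carrier[OF A] ntrace_carrier[OF block_map_carrier, of d0 q d \<sigma> A] d0 by simp
qed

lemma block_map_norm:
  assumes A: "A \<in> carrier_mat d0 d0"
  shows "mat_norm2 (\<Theta> A) \<le> mat_norm2 A"
proof -
  have A': "mat_adjoint A \<in> carrier_mat d0 d0" by (rule mat_adjoint_carrier[OF A])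
  have "mat_norm2 (\<Theta> A) = sqrt (Re (of_real (real (q * d0) / real d) * ntrace (mat_adjoint A * A)))"
    unfolding mat_norm2_def block_map_adjoint[OF A, symmetric] block_map_mult[OF A' A, symmetric]
    using A A' by (subst block_map_ntrace) auto
  also have "\<dots> = sqrt (real (q * d0) / real d) * mat_norm2 A"
    unfolding mat_norm2_def by (simp only: Re_complex_of_real complex_scaleR real_sqrt_mult[symmetric]
      times_complex.sel) (simp add: real_sqrt_mult)
  also have "\<dots> \<le> 1 * mat_norm2 A"
  proof (rule mult_right_mono)
    have "real (q * d0) / real d \<le> 1"
      using qd of_nat_mono[OF qd, where 'a = real] by (simp only: divide_le_eq_1) auto
    then show "sqrt (real (q * d0) / real d) \<le> 1" by simp
    show "0 \<le> mat_norm2 A" unfolding mat_norm2_eq[OF A] by (auto intro!: divide_nonneg_nonneg sum_nonneg)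
  qed
  finally show ?thesis by simp
qed

lemma block_map_partial_permutation:
  assumes "A \<in> partial_permutation_mats d0"
  shows "\<Theta> A \<in> partial_permutation_mats d"
proof -
  have A: "A \<in> carrier_mat d0 d0" "A * mat_adjoint A * A = A"
    using assms by (auto simp: partial_permutation_mats_def)
  have A': "mat_adjoint A \<in> carrier_mat d0 d0" by (rule mat_adjoint_carrier[OF A(1)])
  have "\<Theta> A * mat_adjoint (\<Theta> A) * \<Theta> A = \<Theta> (A * mat_adjoint A * A)"
    by (simp only: block_map_mult[OF mult_carrier_mat[OF A(1) A'] A(1)] block_map_mult[OF A(1) A']
      block_map_adjoint[OF A(1)])
  moreover have "\<Theta> A $$ (i, j) \<in> {0, 1}" if "i < d" "j < d" for i j
    using partial_permutation_matsD(2)[OF assms, of "\<sigma> i mod d0" "\<sigma> j mod d0"] that d0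
    by (auto simp: block_map_entry)
  ultimately show ?thesis using A(2) by (simp add: partial_permutation_mats_def)
qed

lemma block_map_list_prod:
  assumes "As \<noteq> []" "set As \<subseteq> carrier_mat d0 d0"
  shows "mat_list_prod d0 As \<in> carrier_mat d0 d0"
    "\<Theta> (mat_list_prod d0 As) = mat_list_prod d (map \<Theta> As)"
proof -
  have car: "mat_list_prod d0 As \<in> carrier_mat d0 d0" if "set As \<subseteq> carrier_mat d0 d0" for As
    using that by (induction As) (auto simp: mat_list_prod_def)
  show "mat_list_prod d0 As \<in> carrier_mat d0 d0" by (rule car[OF assms(2)])
  show "\<Theta> (mat_list_prod d0 As) = mat_list_prod d (map \<Theta> As)"
    using assms
  proof (induction As rule: list_nonempty_induct)
    case (single A)
    then show ?case by (simp add: mat_list_prod_def right_mult_one_mat[OF block_map_carrier])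
  next
    case (cons A As)
    have "mat_list_prod d0 (A # As) = A * mat_list_prod d0 As" by (simp add: mat_list_prod_def)
    also have "\<Theta> \<dots> = \<Theta> A * mat_list_prod d (map \<Theta> As)"
      using cons car[of As] by (subst block_map_mult) auto
    finally show ?case by (simp add: mat_list_prod_def)
  qed
qed

end

section \<open>Counting permutations up to the symmetries of a graph\<close>

text \<open>The number \<open>d\<^sup>d / d!\<close> is a term of the series of \<open>exp d\<close>.\<close>

lemma ln_fact_ge:
  "ln (fact d :: real) \<ge> real d * ln (real d) - real d"
proof (cases "d = 0")
  case False
  have "real d ^ d / fact d \<le> exp (real d)"
  proof -
    have "(\<lambda>n. real d ^ n /\<^sub>R fact n) sums exp (real d)" by (rule exp_converges)
    then have s: "summable (\<lambda>n. real d ^ n /\<^sub>R fact n)" "exp (real d) = (\<Sum>n. real d ^ n /\<^sub>R fact n)"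
      by (auto simp: sums_iff)
    have "sum (\<lambda>n. real d ^ n /\<^sub>R fact n) {d} \<le> (\<Sum>n. real d ^ n /\<^sub>R fact n)"
      by (rule sum_le_suminf[OF s(1)]) auto
    then show ?thesis using s(2) by (simp add: divide_inverse mult.commute)
  qed
  then have "ln (real d ^ d / fact d) \<le> ln (exp (real d))"
    using False by (subst ln_le_cancel_iff) auto
  then show ?thesis using False by (simp add: ln_div ln_realpow)
qed simp

lemma card_le_card_image_mult_fibre:
  assumes "finite A" "\<And>x. x \<in> A \<Longrightarrow> card {y \<in> A. f y = f x} \<le> m"
  shows "card A \<le> card (f ` A) * m"
proof -
  have "card A = card (\<Union>z\<in>f ` A. {y \<in> A. f y = z})"
    by (intro arg_cong[where f = card]) auto
  also have "\<dots> \<le> (\<Sum>z\<in>f ` A. card {y \<in> A. f y = z})"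
    using assms(1) by (intro card_UN_le) auto
  also have "\<dots> \<le> (\<Sum>z\<in>f ` A. m)" using assms(2) by (intro sum_mono) auto
  finally show ?thesis by simp
qed

definition graph_component :: "'v set \<Rightarrow> ('v \<times> 'v) set \<Rightarrow> ('v \<times> 'v) set" where
  "graph_component V R = Restr ((R \<union> R\<inverse>)\<^sup>*) V"

lemma equiv_graph_component: "equiv V (graph_component V R)"
proof (rule equivI)
  show "graph_component V R \<subseteq> V \<times> V" by (auto simp: graph_component_def)
  show "refl_on V (graph_component V R)" by (auto simp: graph_component_def refl_on_def)
  have "sym ((R \<union> R\<inverse>)\<^sup>*)" by (rule sym_rtrancl) (simp add: sym_Un_converse)
  then show "sym (graph_component V R)" by (auto simp: graph_component_def sym_def)
  show "trans (graph_component V R)"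
    by (auto simp: graph_component_def trans_def intro: rtrancl_trans)
qed

text \<open>A map which respects the edges is determined by its values at one point of each component.\<close>

lemma card_edge_determined_maps:
  assumes V: "finite V" "V \<noteq> {}" and R: "R \<subseteq> V \<times> V"
    and P: "\<And>p. p \<in> P \<Longrightarrow> p ` V \<subseteq> V" "\<And>p x. p \<in> P \<Longrightarrow> x \<notin> V \<Longrightarrow> p x = x"
    and det: "\<And>p p' a b. p \<in> P \<Longrightarrow> p' \<in> P \<Longrightarrow> (a, b) \<in> R \<Longrightarrow> p a = p' a \<longleftrightarrow> p b = p' b"
  shows "card P \<le> card V ^ card (V // graph_component V R)"
proof -
  let ?Q = "V // graph_component V R"
  have finQ: "finite ?Q" using V(1) by (rule finite_quotient) (auto simp: graph_component_def)
  define r where "r C = (SOME x. x \<in> C)" for C :: "'a set"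
  have r: "r C \<in> C" if "C \<in> ?Q" for C
    using in_quotient_imp_non_empty[OF equiv_graph_component that] unfolding r_def some_in_eq .
  have sub: "C \<subseteq> V" if "C \<in> ?Q" for C
    using in_quotient_imp_subset[OF equiv_graph_component that] .
  have agree: "p b = p' b" if "p \<in> P" "p' \<in> P" "p a = p' a" "(a, b) \<in> (R \<union> R\<inverse>)\<^sup>*" for p p' a b
    using that(4,3)
  proof induction
    case (step b c)
    then show ?case using det[OF that(1,2), of b c] det[OF that(1,2), of c b] by auto
  qed
  have inj: "inj_on (\<lambda>p. restrict p (r ` ?Q)) P"
  proof (rule inj_onI)
    fix p p' assume p: "p \<in> P" "p' \<in> P" and eq: "restrict p (r ` ?Q) = restrict p' (r ` ?Q)"
    show "p = p'"
    proof
      fix x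
      show "p x = p' x"
      proof (cases "x \<in> V")
        case True
        define C where "C = graph_component V R `` {x}"
        have C: "C \<in> ?Q" unfolding C_def using True by (rule quotientI)
        then have "r C \<in> C" by (rule r)
        then have "(x, r C) \<in> graph_component V R" by (simp add: C_def)
        then have "(r C, x) \<in> graph_component V R"
          using equiv_graph_component[of V R] by (meson equivE symE)
        then have "(r C, x) \<in> (R \<union> R\<inverse>)\<^sup>*" by (simp add: graph_component_def)
        moreover have "p (r C) = p' (r C)" using fun_cong[OF eq, of "r C"] C by simp
        ultimately show ?thesis using agree[OF p] by blast
      next
        case False
        then show ?thesis using P(2)[OF p(1)] P(2)[OF p(2)] by simp
      qed
    qed
  qed
  have "(\<lambda>p. restrict p (r ` ?Q)) ` P \<subseteq> r ` ?Q \<rightarrow>\<^sub>E V"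
    using P(1) r sub by fastforce
  then have "card P \<le> card (r ` ?Q \<rightarrow>\<^sub>E V)"
    using finQ V(1) by (intro card_inj_on_le[OF inj]) (auto intro!: finite_PiE)
  also have "\<dots> = card V ^ card (r ` ?Q)" using finQ by (simp add: card_PiE)
  also have "\<dots> \<le> card V ^ card ?Q"
    using V finQ by (intro power_increasing card_image_le) (auto simp: Suc_le_eq card_gt_0_iff)
  finally show ?thesis .
qed

text \<open>A component that contains a vertex outside of \<open>bad\<close> has at least \<open>L\<close> elements; the other components
  are disjoint nonempty subsets of \<open>bad\<close>.\<close>

lemma card_graph_components:
  assumes V: "finite V" and R: "R \<subseteq> V \<times> V" and bad: "finite bad"
    and deg: "\<And>v. v \<in> V - bad \<Longrightarrow> L \<le> card {w. (v, w) \<in> R}"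
  shows "L * card (V // graph_component V R) \<le> card V + L * card bad"
proof -
  let ?Q = "V // graph_component V R"
  have finQ: "finite ?Q" using V by (rule finite_quotient) (auto simp: graph_component_def)
  have sub: "C \<subseteq> V" if "C \<in> ?Q" for C
    using in_quotient_imp_subset[OF equiv_graph_component that] .
  have disj: "C \<inter> D = {}" if "C \<in> ?Q" "D \<in> ?Q" "C \<noteq> D" for C D
    using quotient_disj[OF equiv_graph_component that(1,2)] that(3) by blast
  define Good where "Good = {C \<in> ?Q. C - bad \<noteq> {}}"
  have large: "L \<le> card C" if "C \<in> Good" for C
  proof -
    obtain v where v: "v \<in> C" "v \<notin> bad" and C: "C \<in> ?Q" using \<open>C \<in> Good\<close> by (auto simp: Good_def)
    have vV: "v \<in> V" using v C sub by blast
    have "{w. (v, w) \<in> R} \<subseteq> C"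
    proof
      fix w assume "w \<in> {w. (v, w) \<in> R}"
      then have "(v, w) \<in> graph_component V R" using R by (auto simp: graph_component_def)
      then show "w \<in> C" using in_quotient_imp_closed[OF equiv_graph_component C v(1)] by blast
    qed
    then have "card {w. (v, w) \<in> R} \<le> card C"
      using finite_subset[OF sub[OF C] V] by (intro card_mono)
    then show ?thesis using deg[of v] v vV by auto
  qed
  have "L * card Good = (\<Sum>C\<in>Good. L)" by simp
  also have "\<dots> \<le> (\<Sum>C\<in>Good. card C)" using large by (rule sum_mono)
  also have "\<dots> = card (\<Union>Good)"
  proof (rule card_Union_disjoint[symmetric])
    show "pairwise disjnt Good" using disj by (auto simp: pairwise_def disjnt_def Good_def)
    show "finite C" if "C \<in> Good" for C using that finite_subset[OF sub V] by (auto simp: Good_def)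
  qed
  also have "\<dots> \<le> card V" using sub V by (intro card_mono) (auto simp: Good_def)
  finally have 1: "L * card Good \<le> card V" .
  have ne: "C \<noteq> {}" if "C \<in> ?Q" for C
    using in_quotient_imp_non_empty[OF equiv_graph_component that] .
  define r where "r C = (SOME x. x \<in> C)" for C :: "'a set"
  have r: "r C \<in> C" if "C \<in> ?Q" for C using ne[OF that] unfolding r_def some_in_eq .
  have "card (?Q - Good) \<le> card bad"
  proof (rule card_inj_on_le[where f = r])
    show "inj_on r (?Q - Good)"
    proof (rule inj_onI)
      fix C D assume CD: "C \<in> ?Q - Good" "D \<in> ?Q - Good" "r C = r D"
      then have "r C \<in> C \<inter> D" using r[of C] r[of D] by auto
      then show "C = D" using disj[of C D] CD by blast
    qed
    show "r ` (?Q - Good) \<subseteq> bad"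
    proof
      fix x assume "x \<in> r ` (?Q - Good)"
      then obtain C where C: "C \<in> ?Q" "C \<notin> Good" "x = r C" by blast
      then have "C \<subseteq> bad" by (auto simp: Good_def)
      then show "x \<in> bad" using r[OF C(1)] C(3) by blast
    qed
  qed (rule bad)
  moreover have "card ?Q = card Good + card (?Q - Good)"
  proof -
    have "Good \<union> (?Q - Good) = ?Q" by (auto simp: Good_def)
    moreover have "finite Good" using finQ by (simp add: Good_def)
    ultimately show ?thesis using card_Un_disjoint[of Good "?Q - Good"] finQ by auto
  qed
  ultimately have "L * card ?Q \<le> L * card Good + L * card bad"
    by (simp add: add_mult_distrib2)
  then show ?thesis using 1 by linarith
qed

lemma card_UN_ge:
  fixes D :: "nat \<Rightarrow> 'v set"
  assumes "\<And>k. k < K \<Longrightarrow> finite (D k)"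
    and "\<And>k k'. k < K \<Longrightarrow> k' < K \<Longrightarrow> k \<noteq> k' \<Longrightarrow> real (card (D k \<inter> D k')) \<le> c"
    and "c \<ge> 0"
  shows "(\<Sum>k<K. real (card (D k))) \<le> real (card (\<Union>k<K. D k)) + real (K\<^sup>2) * c"
  using assms(1,2)
proof (induction K)
  case (Suc K)
  let ?U = "\<Union>k<K. D k"
  have fin: "finite ?U" "finite (D K)" using Suc.prems(1) by auto
  have "real (card (?U \<inter> D K)) \<le> real K * c"
  proof -
    have "card (?U \<inter> D K) = card (\<Union>k<K. D k \<inter> D K)" by (intro arg_cong[where f = card]) auto
    also have "\<dots> \<le> (\<Sum>k<K. card (D k \<inter> D K))" by (rule card_UN_le) simp
    finally have "real (card (?U \<inter> D K)) \<le> (\<Sum>k<K. real (card (D k \<inter> D K)))"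
      by (simp only: of_nat_sum[symmetric] of_nat_le_iff)
    also have "\<dots> \<le> (\<Sum>k<K. c)" using Suc.prems(2) by (intro sum_mono) auto
    finally show ?thesis by simp
  qed
  moreover have "real (card ?U) + real (card (D K)) = real (card (?U \<union> D K)) + real (card (?U \<inter> D K))"
    using card_Un_Int[OF fin] by linarith
  moreover have "?U \<union> D K = (\<Union>k<Suc K. D k)" by (auto simp: less_Suc_eq)
  moreover have "(\<Sum>k<K. real (card (D k))) \<le> real (card ?U) + real (K\<^sup>2) * c"
    using Suc.prems by (intro Suc.IH) auto
  moreover have "real (K\<^sup>2) * c + real K * c \<le> real ((Suc K)\<^sup>2) * c"
  proof -
    have "real ((Suc K)\<^sup>2) * c = real (K\<^sup>2) * c + real K * c + (real K * c + c)"
      by (simp add: power2_eq_square algebra_simps)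
    then show ?thesis using assms(3) by simp
  qed
  ultimately show ?case by simp
qed simp

text \<open>The relations \<open>a l k\<close> play the role of partial injections with quasi-inverses \<open>b l k\<close>.
  For each \<open>l\<close> the numbers \<open>m l k\<close> are the approximate sizes of almost disjoint domains which nearly
  cover the vertices, and different \<open>a l k\<close> seldom have the same value at a vertex. Hence most
  vertices have for each \<open>l\<close> a neighbour, and different neighbours for different \<open>l\<close>.\<close>

lemma card_low_degree_vertices:
  fixes a b :: "nat \<Rightarrow> nat \<Rightarrow> nat \<Rightarrow> nat \<Rightarrow> bool" and m :: "nat \<Rightarrow> nat \<Rightarrow> real"
    and d L K :: nat and \<epsilon> \<eta> :: real
  defines "V \<equiv> {..<d}"
  assumes bfun: "\<And>l k w v v'. b l k w v \<Longrightarrow> b l k w v' \<Longrightarrow> w \<in> V \<Longrightarrow> v \<in> V \<Longrightarrow> v' \<in> V \<Longrightarrow> v = v'"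
    and dom: "\<And>l k. l < L \<Longrightarrow> k < K \<Longrightarrow>
      real (card {v\<in>V. \<exists>w\<in>V. a l k v w \<and> b l k w v}) \<ge> real d * (m l k - \<epsilon>)"
    and distinct: "\<And>l k l' k'. l < L \<Longrightarrow> k < K \<Longrightarrow> l' < L \<Longrightarrow> k' < K \<Longrightarrow> (l, k) \<noteq> (l', k') \<Longrightarrow>
      real (card {v\<in>V. \<exists>w\<in>V. a l' k' v w \<and> b l k w v}) \<le> real d * \<epsilon>"
    and disjoint: "\<And>l k k'. l < L \<Longrightarrow> k < K \<Longrightarrow> k' < K \<Longrightarrow> k \<noteq> k' \<Longrightarrow>
      real (card {(u, w)\<in>V \<times> V. \<exists>v\<in>V. b l k' w v \<and> a l k v u}) \<le> real d * \<epsilon>"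
    and total: "\<And>l. l < L \<Longrightarrow> (\<Sum>k<K. m l k) \<ge> 1 - \<eta>"
    and "\<epsilon> \<ge> 0"
  shows "real (card {v\<in>V. \<not> L \<le> card {w\<in>V. \<exists>l<L. \<exists>k<K. a l k v w}})
    \<le> real d * (real L * (\<eta> + real K * \<epsilon> + real (K\<^sup>2) * \<epsilon>) + real ((L * K)\<^sup>2) * \<epsilon>)"
proof -
  define D where "D l k = {v\<in>V. \<exists>w\<in>V. a l k v w \<and> b l k w v}" for l k
  define F where "F l k l' k' = {v\<in>V. \<exists>w\<in>V. a l' k' v w \<and> b l k w v}" for l k l' k'
  have finV: "finite V" by (simp add: V_def)
  have DV: "D l k \<subseteq> V" and FV: "F l k l' k' \<subseteq> V" for l k l' k' by (auto simp: D_def F_def)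
  \<comment> \<open>A vertex \<open>v\<close> in both domains is determined by its image \<open>w\<close> under \<open>a l k'\<close>, since \<open>b l k'\<close> leads
    back from \<open>w\<close> to \<open>v\<close>. Then \<open>a l k\<close> leads on from \<open>v\<close> to some \<open>u\<close>, and there are few such pairs \<open>(u, w)\<close>.\<close>
  have cardD: "real (card (D l k \<inter> D l k')) \<le> real d * \<epsilon>" if l: "l < L" "k < K" "k' < K" "k \<noteq> k'" for l k k'
  proof -
    let ?S = "{(u, w)\<in>V \<times> V. \<exists>v\<in>V. b l k' w v \<and> a l k v u}"
    have "\<forall>v\<in>D l k \<inter> D l k'. \<exists>uw\<in>V \<times> V. a l k v (fst uw) \<and> b l k' (snd uw) v"
      unfolding D_def by fastforce
    then obtain g where g: "\<forall>v\<in>D l k \<inter> D l k'. g v \<in> V \<times> V \<and> a l k v (fst (g v)) \<and> b l k' (snd (g v)) v"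
      unfolding Bex_def bchoice_iff by blast
    have "inj_on g (D l k \<inter> D l k')"
    proof (rule inj_onI)
      fix v v' assume v: "v \<in> D l k \<inter> D l k'" "v' \<in> D l k \<inter> D l k'" "g v = g v'"
      have "g v \<in> V \<times> V \<and> b l k' (snd (g v)) v" using g v(1) by blast
      moreover have "b l k' (snd (g v')) v'" using g v(2) by blast
      ultimately have "b l k' (snd (g v)) v" "b l k' (snd (g v)) v'" "snd (g v) \<in> V"
        unfolding v(3) by (auto simp: mem_Times_iff)
      then show "v = v'" using bfun v DV by blast
    qed
    moreover have "g ` (D l k \<inter> D l k') \<subseteq> ?S"
    proof
      fix p assume "p \<in> g ` (D l k \<inter> D l k')"
      then obtain v where "v \<in> D l k \<inter> D l k'" "p = g v" by blast
      moreover have "g v \<in> V \<times> V \<and> a l k v (fst (g v)) \<and> b l k' (snd (g v)) v" "v \<in> V"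
        using g \<open>v \<in> D l k \<inter> D l k'\<close> DV by blast+
      ultimately show "p \<in> ?S" by (auto simp: mem_Times_iff split_beta)
    qed
    moreover have "finite ?S" using finV by (auto intro: finite_subset[of _ "V \<times> V"])
    ultimately have "card (D l k \<inter> D l k') \<le> card ?S" by (rule card_inj_on_le)
    also have "real (card ?S) \<le> real d * \<epsilon>" by (rule disjoint[OF l])
    finally show ?thesis by simp
  qed
  define N where "N l = V - (\<Union>k<K. D l k)" for l
  have cardN: "real (card (N l)) \<le> real d * (\<eta> + real K * \<epsilon> + real (K\<^sup>2) * \<epsilon>)" if l: "l < L" for l
  proof -
    have "real d * (1 - \<eta> - real K * \<epsilon>) \<le> real d * (\<Sum>k<K. m l k - \<epsilon>)"
      using total[OF l] by (intro mult_left_mono) (auto simp: sum_subtractf)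
    also have "\<dots> \<le> (\<Sum>k<K. real (card (D l k)))"
      unfolding sum_distrib_left using dom[OF l] by (intro sum_mono) (auto simp: D_def)
    also have "\<dots> \<le> real (card (\<Union>k<K. D l k)) + real (K\<^sup>2) * (real d * \<epsilon>)"
      using cardD[OF l] finite_subset[OF DV finV] \<open>\<epsilon> \<ge> 0\<close> by (intro card_UN_ge) auto
    finally have "real d * (1 - \<eta> - real K * \<epsilon>) - real (K\<^sup>2) * (real d * \<epsilon>) \<le> real (card (\<Union>k<K. D l k))"
      by simp
    moreover have "card (N l) = d - card (\<Union>k<K. D l k)"
      unfolding N_def using DV finite_subset[OF DV finV] by (subst card_Diff_subset) (auto simp: V_def)
    moreover have "card (\<Union>k<K. D l k) \<le> card V" using DV finV by (intro card_mono) auto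
    ultimately show ?thesis by (simp add: V_def of_nat_diff algebra_simps)
  qed
  define J where "J = {..<L} \<times> {..<K}"
  define I where "I = {(j, j') \<in> J \<times> J. j \<noteq> j'}"
  have finJ: "finite J" "card J = L * K" by (simp_all add: J_def)
  have finI: "finite I" by (rule finite_subset[of _ "J \<times> J"]) (auto simp: I_def finJ)
  have cardI: "card I \<le> (L * K)\<^sup>2"
  proof -
    have "card I \<le> card (J \<times> J)" by (intro card_mono) (auto simp: I_def finJ)
    then show ?thesis by (simp add: card_cartesian_product finJ power2_eq_square)
  qed
  define E where "E = (\<Union>(j, j')\<in>I. F (fst j) (snd j) (fst j') (snd j'))"
  have cardE: "real (card E) \<le> real d * (real ((L * K)\<^sup>2) * \<epsilon>)"
  proof -
    have "card E \<le> (\<Sum>(j, j')\<in>I. card (F (fst j) (snd j) (fst j') (snd j')))"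
      unfolding E_def split_def by (rule card_UN_le[OF finI])
    then have "real (card E) \<le> (\<Sum>(j, j')\<in>I. real (card (F (fst j) (snd j) (fst j') (snd j'))))"
      unfolding split_def by (simp only: of_nat_sum[symmetric] of_nat_le_iff)
    also have "\<dots> \<le> (\<Sum>(j, j')\<in>I. real d * \<epsilon>)"
    proof (rule sum_mono, clarify)
      fix l k l' k' assume "((l, k), (l', k')) \<in> I"
      then have "l < L" "k < K" "l' < L" "k' < K" "(l, k) \<noteq> (l', k')" by (auto simp: I_def J_def)
      from distinct[OF this]
      show "real (card (F (fst (l, k)) (snd (l, k)) (fst (l', k')) (snd (l', k')))) \<le> real d * \<epsilon>"
        by (simp add: F_def)
    qed
    also have "\<dots> = real (card I) * (real d * \<epsilon>)" by (simp add: split_def)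
    also have "\<dots> \<le> real ((L * K)\<^sup>2) * (real d * \<epsilon>)"
      using cardI \<open>\<epsilon> \<ge> 0\<close> by (intro mult_right_mono of_nat_mono) auto
    finally show ?thesis by (simp add: algebra_simps)
  qed
  have "{v\<in>V. \<not> L \<le> card {w\<in>V. \<exists>l<L. \<exists>k<K. a l k v w}} \<subseteq> (\<Union>l<L. N l) \<union> E"
  proof (rule subsetI, rule ccontr)
    fix v assume v: "v \<in> {v\<in>V. \<not> L \<le> card {w\<in>V. \<exists>l<L. \<exists>k<K. a l k v w}}"
      and no: "v \<notin> (\<Union>l<L. N l) \<union> E"
    have vV: "v \<in> V" using v by simp
    have "\<forall>l\<in>{..<L}. \<exists>kw. fst kw < K \<and> snd kw \<in> V \<and> a l (fst kw) v (snd kw) \<and> b l (fst kw) (snd kw) v"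
    proof
      fix l assume "l \<in> {..<L}"
      then have "v \<in> (\<Union>k<K. D l k)" using no vV by (auto simp: N_def)
      then obtain k w where "k < K" "w \<in> V" "a l k v w" "b l k w v" by (auto simp: D_def)
      then show "\<exists>kw. fst kw < K \<and> snd kw \<in> V \<and> a l (fst kw) v (snd kw) \<and> b l (fst kw) (snd kw) v"
        by (intro exI[of _ "(k, w)"]) simp
    qed
    then obtain kw where kw: "\<forall>l\<in>{..<L}. fst (kw l) < K \<and> snd (kw l) \<in> V \<and>
        a l (fst (kw l)) v (snd (kw l)) \<and> b l (fst (kw l)) (snd (kw l)) v"
      unfolding bchoice_iff by blast
    have "inj_on (\<lambda>l. snd (kw l)) {..<L}"
    proof (rule inj_onI, rule ccontr)
      fix l l' assume l: "l \<in> {..<L}" "l' \<in> {..<L}" "snd (kw l) = snd (kw l')" "l \<noteq> l'"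
      have "((l, fst (kw l)), (l', fst (kw l'))) \<in> I" using l kw by (auto simp: I_def J_def)
      moreover have "v \<in> F l (fst (kw l)) l' (fst (kw l'))"
      proof -
        have "a l' (fst (kw l')) v (snd (kw l'))" using kw l(2) by blast
        moreover have "b l (fst (kw l)) (snd (kw l)) v" "snd (kw l) \<in> V" using kw l(1) by blast+
        ultimately show ?thesis unfolding F_def using vV l(3) by auto
      qed
      ultimately have "v \<in> E" unfolding E_def by force
      then show False using no by blast
    qed
    then have "card {..<L} \<le> card {w\<in>V. \<exists>l<L. \<exists>k<K. a l k v w}"
      by (rule card_inj_on_le) (use kw finV in auto)
    then show False using v by simp
  qed
  moreover have finU: "finite ((\<Union>l<L. N l) \<union> E)"
    using finV finI finite_subset[OF FV finV] by (auto simp: N_def E_def)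
  ultimately have "card {v\<in>V. \<not> L \<le> card {w\<in>V. \<exists>l<L. \<exists>k<K. a l k v w}} \<le> card ((\<Union>l<L. N l) \<union> E)"
    by (intro card_mono)
  also have "\<dots> \<le> card (\<Union>l<L. N l) + card E" by (rule card_Un_le)
  also have "\<dots> \<le> (\<Sum>l<L. card (N l)) + card E" by (intro add_right_mono card_UN_le) simp
  finally have "real (card {v\<in>V. \<not> L \<le> card {w\<in>V. \<exists>l<L. \<exists>k<K. a l k v w}})
      \<le> (\<Sum>l<L. real (card (N l))) + real (card E)"
    by (simp only: of_nat_sum[symmetric] of_nat_add[symmetric] of_nat_le_iff)
  also have "\<dots> \<le> (\<Sum>l<L. real d * (\<eta> + real K * \<epsilon> + real (K\<^sup>2) * \<epsilon>)) + real d * (real ((L * K)\<^sup>2) * \<epsilon>)"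
    using cardN cardE by (intro add_mono sum_mono) auto
  finally show ?thesis by (simp add: algebra_simps)
qed

section \<open>Sofic approximations\<close>

lemma SA_D:
  fixes G :: "'g groupoid_data"
  assumes "\<phi> \<in> SA G \<mu> F n \<delta> d"
  defines "M \<equiv> arrow_measure G \<mu>"
  defines "\<Omega> \<equiv> F \<union> op_adjoint M ` F"
  shows "\<phi> \<in> linear_maps G \<mu> d"
    "\<And>ss. ss \<noteq> [] \<Longrightarrow> length ss \<le> n \<Longrightarrow> set ss \<subseteq> \<Omega> \<Longrightarrow>
      mat_norm2 (\<phi> (op_prod M ss) - mat_list_prod d (map \<phi> ss)) < \<delta>"
    "\<And>ss. ss \<noteq> [] \<Longrightarrow> length ss \<le> n \<Longrightarrow> set ss \<subseteq> \<Omega> \<Longrightarrow>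
      \<phi> (op_prod M ss) \<in> partial_permutation_mats d"
    "\<And>ss. ss \<noteq> [] \<Longrightarrow> length ss \<le> n \<Longrightarrow> set ss \<subseteq> \<Omega> \<Longrightarrow>
      cmod (ntrace (\<phi> (op_prod M ss)) - vn_trace G \<mu> (op_prod M ss)) < \<delta>"
proof -
  have mem: "op_prod M ss \<in> op_power_le M \<Omega> n" if "ss \<noteq> []" "length ss \<le> n" "set ss \<subseteq> \<Omega>" for ss
    unfolding op_power_le_def op_power_def using that
    by (intro UN_I[of "length ss"]) (auto simp: Suc_le_eq)
  note * = assms(1)[unfolded SA_def Let_def, folded M_def, folded \<Omega>_def]
  show "\<phi> \<in> linear_maps G \<mu> d" using * by simp
  fix ss assume ss: "ss \<noteq> []" "length ss \<le> n" "set ss \<subseteq> \<Omega>"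
  then have "1 \<le> length ss" by (simp add: Suc_le_eq)
  then show "mat_norm2 (\<phi> (op_prod M ss) - mat_list_prod d (map \<phi> ss)) < \<delta>"
    using * ss by blast
  show "\<phi> (op_prod M ss) \<in> partial_permutation_mats d" using * mem[OF ss] by blast
  show "cmod (ntrace (\<phi> (op_prod M ss)) - vn_trace G \<mu> (op_prod M ss)) < \<delta>" using * mem[OF ss] by blast
qed

lemma SA_I:
  fixes G :: "'g groupoid_data" and \<mu> :: "'g measure"
  defines "M \<equiv> arrow_measure G \<mu>"
  assumes "\<phi> \<in> linear_maps G \<mu> d"
    "\<And>ss. ss \<noteq> [] \<Longrightarrow> length ss \<le> n \<Longrightarrow> set ss \<subseteq> F \<union> op_adjoint M ` F \<Longrightarrow>
      mat_norm2 (\<phi> (op_prod M ss) - mat_list_prod d (map \<phi> ss)) < \<delta>"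
    "\<And>ss. ss \<noteq> [] \<Longrightarrow> length ss \<le> n \<Longrightarrow> set ss \<subseteq> F \<union> op_adjoint M ` F \<Longrightarrow>
      \<phi> (op_prod M ss) \<in> partial_permutation_mats d"
    "\<And>ss. ss \<noteq> [] \<Longrightarrow> length ss \<le> n \<Longrightarrow> set ss \<subseteq> F \<union> op_adjoint M ` F \<Longrightarrow>
      cmod (ntrace (\<phi> (op_prod M ss)) - vn_trace G \<mu> (op_prod M ss)) < \<delta>"
  shows "\<phi> \<in> SA G \<mu> F n \<delta> d"
proof -
  have pow: "\<exists>ss. s = op_prod M ss \<and> ss \<noteq> [] \<and> length ss \<le> n \<and> set ss \<subseteq> F \<union> op_adjoint M ` F"
    if s: "s \<in> op_power_le M (F \<union> op_adjoint M ` F) n" for s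
  proof -
    obtain k ss where k: "k \<in> {1..n}" and ss: "s = op_prod M ss" "length ss = k" "set ss \<subseteq> F \<union> op_adjoint M ` F"
      using s unfolding op_power_le_def op_power_def by blast
    then have "ss \<noteq> []" by auto
    then show ?thesis using k ss by (intro exI[of _ ss]) auto
  qed
  have ne: "1 \<le> length ss \<Longrightarrow> ss \<noteq> []" for ss :: "'g l2op list" by auto
  show ?thesis
    unfolding SA_def Let_def M_def[symmetric]
  proof (intro CollectI conjI allI impI ballI image_subsetI; (elim conjE)?)
    show "\<phi> \<in> linear_maps G \<mu> d" by fact
  next
    fix ss assume "1 \<le> length ss" "length ss \<le> n" "set ss \<subseteq> F \<union> op_adjoint M ` F"
    then show "mat_norm2 (\<phi> (op_prod M ss) - mat_list_prod d (map \<phi> ss)) < \<delta>"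
      using assms(3) ne by blast
  next
    fix s assume "s \<in> op_power_le M (F \<union> op_adjoint M ` F) n"
    from pow[OF this] show "\<phi> s \<in> partial_permutation_mats d" using assms(4) by blast
  next
    fix s assume "s \<in> op_power_le M (F \<union> op_adjoint M ` F) n"
    from pow[OF this] show "cmod (ntrace (\<phi> s) - vn_trace G \<mu> s) < \<delta>" using assms(5) by blast
  qed
qed

lemma SA_mono:
  assumes "F \<subseteq> F'" "n \<le> n'" "\<delta>' \<le> \<delta>"
  shows "SA G \<mu> F' n' \<delta>' d \<subseteq> SA G \<mu> F n \<delta> d"
proof
  fix \<phi> assume \<phi>: "\<phi> \<in> SA G \<mu> F' n' \<delta>' d"
  let ?M = "arrow_measure G \<mu>"
  show "\<phi> \<in> SA G \<mu> F n \<delta> d"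
  proof (rule SA_I)
    show "\<phi> \<in> linear_maps G \<mu> d" by (rule SA_D(1)[OF \<phi>])
    fix ss assume ss: "ss \<noteq> []" "length ss \<le> n" "set ss \<subseteq> F \<union> op_adjoint ?M ` F"
    have len: "length ss \<le> n'" using ss(2) assms(2) by simp
    have sub: "set ss \<subseteq> F' \<union> op_adjoint ?M ` F'" using ss(3) assms(1) by blast
    show "mat_norm2 (\<phi> (op_prod ?M ss) - mat_list_prod d (map \<phi> ss)) < \<delta>"
      using SA_D(2)[OF \<phi> ss(1) len sub] assms(3) by simp
    show "\<phi> (op_prod ?M ss) \<in> partial_permutation_mats d" by (rule SA_D(3)[OF \<phi> ss(1) len sub])
    show "cmod (ntrace (\<phi> (op_prod ?M ss)) - vn_trace G \<mu> (op_prod ?M ss)) < \<delta>"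
      using SA_D(4)[OF \<phi> ss(1) len sub] assms(3) by simp
  qed
qed

context pmp_groupoid
begin

abbreviation span_I where "span_I \<equiv> vn_span G \<mu> (I_groupoid G \<mu>)"

lemma I_groupoid_subset_span: "I_groupoid G \<mu> \<subseteq> span_I"
  by (auto simp: vn_span_def)

lemma span_I_add: "a \<in> span_I \<Longrightarrow> b \<in> span_I \<Longrightarrow> op_add \<nu> a b \<in> span_I"
  by (auto simp: vn_span_def op_subspace_def)

lemma span_I_scale: "a \<in> span_I \<Longrightarrow> op_scale \<nu> c a \<in> span_I"
  by (auto simp: vn_span_def op_subspace_def)

lemma linear_mapsD:
  assumes "\<phi> \<in> linear_maps G \<mu> d"
  shows "a \<in> span_I \<Longrightarrow> \<phi> a \<in> carrier_mat d d"
    "a \<in> span_I \<Longrightarrow> b \<in> span_I \<Longrightarrow> \<phi> (op_add \<nu> a b) = \<phi> a + \<phi> b"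
    "a \<in> span_I \<Longrightarrow> \<phi> (op_scale \<nu> c a) = c \<cdot>\<^sub>m \<phi> a"
  using assms unfolding linear_maps_def Let_def by (auto dest: PiE_mem)

lemma adjoint_closed_subset: "F \<subseteq> I_groupoid G \<mu> \<Longrightarrow> F \<union> op_adjoint \<nu> ` F \<subseteq> I_groupoid G \<mu>"
  using I_groupoid_adjoint by auto

text \<open>Amplification followed by conjugation is linear, multiplicative and compatible with adjoints, and does
  not increase the 2-norm. It multiplies traces by \<open>q d\<^sub>0 / d\<close>, which accounts for the loss in the
  precision.\<close>

lemma SA_block_map:
  assumes \<phi>: "\<phi> \<in> SA G \<mu> F n \<delta> d0" and F: "F \<subseteq> I_groupoid G \<mu>"
    and d0: "d0 > 0" and qd: "q * d0 \<le> d" and \<sigma>: "\<sigma> permutes {..<d}" and d: "d > 0"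
    and \<delta>': "\<delta> + real (d - q * d0) / real d \<le> \<delta>'"
  shows "(\<lambda>a\<in>span_I. block_map d0 q d \<sigma> (\<phi> a)) \<in> SA G \<mu> F n \<delta>' d"
proof (rule SA_I)
  let ?\<psi> = "\<lambda>a\<in>span_I. block_map d0 q d \<sigma> (\<phi> a)"
  note lin = linear_mapsD[OF SA_D(1)[OF \<phi>]]
  have "\<delta> \<le> \<delta> + real (d - q * d0) / real d" by simp
  then have \<delta>\<delta>': "\<delta> \<le> \<delta>'" using \<delta>' by linarith
  show "?\<psi> \<in> linear_maps G \<mu> d"
    unfolding linear_maps_def Let_def
    using span_I_add span_I_scale lin block_map_add[OF d0 qd \<sigma>] block_map_smult[OF d0 qd \<sigma>] by simp
  fix ss assume ss: "ss \<noteq> []" "length ss \<le> n" "set ss \<subseteq> F \<union> op_adjoint \<nu> ` F"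
  then have ssI: "set ss \<subseteq> I_groupoid G \<mu>" using adjoint_closed_subset[OF F] by blast
  then have pI: "op_prod \<nu> ss \<in> span_I" using I_groupoid_prod[OF ss(1)] I_groupoid_subset_span by blast
  have ssV: "set ss \<subseteq> span_I" using ssI I_groupoid_subset_span by blast
  have car: "set (map \<phi> ss) \<subseteq> carrier_mat d0 d0" using lin(1) ssV by auto
  have map_eq: "map ?\<psi> ss = map (block_map d0 q d \<sigma>) (map \<phi> ss)" using ssV by auto
  note prod = block_map_list_prod[OF d0 qd \<sigma> _ car]
  have ne: "map \<phi> ss \<noteq> []" using ss(1) by simp
  note pcar = lin(1)[OF pI]
  have "?\<psi> (op_prod \<nu> ss) - mat_list_prod d (map ?\<psi> ss)
      = block_map d0 q d \<sigma> (\<phi> (op_prod \<nu> ss) - mat_list_prod d0 (map \<phi> ss))"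
    unfolding map_eq prod(2)[OF ne, symmetric] block_map_minus[OF d0 qd \<sigma> pcar prod(1)[OF ne]]
    using pI by simp
  then have "mat_norm2 (?\<psi> (op_prod \<nu> ss) - mat_list_prod d (map ?\<psi> ss))
      \<le> mat_norm2 (\<phi> (op_prod \<nu> ss) - mat_list_prod d0 (map \<phi> ss))"
    using block_map_norm[OF d0 qd \<sigma> minus_carrier_mat[OF prod(1)[OF ne]]] by simp
  then show "mat_norm2 (?\<psi> (op_prod \<nu> ss) - mat_list_prod d (map ?\<psi> ss)) < \<delta>'"
    using SA_D(2)[OF \<phi> ss] \<delta>\<delta>' by linarith
  note pp = SA_D(3)[OF \<phi> ss]
  show "?\<psi> (op_prod \<nu> ss) \<in> partial_permutation_mats d"
    using pI block_map_partial_permutation[OF d0 qd \<sigma> pp] by simp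
  define c where "c = real (q * d0) / real d"
  have c: "1 - c = real (d - q * d0) / real d" "0 \<le> 1 - c"
    using qd d of_nat_mono[OF qd, where 'a = real] unfolding c_def
    by (simp_all only: of_nat_diff) (simp_all add: field_simps)
  let ?t = "ntrace (\<phi> (op_prod \<nu> ss))"
  have "ntrace (?\<psi> (op_prod \<nu> ss)) = of_real c * ?t"
    using pI block_map_ntrace[OF d0 qd \<sigma> pcar] by (simp add: c_def)
  then have "cmod (ntrace (?\<psi> (op_prod \<nu> ss)) - vn_trace G \<mu> (op_prod \<nu> ss))
      = cmod ((?t - vn_trace G \<mu> (op_prod \<nu> ss)) - of_real (1 - c) * ?t)"
    by (simp add: algebra_simps)
  also have "\<dots> \<le> cmod (?t - vn_trace G \<mu> (op_prod \<nu> ss)) + cmod (of_real (1 - c) * ?t)"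
    by (rule norm_triangle_ineq4)
  also have "\<dots> < \<delta> + (1 - c) * 1"
  proof (rule add_less_le_mono)
    show "cmod (?t - vn_trace G \<mu> (op_prod \<nu> ss)) < \<delta>" by (rule SA_D(4)[OF \<phi> ss])
    show "cmod (of_real (1 - c) * ?t) \<le> (1 - c) * 1"
      unfolding norm_mult norm_of_real using c(2) cmod_ntrace_partial_permutation_le_1[OF pp]
      by (intro mult_mono) auto
  qed
  also have "\<dots> \<le> \<delta>'" using \<delta>' by (simp only: c(1) mult_1_right)
  finally show "cmod (ntrace (?\<psi> (op_prod \<nu> ss)) - vn_trace G \<mu> (op_prod \<nu> ss)) < \<delta>'" .
qed

lemma SA_pair:
  assumes \<phi>: "\<phi> \<in> SA G \<mu> F n \<delta> d" and F: "F \<subseteq> I_groupoid G \<mu>" and n: "2 \<le> n"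
    and s: "s \<in> F" and t: "t \<in> F"
  shows "\<phi> s \<in> partial_permutation_mats d" "\<phi> t \<in> partial_permutation_mats d"
    "\<phi> (op_mult \<nu> s t) \<in> partial_permutation_mats d"
    "real (card {(u, v). u < d \<and> v < d \<and> \<phi> (op_mult \<nu> s t) $$ (u, v) \<noteq> (\<phi> s * \<phi> t) $$ (u, v)})
      \<le> real d * \<delta>\<^sup>2"
    "cmod (ntrace (\<phi> (op_mult \<nu> s t)) - vn_trace G \<mu> (op_mult \<nu> s t)) < \<delta>"
proof -
  have I: "s \<in> I_groupoid G \<mu>" "t \<in> I_groupoid G \<mu>" using s t F by auto
  have "op_prod \<nu> [s, t] = op_mult \<nu> s (op_prod \<nu> [t])" by (simp add: op_prod_def)
  then have pair: "op_prod \<nu> [s, t] = op_mult \<nu> s t" by (simp add: op_prod_single[OF I(2)])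
  have single: "\<phi> r \<in> partial_permutation_mats d" if "r \<in> F" for r
    using SA_D(3)[OF \<phi>, of "[r]"] that n F op_prod_single[of r] by auto
  show st: "\<phi> s \<in> partial_permutation_mats d" "\<phi> t \<in> partial_permutation_mats d"
    using single s t by auto
  show P: "\<phi> (op_mult \<nu> s t) \<in> partial_permutation_mats d"
    using SA_D(3)[OF \<phi>, of "[s, t]"] s t n pair by auto
  show "cmod (ntrace (\<phi> (op_mult \<nu> s t)) - vn_trace G \<mu> (op_mult \<nu> s t)) < \<delta>"
    using SA_D(4)[OF \<phi>, of "[s, t]"] s t n pair by auto
  have "mat_list_prod d (map \<phi> [s, t]) = \<phi> s * \<phi> t"
    using partial_permutation_matsD(1)[OF st(2)] by (simp add: mat_list_prod_def)
  then have "mat_norm2 (\<phi> (op_mult \<nu> s t) - \<phi> s * \<phi> t) < \<delta>"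
    using SA_D(2)[OF \<phi>, of "[s, t]"] s t n pair by auto
  then show "real (card {(u, v). u < d \<and> v < d \<and> \<phi> (op_mult \<nu> s t) $$ (u, v) \<noteq> (\<phi> s * \<phi> t) $$ (u, v)})
      \<le> real d * \<delta>\<^sup>2"
    by (rule card_differing_entries[OF P st(2) st(1)])
qed

text \<open>The cardinality counts the nonzero diagonal entries of \<open>\<phi> s * \<phi> t\<close>. These are nearly the same as
  those of \<open>\<phi> (s t)\<close>, whose number is \<open>d\<close> times a normalized trace.\<close>

lemma SA_pair_fixed_points:
  assumes \<phi>: "\<phi> \<in> SA G \<mu> F n \<delta> d" and F: "F \<subseteq> I_groupoid G \<mu>" and n: "2 \<le> n"
    and s: "s \<in> F" and t: "t \<in> F" and \<delta>: "0 < \<delta>" "\<delta> \<le> 1" and d: "d > 0"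
    and \<tau>: "vn_trace G \<mu> (op_mult \<nu> s t) = complex_of_real \<tau>"
  shows "\<bar>real (card {v. v < d \<and> (\<exists>w<d. \<phi> s $$ (v, w) \<noteq> 0 \<and> \<phi> t $$ (w, v) \<noteq> 0)}) - real d * \<tau>\<bar>
    \<le> real d * (2 * \<delta>)"
proof -
  note P = SA_pair[OF \<phi> F n s t]
  let ?P = "\<phi> (op_mult \<nu> s t)" and ?Q = "\<phi> s * \<phi> t"
  define A where "A = {v. v < d \<and> ?P $$ (v, v) \<noteq> 0}"
  define B where "B = {v. v < d \<and> ?Q $$ (v, v) \<noteq> 0}"
  define D where "D = {(u, v). u < d \<and> v < d \<and> ?P $$ (u, v) \<noteq> ?Q $$ (u, v)}"
  define D' where "D' = {v. v < d \<and> ?P $$ (v, v) \<noteq> ?Q $$ (v, v)}"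
  have fin: "finite A" "finite B" "finite D'" by (auto simp: A_def B_def D'_def)
  have finD: "finite D" by (rule finite_subset[of _ "{..<d} \<times> {..<d}"]) (auto simp: D_def)
  have B_eq: "B = {v. v < d \<and> (\<exists>w<d. \<phi> s $$ (v, w) \<noteq> 0 \<and> \<phi> t $$ (w, v) \<noteq> 0)}"
    unfolding B_def using partial_permutation_mult_entry(2)[OF P(2) P(1)] by blast
  have "card D' \<le> card D"
    by (rule card_inj_on_le[where f = "\<lambda>v. (v, v)"]) (auto simp: inj_on_def D'_def D_def finD[unfolded D_def])
  moreover have "real (card D) \<le> real d * \<delta>\<^sup>2" using P(4) by (simp add: D_def)
  ultimately have D': "real (card D') \<le> real d * \<delta>\<^sup>2" by linarith
  have "card A \<le> card (B \<union> D')" by (intro card_mono) (use fin in \<open>auto simp: A_def B_def D'_def\<close>)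
  then have AB: "real (card A) \<le> real (card B) + real (card D')" using card_Un_le[of B D'] by linarith
  have "card B \<le> card (A \<union> D')" by (intro card_mono) (use fin in \<open>auto simp: A_def B_def D'_def\<close>)
  then have BA: "real (card B) \<le> real (card A) + real (card D')" using card_Un_le[of A D'] by linarith
  have "\<bar>real (card A) / real d - \<tau>\<bar> < \<delta>"
  proof -
    have "ntrace ?P - complex_of_real \<tau> = complex_of_real (real (card A) / real d - \<tau>)"
      unfolding partial_permutation_ntrace[OF P(3)] A_def by simp
    then show ?thesis using P(5) unfolding \<tau> by (simp only: norm_of_real)
  qed
  then have "real d * \<bar>real (card A) / real d - \<tau>\<bar> \<le> real d * \<delta>" by (intro mult_left_mono) auto
  then have "\<bar>real d * (real (card A) / real d - \<tau>)\<bar> \<le> real d * \<delta>" by (simp add: abs_mult)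
  then have A: "\<bar>real (card A) - real d * \<tau>\<bar> \<le> real d * \<delta>" using d by (simp add: right_diff_distrib)
  have "\<delta>\<^sup>2 \<le> \<delta>" using \<delta> by (simp add: power2_eq_square mult_left_le)
  then have "real d * \<delta>\<^sup>2 \<le> real d * \<delta>" by (intro mult_left_mono) auto
  then show ?thesis unfolding B_eq[symmetric] using A AB BA D' by (simp add: algebra_simps)
qed

lemma SA_zero:
  assumes "\<phi> \<in> SA G \<mu> F n \<delta> d"
  shows "\<phi> (bisection_op G \<mu> {}) = 0\<^sub>m d d"
proof -
  have "({} :: 'g set) \<in> bisections" by (simp add: bisections_def)
  then have V: "bisection_op G \<mu> {} \<in> span_I" using bisection_op_I I_groupoid_subset_span by blast
  note lin = linear_mapsD[OF SA_D(1)[OF assms]]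
  have "\<phi> (bisection_op G \<mu> {}) = 0 \<cdot>\<^sub>m \<phi> (bisection_op G \<mu> {})"
    using lin(3)[OF V, of 0] unfolding op_scale_empty_bisection .
  also have "\<dots> = 0\<^sub>m d d" using lin(1)[OF V] by auto
  finally show ?thesis .
qed

text \<open>The graph is the one with an edge from \<open>v\<close> to \<open>w\<close> if the matrix of some \<open>T l k\<close> has a nonzero entry at
  \<open>(w, v)\<close>. A bisection and its inverse have the product trace \<open>measure \<nu> (T l k)\<close>, which gives the size
  of the domain; trace 0 for two different bisections says that they seldom agree; disjoint sources make
  the product with an inverse zero, so that the domains are almost disjoint.\<close>

lemma SA_low_degree:
  assumes \<phi>: "\<phi> \<in> SA G \<mu> F n \<delta> d" and F: "F \<subseteq> I_groupoid G \<mu>" and n: "2 \<le> n"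
    and \<delta>: "0 < \<delta>" "\<delta> \<le> 1" and d: "d > 0"
    and T: "\<And>l k. T l k \<in> regular_bisections"
      "\<And>l k l' k'. (l, k) \<noteq> (l', k') \<Longrightarrow> T l k \<inter> T l' k' = {}"
      "\<And>l k k'. k \<noteq> k' \<Longrightarrow> src G ` T l k \<inter> src G ` T l k' = {}"
      "\<And>l. l < L \<Longrightarrow> (\<Sum>k<K. measure \<nu> (T l k)) \<ge> 1 - \<eta>"
    and TF: "\<And>l k. l < L \<Longrightarrow> k < K \<Longrightarrow> bisection_op G \<mu> (T l k) \<in> F"
      "\<And>l k. l < L \<Longrightarrow> k < K \<Longrightarrow> bisection_op G \<mu> (ginv G ` T l k) \<in> F"
  shows "real (card {v\<in>{..<d}. \<not> L \<le> card {w\<in>{..<d}. \<exists>l<L. \<exists>k<K.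
      \<phi> (bisection_op G \<mu> (T l k)) $$ (w, v) \<noteq> 0}})
    \<le> real d * (real L * (\<eta> + real K * (2 * \<delta>) + real (K\<^sup>2) * (2 * \<delta>)) + real ((L * K)\<^sup>2) * (2 * \<delta>))"
proof -
  define A where "A l k = \<phi> (bisection_op G \<mu> (T l k))" for l k
  define B where "B l k = \<phi> (bisection_op G \<mu> (ginv G ` T l k))" for l k
  define a where "a l k v w \<longleftrightarrow> A l k $$ (w, v) \<noteq> 0" for l k v w
  define b where "b l k w v \<longleftrightarrow> l < L \<and> k < K \<and> B l k $$ (v, w) \<noteq> 0" for l k w v
  have fixed: "\<bar>real (card {v\<in>{..<d}. \<exists>w\<in>{..<d}. a l' k' v w \<and> b l k w v})
      - real d * measure \<nu> (T l k \<inter> T l' k')\<bar> \<le> real d * (2 * \<delta>)"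
    if "l < L" "k < K" "l' < L" "k' < K" for l k l' k'
  proof -
    have "{v\<in>{..<d}. \<exists>w\<in>{..<d}. a l' k' v w \<and> b l k w v}
        = {v. v < d \<and> (\<exists>w<d. B l k $$ (v, w) \<noteq> 0 \<and> A l' k' $$ (w, v) \<noteq> 0)}"
      using that by (auto simp: a_def b_def)
    then show ?thesis
      using SA_pair_fixed_points[OF \<phi> F n TF(2)[OF that(1,2)] TF(1)[OF that(3,4)] \<delta> d
          vn_trace_inverse_mult[OF T(1) T(1)]] by (simp add: A_def B_def)
  qed
  have "real (card {v\<in>{..<d}. \<not> L \<le> card {w\<in>{..<d}. \<exists>l<L. \<exists>k<K. a l k v w}})
    \<le> real d * (real L * (\<eta> + real K * (2 * \<delta>) + real (K\<^sup>2) * (2 * \<delta>)) + real ((L * K)\<^sup>2) * (2 * \<delta>))"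
  proof (rule card_low_degree_vertices[where b = b and m = "\<lambda>l k. measure \<nu> (T l k)"])
    fix l k w v v'
    assume "b l k w v" "b l k w v'" "w \<in> {..<d}" "v \<in> {..<d}" "v' \<in> {..<d}"
    then show "v = v'"
      using partial_permutation_unique(2)[OF SA_pair(1)[OF \<phi> F n TF(2) TF(2)], of l k l k w v v']
      by (simp add: b_def B_def)
  next
    fix l k assume lk: "l < L" "k < K"
    show "real d * (measure \<nu> (T l k) - 2 * \<delta>)
        \<le> real (card {v\<in>{..<d}. \<exists>w\<in>{..<d}. a l k v w \<and> b l k w v})"
      using fixed[OF lk lk] unfolding Int_absorb by (simp add: algebra_simps abs_le_iff)
  next
    fix l k l' k' assume lk: "l < L" "k < K" "l' < L" "k' < K" "(l, k) \<noteq> (l', k')"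
    show "real (card {v\<in>{..<d}. \<exists>w\<in>{..<d}. a l' k' v w \<and> b l k w v}) \<le> real d * (2 * \<delta>)"
      using fixed[OF lk(1-4)] unfolding T(2)[OF lk(5)] by simp
  next
    fix l k k' assume lk: "l < L" "k < K" "k' < K" "k \<noteq> k'"
    note P = SA_pair[OF \<phi> F n TF(1)[OF lk(1,2)] TF(2)[OF lk(1,3)],
        unfolded bisection_op_mult_disjoint[OF T(1) T(1) T(3)[OF lk(4)]] SA_zero[OF \<phi>]]
    have "{(u, w)\<in>{..<d} \<times> {..<d}. \<exists>v\<in>{..<d}. b l k' w v \<and> a l k v u}
        = {(u, w). u < d \<and> w < d \<and> 0\<^sub>m d d $$ (u, w) \<noteq> (A l k * B l k') $$ (u, w)}"
    proof -
      have "(\<exists>v\<in>{..<d}. b l k' w v \<and> a l k v u) \<longleftrightarrow> (A l k * B l k') $$ (u, w) \<noteq> 0"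
        if "u < d" "w < d" for u w
        using partial_permutation_mult_entry(2)[OF P(2) P(1) that] lk
        by (auto simp: a_def b_def A_def B_def)
      note entry = this
      show ?thesis
      proof (rule Set.set_eqI)
        fix p :: "nat \<times> nat"
        obtain u w where p: "p = (u, w)" by fastforce
        show "p \<in> {(u, w)\<in>{..<d} \<times> {..<d}. \<exists>v\<in>{..<d}. b l k' w v \<and> a l k v u} \<longleftrightarrow>
            p \<in> {(u, w). u < d \<and> w < d \<and> 0\<^sub>m d d $$ (u, w) \<noteq> (A l k * B l k') $$ (u, w)}"
        proof (cases "u < d \<and> w < d")
          case True
          then have "0\<^sub>m d d $$ (u, w) \<noteq> (A l k * B l k') $$ (u, w) \<longleftrightarrow> (A l k * B l k') $$ (u, w) \<noteq> 0"
            by auto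
          then show ?thesis using True entry[of u w] unfolding p by simp
        qed (auto simp: p)
      qed
    qed
    then have "real (card {(u, w)\<in>{..<d} \<times> {..<d}. \<exists>v\<in>{..<d}. b l k' w v \<and> a l k v u}) \<le> real d * \<delta>\<^sup>2"
      using P(4) by (simp add: A_def B_def)
    also have "\<dots> \<le> real d * (2 * \<delta>)"
    proof (rule mult_left_mono)
      have "\<delta>\<^sup>2 \<le> \<delta>" using \<delta> by (simp add: power2_eq_square mult_left_le)
      then show "\<delta>\<^sup>2 \<le> 2 * \<delta>" using \<delta> by linarith
    qed simp
    finally show "real (card {(u, w)\<in>{..<d} \<times> {..<d}. \<exists>v\<in>{..<d}. b l k' w v \<and> a l k v u})
        \<le> real d * (2 * \<delta>)" .
  next
    show "1 - \<eta> \<le> (\<Sum>k<K. measure \<nu> (T l k))" if "l < L" for l by (rule T(4)[OF that])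
    show "0 \<le> 2 * \<delta>" using \<delta> by simp
  qed
  then show ?thesis by (simp add: a_def A_def)
qed

end

context pmp_groupoid
begin

text \<open>The approximations used are the conjugates \<open>\<psi> \<sigma>\<close> of one amplification of \<open>\<phi>\<close>. The set of all
  permutations splits into fibres over the restrictions of \<open>\<psi> \<sigma>\<close> to \<open>E\<close>, and each fibre is at most as
  large as the group \<open>P\<close> of symmetries of the graph.\<close>

lemma many_restrictions:
  assumes \<phi>: "\<phi> \<in> SA G \<mu> F n (\<delta> / 2) d0" and F: "F \<subseteq> I_groupoid G \<mu>" and n: "2 \<le> n"
    and \<delta>: "0 < \<delta>" "\<delta> \<le> 1" and d0: "d0 > 0" and d: "d \<ge> d0" "real d \<ge> 2 * real d0 / \<delta>"
    and T: "\<And>l k. T l k \<in> regular_bisections"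
      "\<And>l k l' k'. (l, k) \<noteq> (l', k') \<Longrightarrow> T l k \<inter> T l' k' = {}"
      "\<And>l k k'. k \<noteq> k' \<Longrightarrow> src G ` T l k \<inter> src G ` T l k' = {}"
      "\<And>l. l < L \<Longrightarrow> (\<Sum>k<K. measure \<nu> (T l k)) \<ge> 1 - \<eta>"
    and TF: "\<And>l k. l < L \<Longrightarrow> k < K \<Longrightarrow> bisection_op G \<mu> (T l k) \<in> F"
      "\<And>l k. l < L \<Longrightarrow> k < K \<Longrightarrow> bisection_op G \<mu> (ginv G ` T l k) \<in> F"
    and L: "L > 0"
    and small: "real L * (\<eta> + real K * (2 * \<delta>) + real (K\<^sup>2) * (2 * \<delta>)) + real ((L * K)\<^sup>2) * (2 * \<delta>)
      \<le> 2 / real L"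
    and E: "\<And>l k. l < L \<Longrightarrow> k < K \<Longrightarrow> bisection_op G \<mu> (T l k) \<in> E"
  obtains Y c where "Y \<subseteq> restrictions (SA G \<mu> F n \<delta> d) E" "finite Y" "fact d \<le> card Y * d ^ c"
    "real c \<le> 3 * real d / real L"
proof -
  have d_pos: "d > 0" using d0 d(1) by simp
  define q where "q = d div d0"
  have qd: "q * d0 \<le> d" by (simp add: q_def)
  have "d - q * d0 = d mod d0" unfolding q_def by (metis minus_div_mult_eq_mod)
  then have "real (d - q * d0) \<le> real d0" using d0 by (simp add: less_imp_le)
  also have "real d0 \<le> \<delta> / 2 * real d" using d(2) \<delta> by (simp add: field_simps)
  finally have "real (d - q * d0) / real d \<le> \<delta> / 2" using d_pos by (simp add: divide_le_eq)
  then have close: "\<delta> / 2 + real (d - q * d0) / real d \<le> \<delta>" by linarith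
  define \<psi> where "\<psi> \<sigma> = (\<lambda>a\<in>span_I. block_map d0 q d \<sigma> (\<phi> a))" for \<sigma>
  have \<psi>: "\<psi> \<sigma> \<in> SA G \<mu> F n \<delta> d" if "\<sigma> permutes {..<d}" for \<sigma>
    unfolding \<psi>_def by (rule SA_block_map[OF \<phi> F d0 qd that d_pos close])
  define V where "V = {..<d}"
  have V: "finite V" "V \<noteq> {}" "card V = d" using d_pos by (auto simp: V_def)
  define M where "M l k = block_map d0 q d id (\<phi> (bisection_op G \<mu> (T l k)))" for l k
  have span: "bisection_op G \<mu> (T l k) \<in> span_I" for l k
    using bisection_op_I[OF regular_bisectionsD(1)[OF T(1)]] I_groupoid_subset_span by blast
  have \<psi>_T: "\<psi> \<sigma> (bisection_op G \<mu> (T l k)) = block_map d0 q d \<sigma> (\<phi> (bisection_op G \<mu> (T l k)))"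
    for \<sigma> l k using span by (simp add: \<psi>_def)
  have \<psi>_id: "\<psi> id (bisection_op G \<mu> (T l k)) = M l k" for l k by (simp add: \<psi>_T M_def)
  have M_pp: "M l k \<in> partial_permutation_mats d" if "l < L" "k < K" for l k
    using SA_pair(1)[OF \<psi>[OF permutes_id] F n TF(1)[OF that] TF(1)[OF that]] by (simp add: \<psi>_id)
  define R where "R = {(v, w)\<in>V \<times> V. \<exists>l<L. \<exists>k<K. M l k $$ (w, v) \<noteq> 0}"
  have R: "R \<subseteq> V \<times> V" by (auto simp: R_def)
  define bad where "bad = {v\<in>V. \<not> L \<le> card {w. (v, w) \<in> R}}"
  define c where "c = card (V // graph_component V R)"
  have "L * c \<le> d + L * card bad"
    unfolding c_def V(3)[symmetric]
    by (rule card_graph_components[OF V(1) R]) (auto simp: bad_def V(1))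
  moreover have "real (card bad) \<le> 2 * real d / real L"
  proof -
    have "bad = {v\<in>{..<d}. \<not> L \<le> card {w\<in>{..<d}. \<exists>l<L. \<exists>k<K. \<psi> id (bisection_op G \<mu> (T l k)) $$ (w, v) \<noteq> 0}}"
      unfolding bad_def \<psi>_id R_def V_def by (auto intro!: arg_cong[where f = card])
    then have bad_eq: "card bad = card {v\<in>{..<d}.
        \<not> L \<le> card {w\<in>{..<d}. \<exists>l<L. \<exists>k<K. \<psi> id (bisection_op G \<mu> (T l k)) $$ (w, v) \<noteq> 0}}"
      by (rule arg_cong)
    have "real (card bad) \<le> real d * (real L * (\<eta> + real K * (2 * \<delta>) + real (K\<^sup>2) * (2 * \<delta>))
        + real ((L * K)\<^sup>2) * (2 * \<delta>))"
      unfolding bad_eq by (rule SA_low_degree[OF \<psi>[OF permutes_id] F n \<delta> d_pos T TF])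
    also have "\<dots> \<le> real d * (2 / real L)" by (rule mult_left_mono[OF small]) simp
    finally show ?thesis by (simp add: mult.commute)
  qed
  ultimately have c: "real c \<le> 3 * real d / real L"
  proof -
    assume 1: "L * c \<le> d + L * card bad" and 2: "real (card bad) \<le> 2 * real d / real L"
    have "real L * real c \<le> real d + real L * real (card bad)"
      using of_nat_mono[OF 1, where 'a = real] by simp
    also have "\<dots> \<le> real d + real L * (2 * real d / real L)"
      using 2 by (intro add_left_mono mult_left_mono) auto
    also have "\<dots> = 3 * real d" using L by simp
    finally show ?thesis using L by (simp add: field_simps)
  qed
  define P where "P = {p. p permutes V \<and> (\<forall>l<L. \<forall>k<K. \<forall>i\<in>V. \<forall>j\<in>V. M l k $$ (p i, p j) = M l k $$ (i, j))}"
  have finPerm: "finite {p. p permutes V}" using finite_permutations[OF V(1)] by simp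
  have finP: "finite P" by (rule finite_subset[OF _ finPerm]) (auto simp: P_def)
  have cardP: "card P \<le> d ^ c"
    unfolding c_def V(3)[symmetric]
  proof (rule card_edge_determined_maps[OF V(1,2) R])
    show "p ` V \<subseteq> V" if "p \<in> P" for p using that permutes_image[of p V] by (auto simp: P_def)
    show "p x = x" if "p \<in> P" "x \<notin> V" for p x using that permutes_not_in[of p V] by (auto simp: P_def)
    fix p p' a b assume p: "p \<in> P" "p' \<in> P" and ab: "(a, b) \<in> R"
    obtain l k where lk: "l < L" "k < K" "M l k $$ (b, a) \<noteq> 0" and V': "a \<in> V" "b \<in> V"
      using ab by (auto simp: R_def)
    have in_V: "p a < d" "p b < d" "p' a < d" "p' b < d"
      using p V' permutes_in_image[of p V] permutes_in_image[of p' V] by (auto simp: P_def V_def)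
    have ne: "M l k $$ (p b, p a) \<noteq> 0" "M l k $$ (p' b, p' a) \<noteq> 0"
      using p lk V' by (auto simp: P_def)
    show "p a = p' a \<longleftrightarrow> p b = p' b"
    proof
      assume "p a = p' a"
      then show "p b = p' b"
        using partial_permutation_unique(2)[OF M_pp[OF lk(1,2)] in_V(1,2,4)] ne by simp
    next
      assume "p b = p' b"
      then show "p a = p' a"
        using partial_permutation_unique(1)[OF M_pp[OF lk(1,2)] in_V(2,1,3)] ne by simp
    qed
  qed
  define f where "f \<sigma> = restrict (\<psi> \<sigma>) E" for \<sigma>
  define Y where "Y = f ` {p. p permutes V}"
  have fibre: "card {\<sigma>' \<in> {p. p permutes V}. f \<sigma>' = f \<sigma>} \<le> d ^ c" if "\<sigma> \<in> {p. p permutes V}" for \<sigma>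
  proof -
    have \<sigma>: "\<sigma> permutes V" using that by simp
    have "card {\<sigma>' \<in> {p. p permutes V}. f \<sigma>' = f \<sigma>} \<le> card P"
    proof (rule card_inj_on_le[where f = "\<lambda>\<sigma>'. \<sigma>' \<circ> Hilbert_Choice.inv \<sigma>"])
      show "inj_on (\<lambda>\<sigma>'. \<sigma>' \<circ> Hilbert_Choice.inv \<sigma>) {\<sigma>' \<in> {p. p permutes V}. f \<sigma>' = f \<sigma>}"
      proof (rule inj_onI)
        fix \<sigma>1 \<sigma>2 assume "\<sigma>1 \<circ> Hilbert_Choice.inv \<sigma> = \<sigma>2 \<circ> Hilbert_Choice.inv \<sigma>"
        then have "\<sigma>1 \<circ> (Hilbert_Choice.inv \<sigma> \<circ> \<sigma>) = \<sigma>2 \<circ> (Hilbert_Choice.inv \<sigma> \<circ> \<sigma>)" by (simp add: comp_assoc[symmetric])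
        then show "\<sigma>1 = \<sigma>2" using permutes_inv_o(2)[OF \<sigma>] by simp
      qed
      show "(\<lambda>\<sigma>'. \<sigma>' \<circ> Hilbert_Choice.inv \<sigma>) ` {\<sigma>' \<in> {p. p permutes V}. f \<sigma>' = f \<sigma>} \<subseteq> P"
      proof
        fix p assume "p \<in> (\<lambda>\<sigma>'. \<sigma>' \<circ> Hilbert_Choice.inv \<sigma>) ` {\<sigma>' \<in> {p. p permutes V}. f \<sigma>' = f \<sigma>}"
        then obtain \<sigma>' where \<sigma>': "\<sigma>' permutes V" "f \<sigma>' = f \<sigma>" "p = \<sigma>' \<circ> Hilbert_Choice.inv \<sigma>" by auto
        have "M l k $$ (p i, p j) = M l k $$ (i, j)" if lk: "l < L" "k < K" and ij: "i \<in> V" "j \<in> V" for l k i j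
        proof -
          let ?A = "\<phi> (bisection_op G \<mu> (T l k))"
          have "\<psi> \<sigma>' (bisection_op G \<mu> (T l k)) = \<psi> \<sigma> (bisection_op G \<mu> (T l k))"
            using fun_cong[OF \<sigma>'(2), of "bisection_op G \<mu> (T l k)"] E[OF lk] by (simp add: f_def)
          then have eq: "block_map d0 q d \<sigma>' ?A = block_map d0 q d \<sigma> ?A" by (simp only: \<psi>_T)
          have inv: "Hilbert_Choice.inv \<sigma> i < d" "Hilbert_Choice.inv \<sigma> j < d"
            using permutes_in_image[OF permutes_inv[OF \<sigma>]] ij by (auto simp: V_def)
          have "M l k $$ (p i, p j) = block_map d0 q d \<sigma>' ?A $$ (Hilbert_Choice.inv \<sigma> i, Hilbert_Choice.inv \<sigma> j)"
            unfolding M_def \<sigma>'(3) using block_map_conjugate[OF \<sigma>'(1)[unfolded V_def] inv] by simp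
          also have "\<dots> = M l k $$ (\<sigma> (Hilbert_Choice.inv \<sigma> i), \<sigma> (Hilbert_Choice.inv \<sigma> j))"
            unfolding M_def eq using block_map_conjugate[OF \<sigma>[unfolded V_def] inv] by simp
          also have "\<dots> = M l k $$ (i, j)" by (simp add: permutes_inverses(1)[OF \<sigma>])
          finally show ?thesis .
        qed
        moreover have "p permutes V" unfolding \<sigma>'(3) by (rule permutes_compose[OF permutes_inv[OF \<sigma>] \<sigma>'(1)])
        ultimately show "p \<in> P" by (simp add: P_def)
      qed
    qed (rule finP)
    then show ?thesis using cardP by simp
  qed
  show thesis
  proof (rule that[of Y c])
    show "Y \<subseteq> restrictions (SA G \<mu> F n \<delta> d) E"
      using \<psi> by (auto simp: Y_def f_def restrictions_def V_def)
    show "finite Y" unfolding Y_def using finPerm by simp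
    have "card {p. p permutes V} = fact d" by (rule card_permutations[OF V(3,1)])
    then show "fact d \<le> card Y * d ^ c"
      using card_le_card_image_mult_fibre[OF finPerm fibre] by (simp add: Y_def)
  qed (rule c)
qed

end

text \<open>The error term \<open>1 / ln d\<close> comes from \<open>ln (d!) \<ge> d ln d - d\<close>, and \<open>c ln d \<le> a d ln d\<close>.\<close>

lemma log_card_ge:
  assumes Y: "Y \<subseteq> Z" "finite Y" and fact: "fact d \<le> card Y * d ^ c" and c: "real c \<le> a * real d"
    and d: "d \<ge> 2"
  shows "ereal (1 - 1 / ln (real d) - a) \<le> ereal (1 / (real d * ln (real d))) * log_card Z"
proof -
  have ln_pos: "ln (real d) > 0" using d by simp
  have pos: "real d * ln (real d) > 0" using ln_pos d by simp
  show ?thesis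
  proof (cases "infinite Z")
    case True
    have "ereal p * \<infinity> = \<infinity>" if "p > 0" for p using that by simp
    from this[of "1 / (real d * ln (real d))"] show ?thesis using True pos by (simp only: log_card_def) simp
  next
    case False
    have "fact d > (0 :: nat)" by simp
    then have "card Y > 0" using fact by (metis gr0I mult_0 not_less)
    then have Y0: "Y \<noteq> {}" by auto
    then have Z0: "Z \<noteq> {}" using Y by blast
    have "real (fact d) \<le> real (card Y * d ^ c)" using fact by (rule of_nat_mono)
    then have "ln (fact d :: real) \<le> ln (real (card Y) * real d ^ c)"
      using \<open>card Y > 0\<close> d by (subst ln_le_cancel_iff) auto
    also have "\<dots> = ln (real (card Y)) + real c * ln (real d)"
      using \<open>card Y > 0\<close> d by (simp add: ln_mult ln_realpow)
    also have "\<dots> \<le> ln (real (card Y)) + a * real d * ln (real d)"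
      using c ln_pos by (intro add_left_mono mult_right_mono) auto
    also have "ln (real (card Y)) \<le> ln (real (card Z))"
      using \<open>card Y > 0\<close> card_mono[OF _ Y(1)] False by (subst ln_le_cancel_iff) auto
    finally have "real d * ln (real d) - real d - a * real d * ln (real d) \<le> ln (real (card Z))"
      using ln_fact_ge[of d] by linarith
    then have "(real d * ln (real d) - real d - a * real d * ln (real d)) / (real d * ln (real d))
        \<le> ln (real (card Z)) / (real d * ln (real d))"
      using pos by (intro divide_right_mono) auto
    moreover have "(real d * ln (real d) - real d - a * real d * ln (real d)) / (real d * ln (real d))
        = 1 - 1 / ln (real d) - a"
      using ln_pos d by (simp add: field_simps)
    ultimately show ?thesis using False Z0 by (simp add: log_card_def)
  qed
qed

text \<open>Approximations of higher precision for a larger set \<open>F'\<close> are among those for \<open>F\<close>. So \<open>F\<close> may be taken to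
  contain the operators of the bisections and of their inverses, and the precision may be adapted to the
  number of bisections.\<close>

lemma (in pmp_groupoid) sofic_dim_ge:
  fixes K L n :: nat and T :: "nat \<Rightarrow> nat \<Rightarrow> 'g set"
  assumes sofic: "sofic G \<mu>" and L: "L > 0"
    and T: "\<And>l k. T l k \<in> regular_bisections"
      "\<And>l k l' k'. (l, k) \<noteq> (l', k') \<Longrightarrow> T l k \<inter> T l' k' = {}"
      "\<And>l k k'. k \<noteq> k' \<Longrightarrow> src G ` T l k \<inter> src G ` T l k' = {}"
      "\<And>l. l < L \<Longrightarrow> (\<Sum>k<K. measure \<nu> (T l k)) \<ge> 1 - 1 / (real L)\<^sup>2"
    and F: "finite F" "F \<subseteq> I_groupoid G \<mu>" and n: "n \<ge> 1" and \<delta>: "\<delta> > 0"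
    and E_def: "E = (\<lambda>(l, k). bisection_op G \<mu> (T l k)) ` ({..<L} \<times> {..<K})"
  shows "ereal (1 - 3 / real L) \<le> sofic_dim_EFn\<delta> G \<mu> E F n \<delta>"
proof -
  define E' where "E' = (\<lambda>(l, k). bisection_op G \<mu> (ginv G ` T l k)) ` ({..<L} \<times> {..<K})"
  define F' where "F' = F \<union> (E \<union> E')"
  have E_I: "E \<subseteq> I_groupoid G \<mu>" unfolding E_def
    using bisection_op_I[OF regular_bisectionsD(1)[OF T(1)]] by auto
  have E'_I: "E' \<subseteq> I_groupoid G \<mu>" unfolding E'_def
    using bisection_op_I[OF inverse_bisection[OF regular_bisectionsD(1)[OF T(1)]]] by auto
  have F': "finite F'" "F' \<subseteq> I_groupoid G \<mu>"
    using F E_I E'_I by (auto simp: F'_def E_def E'_def)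
  define n' where "n' = max n 2"
  define B where "B = real L * real K + real L * real (K\<^sup>2) + real ((L * K)\<^sup>2) + 1"
  have B: "B \<ge> 1" by (simp add: B_def)
  \<comment> \<open>With this precision the vertices of low degree make up at most \<open>2 / L\<close> of all vertices: \<open>1 / L\<close> for
    the parts missed by the sections, and \<open>1 / L\<close> for the errors of the approximation.\<close>
  define \<delta>' where "\<delta>' = min \<delta> (1 / (2 * real L * B))"
  have LB: "2 * real L * B \<ge> 1"
  proof -
    have "1 * 1 \<le> (2 * real L) * B" using L B by (intro mult_mono) auto
    then show ?thesis by simp
  qed
  then have \<delta>': "0 < \<delta>'" "\<delta>' \<le> 1" "\<delta>' \<le> \<delta>" "\<delta>' \<le> 1 / (2 * real L * B)"
    using \<delta> L B by (auto simp: \<delta>'_def min_le_iff_disj)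
  have small: "real L * (1 / (real L)\<^sup>2 + real K * (2 * \<delta>') + real (K\<^sup>2) * (2 * \<delta>'))
      + real ((L * K)\<^sup>2) * (2 * \<delta>') \<le> 2 / real L"
  proof -
    have "real L * (1 / (real L)\<^sup>2 + real K * (2 * \<delta>') + real (K\<^sup>2) * (2 * \<delta>'))
        + real ((L * K)\<^sup>2) * (2 * \<delta>') = 1 / real L + 2 * \<delta>' * (B - 1)"
      using L by (simp add: B_def power2_eq_square algebra_simps)
    also have "\<dots> \<le> 1 / real L + 2 * \<delta>' * B" using \<delta>'(1) by (simp add: mult_left_mono)
    also have "2 * \<delta>' * B \<le> 1 / real L"
    proof -
      have "2 * B * \<delta>' \<le> 2 * B * (1 / (2 * real L * B))" using \<delta>'(4) B by (intro mult_left_mono) auto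
      also have "\<dots> = 1 / real L" using B L by simp
      finally show ?thesis by (simp add: mult_ac)
    qed
    finally show ?thesis by simp
  qed
  have "\<delta>' / 2 > 0" "n' \<ge> 1" using \<delta>' n by (auto simp: n'_def)
  then obtain d0 \<phi> where d0: "d0 \<ge> 1" and \<phi>: "\<phi> \<in> SA G \<mu> F' n' (\<delta>' / 2) d0"
    using sofic F' unfolding sofic_def by blast
  have bound: "ereal (1 - 1 / ln (real d) - 3 / real L)
      \<le> ereal (1 / (real d * ln (real d))) * log_card (restrictions (SA G \<mu> F n \<delta> d) E)"
    if d: "d \<ge> max 2 d0" "real d \<ge> 2 * real d0 / \<delta>'" for d
  proof -
    have TF: "bisection_op G \<mu> (T l k) \<in> F'" "bisection_op G \<mu> (ginv G ` T l k) \<in> F'"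
      "bisection_op G \<mu> (T l k) \<in> E" if "l < L" "k < K" for l k
      using that by (auto simp: F'_def E_def E'_def)
    have n2: "2 \<le> n'" by (simp add: n'_def)
    have d00: "0 < d0" "d0 \<le> d" using d0 d by auto
    obtain Y c where Y: "Y \<subseteq> restrictions (SA G \<mu> F' n' \<delta>' d) E" "finite Y" "fact d \<le> card Y * d ^ c"
      "real c \<le> 3 * real d / real L"
      by (rule many_restrictions[OF \<phi> F'(2) n2 \<delta>'(1,2) d00 d(2) T TF(1,2) L small TF(3)])
    have "SA G \<mu> F' n' \<delta>' d \<subseteq> SA G \<mu> F n \<delta> d"
      by (rule SA_mono) (use \<delta>'(3) in \<open>auto simp: F'_def n'_def\<close>)
    then have "Y \<subseteq> restrictions (SA G \<mu> F n \<delta> d) E"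
      using Y(1) unfolding restrictions_def by (meson image_mono subset_trans)
    then show ?thesis by (rule log_card_ge[OF _ Y(2,3)]) (use Y(4) d in auto)
  qed
  have "(\<lambda>d. 1 - 1 / ln (real d) - 3 / real L) \<longlonglongrightarrow> 1 - 0 - 3 / real L"
    by (intro tendsto_diff tendsto_const tendsto_divide_0[OF tendsto_const]
      filterlim_at_top_imp_at_infinity filterlim_compose[OF ln_at_top filterlim_real_sequentially])
  then have "(\<lambda>d. ereal (1 - 1 / ln (real d) - 3 / real L)) \<longlonglongrightarrow> ereal (1 - 3 / real L)" by simp
  then have "ereal (1 - 3 / real L) = liminf (\<lambda>d. ereal (1 - 1 / ln (real d) - 3 / real L))"
    by (rule lim_imp_Liminf[OF sequentially_bot, symmetric])
  also have "\<dots> \<le> sofic_dim_EFn\<delta> G \<mu> E F n \<delta>"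
    unfolding sofic_dim_EFn\<delta>_def
  proof (rule Liminf_mono)
    have "\<forall>\<^sub>F d in sequentially. d \<ge> max 2 d0" by (rule eventually_ge_at_top)
    moreover have "\<forall>\<^sub>F d in sequentially. real d \<ge> 2 * real d0 / \<delta>'"
      using filterlim_real_sequentially by (simp add: filterlim_at_top)
    ultimately show "\<forall>\<^sub>F d in sequentially. ereal (1 - 1 / ln (real d) - 3 / real L)
      \<le> ereal (1 / (real d * ln (real d))) * log_card (restrictions (SA G \<mu> F n \<delta> d) E)"
      by eventually_elim (rule bound)
  qed
  finally show ?thesis .
qed

theorem proposition2p14:
  fixes G :: "'g groupoid_data" and \<mu> :: "'g measure"
  assumes "pmp_groupoid G \<mu>"
    and "sofic G \<mu>"
    and "infinite_classes G \<mu>"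
  shows "lower_sofic_dim G \<mu> \<ge> 1"
proof -
  interpret pmp_groupoid G \<mu> by fact
  have bound: "ereal (1 - 3 / real L) \<le> lower_sofic_dim G \<mu>" if L: "L \<ge> 1" for L :: nat
  proof -
    have "1 / (real L)\<^sup>2 > 0" using L by simp
    then obtain K :: nat and T :: "nat \<Rightarrow> nat \<Rightarrow> 'g set" where T:
      "\<And>l k. T l k \<in> regular_bisections"
      "\<And>l k l' k'. (l, k) \<noteq> (l', k') \<Longrightarrow> T l k \<inter> T l' k' = {}"
      "\<And>l k k'. k \<noteq> k' \<Longrightarrow> src G ` T l k \<inter> src G ` T l k' = {}"
      "\<And>l. l < L \<Longrightarrow> (\<Sum>k<K. measure \<nu> (T l k)) \<ge> 1 - 1 / (real L)\<^sup>2"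
      by (rule disjoint_bisections_exist[OF assms(3), of _ L]) blast
    define E where "E = (\<lambda>(l, k). bisection_op G \<mu> (T l k)) ` ({..<L} \<times> {..<K})"
    have E: "finite E" "E \<subseteq> I_groupoid G \<mu>"
      using bisection_op_I[OF regular_bisectionsD(1)[OF T(1)]] by (auto simp: E_def)
    have "L > 0" using L by simp
    note ge = sofic_dim_ge[OF assms(2) this T _ _ _ _ E_def]
    have "ereal (1 - 3 / real L) \<le> (INF F\<in>{F. finite F \<and> F \<subseteq> I_groupoid G \<mu>}. sofic_dim_EF G \<mu> E F)"
      unfolding sofic_dim_EF_def sofic_dim_EFn_def
      by (intro INF_greatest ge) auto
    also have "\<dots> \<le> lower_sofic_dim G \<mu>"
      unfolding lower_sofic_dim_def using E by (intro SUP_upper) auto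
    finally show ?thesis .
  qed
  have "(\<lambda>L. ereal (1 - 3 / real L)) \<longlonglongrightarrow> ereal (1 - 0)"
    by (intro tendsto_ereal tendsto_diff tendsto_const lim_const_over_n)
  then have "ereal (1 - 0) \<le> lower_sofic_dim G \<mu>"
    by (rule LIMSEQ_le_const2) (use bound in blast)
  then show ?thesis by (simp add: one_ereal_def)
qed

end
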